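(* Let $I\subseteq\mathbb{R}$ be an interval and let \[ P(t)(z) = z^n + \sum_{j=1}^n (-1)^j a_j(t) z^{n-j}, \qquad t\in I, \] be a curve of monic polynomials whose coefficients $a_j : I\to\mathbb{C}$ are real analytic, or more generally belong to a quasianalytic class of $C^\infty$ functions. Then any continuous parameterization of the roots of $P$ is locally absolutely continuous.
   Context: A quasianalytic class of $C^\infty$ functions here means an algebra (closed under linear combinations and products, containing constants) of $C^\infty$ functions $I\to\mathbb{C}$ such that any member which is infinitely flat at some point of $I$ (all derivatives vanish there) is identically zero on $I$. A continuous parameterization of the roots of $P$ on $I$ is an $n$-tuple of continuous functions $\lambda_1,\ldots,\lambda_n : I \to \mathbb{C}$ such that $P(t)(z)=\prod_{j=1}^n (z-\lambda_j(t))$ for all $t\in I$. Locally absolutely continuous means that every point of $I$ has a neighborhood in $I$ on which the functions are absolutely continuous. *)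

theory Defs
  imports "HOL-Analysis.Analysis" "HOL-Computational_Algebra.Polynomial"
begin

text \<open>
  Functions on \<open>I\<close> are total functions on \<open>real\<close> whose values outside \<open>I\<close> are irrelevant:
  derivatives are taken within \<open>I\<close>, hence are one-sided at endpoints belonging to \<open>I\<close>.
\<close>

definition real_analytic_on :: "(real \<Rightarrow> complex) \<Rightarrow> real set \<Rightarrow> bool" where
  "real_analytic_on f I \<longleftrightarrow>
     (\<forall>t\<^sub>0\<in>I. \<exists>r>0. \<exists>c :: nat \<Rightarrow> complex. \<forall>t\<in>I. dist t t\<^sub>0 < r \<longrightarrow>
        (\<lambda>k. c k * of_real (t - t\<^sub>0) ^ k) sums f t)"

primrec higher_deriv_within :: "real set \<Rightarrow> nat \<Rightarrow> (real \<Rightarrow> complex) \<Rightarrow> real \<Rightarrow> complex" where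
  "higher_deriv_within I 0 f = f"
| "higher_deriv_within I (Suc k) f =
     (\<lambda>t. vector_derivative (higher_deriv_within I k f) (at t within I))"

definition smooth_within :: "(real \<Rightarrow> complex) \<Rightarrow> real set \<Rightarrow> bool" where
  "smooth_within f I \<longleftrightarrow> (\<forall>k. higher_deriv_within I k f differentiable_on I)"

text \<open>Derivatives of all orders include order \<open>0\<close>, i.e. the value at the point; otherwise
  nonzero constants would be infinitely flat.\<close>

definition infinitely_flat_at :: "(real \<Rightarrow> complex) \<Rightarrow> real set \<Rightarrow> real \<Rightarrow> bool" where
  "infinitely_flat_at f I t \<longleftrightarrow> (\<forall>k. higher_deriv_within I k f t = 0)"

definition quasianalytic_class :: "real set \<Rightarrow> (real \<Rightarrow> complex) set \<Rightarrow> bool" where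
  "quasianalytic_class I Q \<longleftrightarrow>
     (\<forall>f\<in>Q. smooth_within f I) \<and>
     (\<forall>c. (\<lambda>_. c) \<in> Q) \<and>
     (\<forall>f\<in>Q. \<forall>g\<in>Q. \<forall>c d. (\<lambda>t. c * f t + d * g t) \<in> Q) \<and>
     (\<forall>f\<in>Q. \<forall>g\<in>Q. (\<lambda>t. f t * g t) \<in> Q) \<and>
     (\<forall>f\<in>Q. (\<exists>t\<in>I. infinitely_flat_at f I t) \<longrightarrow> (\<forall>t\<in>I. f t = 0))"

definition monic_poly_curve :: "nat \<Rightarrow> (nat \<Rightarrow> real \<Rightarrow> complex) \<Rightarrow> real \<Rightarrow> complex poly" where
  "monic_poly_curve n a t = monom 1 n + (\<Sum>j=1..n. monom ((-1) ^ j * a j t) (n - j))"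

definition continuous_root_parameterization ::
  "real set \<Rightarrow> nat \<Rightarrow> (real \<Rightarrow> complex poly) \<Rightarrow> (nat \<Rightarrow> real \<Rightarrow> complex) \<Rightarrow> bool" where
  "continuous_root_parameterization I n P \<Lambda> \<longleftrightarrow>
     (\<forall>j\<in>{1..n}. continuous_on I (\<Lambda> j)) \<and>
     (\<forall>t\<in>I. \<forall>z. poly (P t) z = (\<Prod>j=1..n. z - \<Lambda> j t))"

text \<open>Absolute continuity of functions in the epsilon-delta sense, for finite families of
  non-overlapping compact intervals contained in \<open>S\<close>; unrelated to the library's
  \<open>absolutely_continuous\<close>, which is about measures.\<close>

definition abs_continuous_on :: "real set \<Rightarrow> (real \<Rightarrow> complex) \<Rightarrow> bool" where
  "abs_continuous_on S f \<longleftrightarrow>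
     (\<forall>\<epsilon>>0. \<exists>\<delta>>0. \<forall>(m::nat) u v.
        (\<forall>i<m. u i \<le> v i \<and> {u i..v i} \<subseteq> S) \<and>
        disjoint_family_on (\<lambda>i. {u i<..<v i}) {..<m} \<and>
        (\<Sum>i<m. v i - u i) < \<delta>
        \<longrightarrow> (\<Sum>i<m. dist (f (v i)) (f (u i))) < \<epsilon>)"

definition locally_abs_continuous_on :: "real set \<Rightarrow> (real \<Rightarrow> complex) \<Rightarrow> bool" where
  "locally_abs_continuous_on I f \<longleftrightarrow> (\<forall>t\<in>I. \<exists>r>0. abs_continuous_on (I \<inter> ball t r) f)"

end

theory Submission
  imports Defs
begin

text \<open>
  On either side of a point \<open>t\<^sub>0\<close> the coefficients, as functions of \<open>s = \<bar>t - t\<^sub>0\<bar>\<close>, lie in an algebra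
  of smooth germs in which only the zero germ is flat. The top nonvanishing generalised discriminant
  is a polynomial in the coefficients and hence nonflat, so any two continuous roots either coincide
  near \<open>t\<^sub>0\<close> or differ by at least \<open>c s\<^sup>M\<close>. This separation of the roots, unlike membership of
  the coefficients in the class, survives the steps of Puiseux's algorithm: centre the roots, pass to
  \<open>s \<mapsto> s\<^sup>N\<close> and divide the roots by \<open>s\<^sup>p\<close> according to the smallest slope of the Newton polygon,
  and split off a cluster of roots by Hensel's lemma. If the Newton polygon is empty, the centred
  roots are flat, hence all equal and zero. By induction on the degree, each root becomes
  Lipschitz in \<open>s\<close> after a substitution \<open>s \<mapsto> s\<^sup>N\<close>, so it is a Lipschitz function of
  \<open>\<bar>t - t\<^sub>0\<bar>\<^bsup>1/N\<^esup>\<close>.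
\<close>

section \<open>Germs at zero from the right\<close>

text \<open>The class is not assumed closed under division, substitution or factorisation, so the
  recursion runs on a notion of smoothness at 0 that is stable under these: nested expansions
  \<open>c + s * g\<close> of every order with a Lipschitz innermost term. Dividing by
  \<open>s\<close> costs one order, and a quadratic system with a factor \<open>s\<close> in front
  regains orders one at a time; this is the engine behind Hensel's lemma.

  Rescaled roots are known to be continuous only for \<open>s > 0\<close>. Their limits at 0 come
  from the limits of the coefficients together with connectedness of an interval. The cluster
  belonging to one limit is a proper subset of the roots: centring makes the limits sum to 0, so
  equal limits would all be 0, whereas the minimal slope keeps one nonleading coefficient nonzero in
  the limit.

  Discriminants enter as sums over all index maps because such sums factor into power sums, and
  Newton's identities place the power sums in the algebra.\<close>

text \<open>The point 0 is excluded because quotients by powers of \<open>s\<close> carry a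
  meaningless value there.\<close>

definition lip_germ :: "(real \<Rightarrow> complex) \<Rightarrow> bool" where
  "lip_germ f \<longleftrightarrow> (\<exists>r>0. \<exists>L. L-lipschitz_on {0<..<r} f)"

text \<open>An arbitrary eventual predicate \<open>Q\<close> replaces the interval so that the
  domains of several germs combine by \<open>eventually_conj\<close>.\<close>

lemma lip_germI:
  assumes "eventually Q (at_right 0)"
    and "\<And>s t. Q s \<Longrightarrow> Q t \<Longrightarrow> cmod (f s - f t) \<le> L * \<bar>s - t\<bar>"
  shows "lip_germ f"
proof -
  obtain r where r: "r > 0" "\<And>s. 0 < s \<Longrightarrow> s < r \<Longrightarrow> Q s"
    using assms(1) unfolding eventually_at_right_field by auto
  have "(max L 0)-lipschitz_on {0<..<r} f"
  proof (rule lipschitz_onI)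
    fix s t assume "s \<in> {0<..<r}" "t \<in> {0<..<r}"
    then have "cmod (f s - f t) \<le> L * \<bar>s - t\<bar>" using assms(2) r(2) by simp
    also have "\<dots> \<le> max L 0 * \<bar>s - t\<bar>" by (rule mult_right_mono) auto
    finally show "dist (f s) (f t) \<le> max L 0 * dist s t" by (simp add: dist_norm)
  qed simp
  with r(1) show ?thesis unfolding lip_germ_def by blast
qed

lemma lip_germE:
  assumes "lip_germ f"
  obtains Q L where "eventually Q (at_right 0)" "L \<ge> 0"
    "\<forall>s t. Q s \<longrightarrow> Q t \<longrightarrow> cmod (f s - f t) \<le> L * \<bar>s - t\<bar>"
proof -
  obtain r L where r: "r > 0" and L: "L-lipschitz_on {0<..<r} f"
    using assms unfolding lip_germ_def by blast
  show ?thesis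
  proof (rule that[of "\<lambda>s. s \<in> {0<..<r}" L])
    show "\<forall>\<^sub>F s in at_right 0. s \<in> {0<..<r}" using r by (rule eventually_at_right_real)
    show "L \<ge> 0" using L by (rule lipschitz_on_nonneg)
    show "\<forall>s t. s \<in> {0<..<r} \<longrightarrow> t \<in> {0<..<r} \<longrightarrow> cmod (f s - f t) \<le> L * \<bar>s - t\<bar>"
      using lipschitz_onD[OF L] by (simp add: dist_norm)
  qed
qed

lemma lip_germ_bounded:
  assumes "lip_germ f"
  obtains B where "B > 0" "\<forall>\<^sub>F s in at_right 0. cmod (f s) \<le> B"
proof -
  obtain Q L where Q: "eventually Q (at_right 0)" "L \<ge> 0"
    "\<forall>s t. Q s \<longrightarrow> Q t \<longrightarrow> cmod (f s - f t) \<le> L * \<bar>s - t\<bar>"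
    using lip_germE[OF assms] .
  have ev: "\<forall>\<^sub>F s in at_right 0. Q s \<and> 0 < s \<and> s < 1"
    using Q(1) eventually_at_right_real[OF zero_less_one] by eventually_elim auto
  \<comment> \<open>A fixed point \<open>u\<close> of the domain serves as reference; all distances
    to it stay below 1.\<close>
  then obtain u where u: "Q u" "0 < u" "u < 1"
    using eventually_happens[OF ev] by auto
  from ev have "\<forall>\<^sub>F s in at_right 0. cmod (f s) \<le> cmod (f u) + L + 1"
  proof eventually_elim
    case (elim s)
    have "cmod (f s) \<le> cmod (f u) + cmod (f s - f u)" by (metis add.commute diff_add_cancel norm_triangle_ineq)
    also have "cmod (f s - f u) \<le> L * \<bar>s - u\<bar>" using Q(3)[rule_format] elim u by auto
    also have "\<dots> \<le> L * 1" using elim u Q(2) by (intro mult_left_mono) auto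
    finally show ?case by simp
  qed
  moreover have "cmod (f u) + L + 1 > 0" using Q(2) by (simp add: add_nonneg_pos)
  ultimately show ?thesis using that by blast
qed

lemma lip_germ_cong:
  assumes "lip_germ f" "\<forall>\<^sub>F s in at_right 0. f s = g s"
  shows "lip_germ g"
proof -
  obtain Q L where Q: "eventually Q (at_right 0)" "L \<ge> 0"
    "\<forall>s t. Q s \<longrightarrow> Q t \<longrightarrow> cmod (f s - f t) \<le> L * \<bar>s - t\<bar>"
    using lip_germE[OF assms(1)] .
  show ?thesis
  proof (rule lip_germI[OF eventually_conj[OF Q(1) assms(2)]])
    show "cmod (g s - g t) \<le> L * \<bar>s - t\<bar>" if "Q s \<and> f s = g s" "Q t \<and> f t = g t" for s t
      using Q(3)[rule_format, of s t] that by metis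
  qed
qed

lemma lip_germ_const: "lip_germ (\<lambda>s. c)"
  by (rule lip_germI[of "\<lambda>_. True" _ 0]) simp_all

lemma lip_germ_ident: "lip_germ of_real"
proof (rule lip_germI[of "\<lambda>_. True" _ 1])
  show "cmod (of_real s - of_real t) \<le> 1 * \<bar>s - t\<bar>" for s t
    by (metis mult_1 norm_of_real of_real_diff order_refl)
qed simp

lemma lip_germ_add:
  assumes "lip_germ f" "lip_germ g"
  shows "lip_germ (\<lambda>s. f s + g s)"
proof -
  obtain Q L where Q: "eventually Q (at_right 0)" "L \<ge> 0"
    "\<forall>s t. Q s \<longrightarrow> Q t \<longrightarrow> cmod (f s - f t) \<le> L * \<bar>s - t\<bar>"
    using lip_germE[OF assms(1)] .
  obtain Q' L' where Q': "eventually Q' (at_right 0)" "L' \<ge> 0"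
    "\<forall>s t. Q' s \<longrightarrow> Q' t \<longrightarrow> cmod (g s - g t) \<le> L' * \<bar>s - t\<bar>"
    using lip_germE[OF assms(2)] .
  show ?thesis
  proof (rule lip_germI[OF eventually_conj[OF Q(1) Q'(1)], of _ "L + L'"])
    fix s t assume "Q s \<and> Q' s" "Q t \<and> Q' t"
    then have "cmod (f s - f t) + cmod (g s - g t) \<le> (L + L') * \<bar>s - t\<bar>"
      using Q(3)[rule_format, of s t] Q'(3)[rule_format, of s t] by (simp add: distrib_right)
    then show "cmod (f s + g s - (f t + g t)) \<le> (L + L') * \<bar>s - t\<bar>"
      using norm_triangle_ineq[of "f s - f t" "g s - g t"] by (simp add: algebra_simps)
  qed
qed

lemma lip_germ_mult:
  assumes "lip_germ f" "lip_germ g"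
  shows "lip_germ (\<lambda>s. f s * g s)"
proof -
  obtain Q L where Q: "eventually Q (at_right 0)" "L \<ge> 0"
    "\<forall>s t. Q s \<longrightarrow> Q t \<longrightarrow> cmod (f s - f t) \<le> L * \<bar>s - t\<bar>"
    using lip_germE[OF assms(1)] .
  obtain Q' L' where Q': "eventually Q' (at_right 0)" "L' \<ge> 0"
    "\<forall>s t. Q' s \<longrightarrow> Q' t \<longrightarrow> cmod (g s - g t) \<le> L' * \<bar>s - t\<bar>"
    using lip_germE[OF assms(2)] .
  obtain B where B: "B > 0" "\<forall>\<^sub>F s in at_right 0. cmod (f s) \<le> B" using lip_germ_bounded[OF assms(1)] .
  obtain B' where B': "B' > 0" "\<forall>\<^sub>F s in at_right 0. cmod (g s) \<le> B'" using lip_germ_bounded[OF assms(2)] .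
  have ev: "\<forall>\<^sub>F s in at_right 0. (Q s \<and> Q' s) \<and> cmod (f s) \<le> B \<and> cmod (g s) \<le> B'"
    using Q(1) Q'(1) B(2) B'(2) by eventually_elim auto
  show ?thesis
  proof (rule lip_germI[OF ev, of _ "B * L' + B' * L"])
    fix s t assume st: "(Q s \<and> Q' s) \<and> cmod (f s) \<le> B \<and> cmod (g s) \<le> B'"
      "(Q t \<and> Q' t) \<and> cmod (f t) \<le> B \<and> cmod (g t) \<le> B'"
    have "f s * g s - f t * g t = f s * (g s - g t) + (f s - f t) * g t" by (simp add: algebra_simps)
    then have "cmod (f s * g s - f t * g t) \<le> cmod (f s) * cmod (g s - g t) + cmod (f s - f t) * cmod (g t)"
      by (metis norm_mult norm_triangle_ineq)
    also have "\<dots> \<le> B * (L' * \<bar>s - t\<bar>) + (L * \<bar>s - t\<bar>) * B'"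
      using st Q(2) Q'(2) Q(3)[rule_format, of s t] Q'(3)[rule_format, of s t] B(1) B'(1) by (intro add_mono mult_mono) auto
    finally show "cmod (f s * g s - f t * g t) \<le> (B * L' + B' * L) * \<bar>s - t\<bar>"
      by (simp add: algebra_simps)
  qed
qed

lemma filterlim_power_at_right_0:
  assumes "N \<ge> 1"
  shows "filterlim (\<lambda>s::real. s ^ N) (at_right 0) (at_right 0)"
proof -
  have "((\<lambda>s::real. s ^ N) \<longlongrightarrow> 0 ^ N) (at_right 0)" by (intro tendsto_intros)
  moreover have "(0::real) ^ N = 0" using assms by simp
  moreover have "\<forall>\<^sub>F s in at_right (0::real). s ^ N \<in> {0<..} \<and> s ^ N \<noteq> 0"
    using eventually_at_right_less[of 0] by eventually_elim simp
  ultimately show ?thesis by (simp add: filterlim_at)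
qed

lemma eventually_power_at_right_0:
  assumes "N \<ge> 1" "eventually P (at_right (0::real))"
  shows "\<forall>\<^sub>F s in at_right 0. P (s ^ N)"
  using assms(2) filterlim_power_at_right_0[OF assms(1)] by (simp add: filterlim_iff)

text \<open>Telescoping factorisation of \<open>s ^ N - t ^ N\<close>: each of the \<open>N\<close>
  summands is at most \<open>b ^ (N - 1)\<close>. For \<open>N = 0\<close> both sides
  vanish.\<close>

lemma power_diff_bound:
  fixes s t b :: real
  assumes "0 \<le> s" "s \<le> b" "0 \<le> t" "t \<le> b"
  shows "\<bar>s ^ N - t ^ N\<bar> \<le> real N * b ^ (N - 1) * \<bar>s - t\<bar>"
proof (cases N)
  case (Suc k)
  have "s ^ N - t ^ N = (s - t) * (\<Sum>p<N. s ^ p * t ^ (k - p))"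
    using power_diff_sumr2[of s "Suc k" t] by (simp add: Suc mult.commute)
  moreover have "\<bar>\<Sum>p<N. s ^ p * t ^ (k - p)\<bar> \<le> (\<Sum>p<N. b ^ k)"
  proof (rule order_trans[OF sum_abs], rule sum_mono)
    fix p assume "p \<in> {..<N}"
    then have "b ^ k = b ^ p * b ^ (k - p)" using Suc by (simp flip: power_add)
    moreover have "s ^ p * t ^ (k - p) \<le> b ^ p * b ^ (k - p)"
      using assms by (intro mult_mono power_mono) auto
    ultimately show "\<bar>s ^ p * t ^ (k - p)\<bar> \<le> b ^ k" using assms by simp
  qed
  ultimately show ?thesis using Suc mult_left_mono[OF _ abs_ge_zero[of "s - t"], of "\<bar>\<Sum>p<N. s ^ p * t ^ (k - p)\<bar>" "N * b ^ k"]
    by (simp add: abs_mult mult_ac del: sum.lessThan_Suc)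
qed simp

lemma lip_germ_power_subst:
  assumes "lip_germ f" "N \<ge> 1"
  shows "lip_germ (\<lambda>s. f (s ^ N))"
proof -
  obtain Q L where Q: "eventually Q (at_right 0)" "L \<ge> 0"
    "\<forall>s t. Q s \<longrightarrow> Q t \<longrightarrow> cmod (f s - f t) \<le> L * \<bar>s - t\<bar>"
    using lip_germE[OF assms(1)] .
  have ev: "\<forall>\<^sub>F s in at_right 0. Q (s ^ N) \<and> 0 < s \<and> s < 1"
    using eventually_power_at_right_0[OF assms(2) Q(1)] eventually_at_right_real[OF zero_less_one]
    by eventually_elim auto
  show ?thesis
  proof (rule lip_germI[OF ev, of _ "L * N"])
    fix s t assume st: "Q (s ^ N) \<and> 0 < s \<and> s < 1" "Q (t ^ N) \<and> 0 < t \<and> t < 1"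
    have "cmod (f (s ^ N) - f (t ^ N)) \<le> L * \<bar>s ^ N - t ^ N\<bar>" using Q(3)[rule_format] st by blast
    also have "\<dots> \<le> L * (real N * 1 ^ (N - 1) * \<bar>s - t\<bar>)"
      using st Q(2) by (intro mult_left_mono[OF power_diff_bound]) auto
    finally show "cmod (f (s ^ N) - f (t ^ N)) \<le> L * N * \<bar>s - t\<bar>" by simp
  qed
qed

section \<open>Taylor expansions with Lipschitz remainder\<close>

text \<open>A Taylor polynomial of degree below \<open>k\<close> plus \<open>s ^ k\<close> times a
  Lipschitz germ, written in nested Horner form so that every closure property is an induction on
  \<open>k\<close>.\<close>

primrec taylor_germ :: "nat \<Rightarrow> (real \<Rightarrow> complex) \<Rightarrow> bool" where
  "taylor_germ 0 f = lip_germ f"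
| "taylor_germ (Suc k) f = (\<exists>c g. taylor_germ k g \<and> (\<forall>\<^sub>F s in at_right 0. f s = c + of_real s * g s))"

declare taylor_germ.simps(2) [simp del]

lemma taylor_germ_SucI:
  "taylor_germ k g \<Longrightarrow> \<forall>\<^sub>F s in at_right 0. f s = c + of_real s * g s \<Longrightarrow> taylor_germ (Suc k) f"
  by (auto simp: taylor_germ.simps)

lemma taylor_germ_SucE:
  assumes "taylor_germ (Suc k) f"
  obtains c g where "taylor_germ k g" "\<forall>\<^sub>F s in at_right 0. f s = c + of_real s * g s"
  using assms by (auto simp: taylor_germ.simps)

lemma taylor_germ_cong:
  assumes "taylor_germ k f" "\<forall>\<^sub>F s in at_right 0. f s = g s"
  shows "taylor_germ k g"
proof (cases k)
  case 0 then show ?thesis using assms lip_germ_cong by simp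
next
  case (Suc l)
  with assms(1) obtain c h where h: "taylor_germ l h" "\<forall>\<^sub>F s in at_right 0. f s = c + of_real s * h s"
    by (auto elim: taylor_germ_SucE)
  from h(2) assms(2) have "\<forall>\<^sub>F s in at_right 0. g s = c + of_real s * h s" by eventually_elim auto
  with h(1) Suc show ?thesis by (auto intro: taylor_germ_SucI)
qed

lemma taylor_germ_Suc_imp: "taylor_germ (Suc k) f \<Longrightarrow> taylor_germ k f"
proof (induction k arbitrary: f)
  case 0
  then obtain c g where g: "lip_germ g" and ev: "\<forall>\<^sub>F s in at_right 0. f s = c + of_real s * g s"
    by (auto elim: taylor_germ_SucE)
  have "lip_germ (\<lambda>s. c + of_real s * g s)"
    by (rule lip_germ_add[OF lip_germ_const lip_germ_mult[OF lip_germ_ident g]])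
  from lip_germ_cong[OF this] ev show ?case by (simp add: eq_commute[of "f _"])
next
  case (Suc k)
  from Suc.prems obtain c g where "taylor_germ (Suc k) g" "\<forall>\<^sub>F s in at_right 0. f s = c + of_real s * g s"
    by (rule taylor_germ_SucE)
  then show ?case by (intro taylor_germ_SucI[of k g]) (auto intro: Suc.IH)
qed

lemma taylor_germ_imp_lip: "taylor_germ k f \<Longrightarrow> lip_germ f"
  by (induction k) (use taylor_germ_Suc_imp in auto)

lemma taylor_germ_const: "taylor_germ k (\<lambda>s. c)"
proof (induction k arbitrary: c)
  case 0 show ?case by (simp add: lip_germ_const)
next
  case (Suc k)
  have "\<forall>\<^sub>F s in at_right 0. c = c + of_real s * 0" by simp
  with Suc[of 0] show ?case by (rule taylor_germ_SucI)
qed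

lemma taylor_germ_ident: "taylor_germ k of_real"
proof (cases k)
  case 0 then show ?thesis by (simp add: lip_germ_ident)
next
  case (Suc l)
  have "\<forall>\<^sub>F s in at_right 0. of_real s = 0 + of_real s * (1::complex)" by simp
  with taylor_germ_const[of l 1] show ?thesis unfolding Suc by (rule taylor_germ_SucI)
qed

lemma taylor_germ_add: "taylor_germ k f \<Longrightarrow> taylor_germ k g \<Longrightarrow> taylor_germ k (\<lambda>s. f s + g s)"
proof (induction k arbitrary: f g)
  case 0 then show ?case by (simp add: lip_germ_add)
next
  case (Suc k)
  obtain c f' where f': "taylor_germ k f'" "\<forall>\<^sub>F s in at_right 0. f s = c + of_real s * f' s"
    using taylor_germ_SucE[OF Suc.prems(1)] .
  obtain d g' where g': "taylor_germ k g'" "\<forall>\<^sub>F s in at_right 0. g s = d + of_real s * g' s"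
    using taylor_germ_SucE[OF Suc.prems(2)] .
  have "\<forall>\<^sub>F s in at_right 0. f s + g s = (c + d) + of_real s * (f' s + g' s)"
    using f'(2) g'(2) by eventually_elim (simp add: algebra_simps)
  with Suc.IH[OF f'(1) g'(1)] show ?case by (rule taylor_germ_SucI)
qed

lemma taylor_germ_mult: "taylor_germ k f \<Longrightarrow> taylor_germ k g \<Longrightarrow> taylor_germ k (\<lambda>s. f s * g s)"
proof (induction k arbitrary: f g)
  case 0 then show ?case by (simp add: lip_germ_mult)
next
  case (Suc k)
  obtain c f' where f': "taylor_germ k f'" "\<forall>\<^sub>F s in at_right 0. f s = c + of_real s * f' s"
    using taylor_germ_SucE[OF Suc.prems(1)] .
  obtain d g' where g': "taylor_germ k g'" "\<forall>\<^sub>F s in at_right 0. g s = d + of_real s * g' s"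
    using taylor_germ_SucE[OF Suc.prems(2)] .
  \<comment> \<open>The unsymmetric splitting keeps \<open>g\<close> itself as a factor, lowered
    from order \<open>Suc k\<close> to \<open>k\<close>, so that both summands of the cofactor have
    order \<open>k\<close>.\<close>
  have "\<forall>\<^sub>F s in at_right 0. f s * g s = (c * d) + of_real s * (c * g' s + f' s * g s)"
    using f'(2) g'(2) by eventually_elim (simp add: algebra_simps)
  moreover have "taylor_germ k (\<lambda>s. c * g' s + f' s * g s)"
    by (rule taylor_germ_add[OF Suc.IH[OF taylor_germ_const g'(1)]
          Suc.IH[OF f'(1) taylor_germ_Suc_imp[OF Suc.prems(2)]]])
  ultimately show ?case by (intro taylor_germ_SucI)
qed

lemma taylor_germ_power: "taylor_germ k f \<Longrightarrow> taylor_germ k (\<lambda>s. f s ^ m)"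
  by (induction m) (simp_all add: taylor_germ_const taylor_germ_mult)

lemma taylor_germ_sum: "(\<And>i. i \<in> A \<Longrightarrow> taylor_germ k (f i)) \<Longrightarrow> taylor_germ k (\<lambda>s. \<Sum>i\<in>A. f i s)"
  by (induction A rule: infinite_finite_induct) (simp_all add: taylor_germ_const taylor_germ_add)

lemma taylor_germ_power_subst:
  assumes "taylor_germ k f" "N \<ge> 1"
  shows "taylor_germ k (\<lambda>s. f (s ^ N))"
  using assms(1)
proof (induction k arbitrary: f)
  case 0 then show ?case using assms(2) by (simp add: lip_germ_power_subst)
next
  case (Suc k)
  obtain c g where g: "taylor_germ k g" "\<forall>\<^sub>F s in at_right 0. f s = c + of_real s * g s"
    using taylor_germ_SucE[OF Suc.prems] .
  have "of_real s * (of_real s ^ (N - 1) * z) = of_real (s ^ N) * z" for s :: real and z :: complex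
    using assms(2) by (cases N) (auto simp: algebra_simps)
  then have "\<forall>\<^sub>F s in at_right 0. f (s ^ N) = c + of_real s * (of_real s ^ (N - 1) * g (s ^ N))"
    using eventually_power_at_right_0[OF assms(2) g(2)] by (simp only:)
  moreover have "taylor_germ k (\<lambda>s. of_real s ^ (N - 1) * g (s ^ N))"
    by (rule taylor_germ_mult[OF taylor_germ_power[OF taylor_germ_ident] Suc.IH[OF g(1)]])
  ultimately show ?case by (intro taylor_germ_SucI)
qed

text \<open>Weaker than being smooth on a neighbourhood: away from 0 only Lipschitz continuity is
  demanded, and the neighbourhood may shrink with the order.\<close>

definition smooth_germ :: "(real \<Rightarrow> complex) \<Rightarrow> bool" where
  "smooth_germ f \<longleftrightarrow> (\<forall>k. taylor_germ k f)"

lemma smooth_germ_cong: "smooth_germ f \<Longrightarrow> \<forall>\<^sub>F s in at_right 0. f s = g s \<Longrightarrow> smooth_germ g"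
  unfolding smooth_germ_def using taylor_germ_cong by blast

lemma smooth_germ_const: "smooth_germ (\<lambda>s. c)"
  and smooth_germ_ident: "smooth_germ of_real"
  and smooth_germ_add: "smooth_germ f \<Longrightarrow> smooth_germ g \<Longrightarrow> smooth_germ (\<lambda>s. f s + g s)"
  and smooth_germ_mult: "smooth_germ f \<Longrightarrow> smooth_germ g \<Longrightarrow> smooth_germ (\<lambda>s. f s * g s)"
  and smooth_germ_power: "smooth_germ f \<Longrightarrow> smooth_germ (\<lambda>s. f s ^ m)"
  and smooth_germ_power_subst: "smooth_germ f \<Longrightarrow> N \<ge> 1 \<Longrightarrow> smooth_germ (\<lambda>s. f (s ^ N))"
  and smooth_germ_sum: "(\<And>i. i \<in> A \<Longrightarrow> smooth_germ (h i)) \<Longrightarrow> smooth_germ (\<lambda>s. \<Sum>i\<in>A. h i s)"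
  unfolding smooth_germ_def
  by (blast intro: taylor_germ_const, blast intro: taylor_germ_ident, blast intro: taylor_germ_add,
      blast intro: taylor_germ_mult, blast intro: taylor_germ_power,
      blast intro: taylor_germ_power_subst, blast intro: taylor_germ_sum)

lemma smooth_germ_cmult: "smooth_germ f \<Longrightarrow> smooth_germ (\<lambda>s. c * f s)"
  by (intro smooth_germ_mult smooth_germ_const)

lemma smooth_germ_lip: "smooth_germ f \<Longrightarrow> lip_germ f"
  unfolding smooth_germ_def by (metis taylor_germ.simps(1))

lemma taylor_germ_tendsto:
  assumes "taylor_germ k g" "\<forall>\<^sub>F s in at_right 0. f s = c + of_real s * g s"
  shows "(f \<longlongrightarrow> c) (at_right 0)"
proof -
  obtain B where B: "B > 0" "\<forall>\<^sub>F s in at_right 0. cmod (g s) \<le> B"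
    using lip_germ_bounded[OF taylor_germ_imp_lip[OF assms(1)]] .
  have "((\<lambda>s. f s - c) \<longlongrightarrow> 0) (at_right 0)"
  proof (rule Lim_null_comparison)
    show "\<forall>\<^sub>F s in at_right 0. cmod (f s - c) \<le> s * B"
      using assms(2) B(2) eventually_at_right_less[of 0]
      by eventually_elim (auto simp: norm_mult intro!: mult_left_mono)
    have "((\<lambda>s. s * B) \<longlongrightarrow> 0 * B) (at_right 0)" by (intro tendsto_intros)
    then show "((\<lambda>s. s * B) \<longlongrightarrow> 0) (at_right 0)" by simp
  qed
  then show ?thesis by (simp add: LIM_zero_iff)
qed

text \<open>The constant term of each expansion is the limit at 0, so expansions of all orders share
  it and a single quotient is smooth to every order.\<close>

lemma smooth_germ_expand:
  assumes "smooth_germ f"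
  obtains c where "(f \<longlongrightarrow> c) (at_right 0)" "smooth_germ (\<lambda>s. (f s - c) / of_real s)"
proof -
  have "taylor_germ (Suc 0) f" using assms by (simp add: smooth_germ_def)
  then obtain c where c: "(f \<longlongrightarrow> c) (at_right 0)" by (meson taylor_germ_SucE taylor_germ_tendsto)
  have "taylor_germ k (\<lambda>s. (f s - c) / of_real s)" for k
  proof -
    have "taylor_germ (Suc k) f" using assms by (simp add: smooth_germ_def)
    then obtain d g where g: "taylor_germ k g" "\<forall>\<^sub>F s in at_right 0. f s = d + of_real s * g s"
      by (rule taylor_germ_SucE)
    have "d = c" using tendsto_unique[OF _ taylor_germ_tendsto[OF g] c] by simp
    have "\<forall>\<^sub>F s in at_right 0. g s = (f s - c) / of_real s"
      using g(2) eventually_at_right_less[of 0] by eventually_elim (auto simp: \<open>d = c\<close>)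
    with g(1) show ?thesis by (rule taylor_germ_cong)
  qed
  with c show ?thesis using that by (simp add: smooth_germ_def)
qed

section \<open>Vanishing order\<close>

definition has_order :: "(real \<Rightarrow> complex) \<Rightarrow> nat \<Rightarrow> bool" where
  "has_order f m \<longleftrightarrow> (\<exists>g c. smooth_germ g \<and> (g \<longlongrightarrow> c) (at_right 0) \<and> c \<noteq> 0 \<and>
     (\<forall>\<^sub>F s in at_right 0. f s = of_real s ^ m * g s))"

text \<open>Divide by \<open>s\<close> as long as the limit vanishes. A germ without an order is
  thus divisible by every power of \<open>s\<close>, which is the form in which flatness is
  used.\<close>

lemma smooth_germ_order_cases:
  assumes "smooth_germ f"
  shows "(\<exists>m<k. has_order f m) \<or>
    (\<exists>g. smooth_germ g \<and> (\<forall>\<^sub>F s in at_right 0. f s = of_real s ^ k * g s))"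
proof (induction k)
  case 0 then show ?case using assms by auto
next
  case (Suc k)
  show ?case
  proof (cases "\<exists>m<k. has_order f m")
    case True then show ?thesis using less_Suc_eq by blast
  next
    case False
    with Suc obtain g where g: "smooth_germ g" "\<forall>\<^sub>F s in at_right 0. f s = of_real s ^ k * g s" by blast
    obtain c where c: "(g \<longlongrightarrow> c) (at_right 0)" "smooth_germ (\<lambda>s. (g s - c) / of_real s)"
      using smooth_germ_expand[OF g(1)] .
    show ?thesis
    proof (cases "c = 0")
      case True
      have "\<forall>\<^sub>F s in at_right 0. f s = of_real s ^ Suc k * (g s / of_real s)"
        using g(2) eventually_at_right_less[of 0] by eventually_elim auto
      with c(2) True show ?thesis by auto
    next
      case False
      then have "has_order f k" unfolding has_order_def using g c(1) by blast
      then show ?thesis by blast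
    qed
  qed
qed

section \<open>Quadratic systems\<close>

lemma lip_germ_uniform:
  assumes "finite K" "\<And>i. i \<in> K \<Longrightarrow> lip_germ (g i)"
  obtains Q L where "eventually Q (at_right 0)" "L \<ge> 0"
    "\<forall>i\<in>K. \<forall>s t. Q s \<longrightarrow> Q t \<longrightarrow> cmod (g i s - g i t) \<le> L * \<bar>s - t\<bar>"
proof -
  have "\<exists>Q L. eventually Q (at_right 0) \<and> L \<ge> 0 \<and>
    (\<forall>i\<in>K. \<forall>s t. Q s \<longrightarrow> Q t \<longrightarrow> cmod (g i s - g i t) \<le> L * \<bar>s - t\<bar>)"
    using assms
  proof (induction K rule: finite_induct)
    case empty
    show ?case by (rule exI[of _ "\<lambda>_. True"], rule exI[of _ 0]) simp
  next
    case (insert j K)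
    then obtain Q L where Q: "eventually Q (at_right 0)" "L \<ge> 0"
      "\<forall>i\<in>K. \<forall>s t. Q s \<longrightarrow> Q t \<longrightarrow> cmod (g i s - g i t) \<le> L * \<bar>s - t\<bar>" by auto
    have "lip_germ (g j)" using insert.prems by simp
    from lip_germE[OF this] obtain Q' L' where Q': "eventually Q' (at_right 0)" "L' \<ge> 0"
      "\<forall>s t. Q' s \<longrightarrow> Q' t \<longrightarrow> cmod (g j s - g j t) \<le> L' * \<bar>s - t\<bar>" .
    have "cmod (g i s - g i t) \<le> (L + L') * \<bar>s - t\<bar>"
      if "i \<in> insert j K" "Q s \<and> Q' s" "Q t \<and> Q' t" for i s t
    proof -
      have "L * \<bar>s - t\<bar> \<ge> 0" "L' * \<bar>s - t\<bar> \<ge> 0" using Q(2) Q'(2) by auto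
      moreover have "cmod (g i s - g i t) \<le> L * \<bar>s - t\<bar> \<or> cmod (g i s - g i t) \<le> L' * \<bar>s - t\<bar>"
        using that Q(3) Q'(3) by auto
      ultimately show ?thesis by (auto simp: distrib_right)
    qed
    with Q(2) Q'(2) eventually_conj[OF Q(1) Q'(1)] show ?case
      by (intro exI[of _ "\<lambda>s. Q s \<and> Q' s"] exI[of _ "L + L'"]) auto
  qed
  then show ?thesis using that by blast
qed

text \<open>A priori bound by absorption: since \<open>s * x\<close> tends to 0, the quadratic term
  is at most half of the total size \<open>X\<close> of the unknowns.\<close>

lemma quadratic_system_bounded:
  fixes x g :: "'i \<Rightarrow> real \<Rightarrow> complex" and c :: "'i \<Rightarrow> 'p \<Rightarrow> complex"
  assumes fin: "finite K" "finite M" and uv: "\<And>p. p \<in> M \<Longrightarrow> u p \<in> K" "\<And>p. p \<in> M \<Longrightarrow> v p \<in> K"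
    and g: "\<And>i. i \<in> K \<Longrightarrow> lip_germ (g i)"
    and eq: "\<And>i. i \<in> K \<Longrightarrow> \<forall>\<^sub>F s in at_right 0.
        x i s = g i s + of_real s * (\<Sum>p\<in>M. c i p * (x (u p) s * x (v p) s))"
    and small: "\<And>i. i \<in> K \<Longrightarrow> ((\<lambda>s. of_real s * x i s) \<longlongrightarrow> 0) (at_right 0)"
  obtains B where "B \<ge> 0" "\<forall>\<^sub>F s in at_right 0. (\<Sum>i\<in>K. cmod (x i s)) \<le> B"
proof -
  define X where "X = (\<lambda>s. \<Sum>i\<in>K. cmod (x i s))"
  define C where "C = (\<Sum>i\<in>K. \<Sum>p\<in>M. cmod (c i p))"
  have C0: "C \<ge> 0" unfolding C_def by (intro sum_nonneg) auto
  have "\<forall>i\<in>K. \<exists>B. \<forall>\<^sub>F s in at_right 0. cmod (g i s) \<le> B"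
    using g lip_germ_bounded by metis
  then obtain G where G: "\<And>i. i \<in> K \<Longrightarrow> \<forall>\<^sub>F s in at_right 0. cmod (g i s) \<le> G i" by metis
  have X1: "cmod (x i s) \<le> X s" if "i \<in> K" for i s
    unfolding X_def by (rule member_le_sum) (use that fin in auto)
  have X0: "X s \<ge> 0" for s unfolding X_def by (intro sum_nonneg) auto
  have "\<forall>\<^sub>F s in at_right 0. \<forall>i\<in>K. cmod (g i s) \<le> G i \<and>
      x i s = g i s + of_real s * (\<Sum>p\<in>M. c i p * (x (u p) s * x (v p) s))"
    using fin G eq by (simp add: eventually_ball_finite_distrib eventually_conj_iff)
  moreover have "\<forall>\<^sub>F s in at_right 0. C * (\<Sum>i\<in>K. cmod (of_real s * x i s)) < 1/2"
  proof -
    have "((\<lambda>s. C * (\<Sum>i\<in>K. cmod (of_real s * x i s))) \<longlongrightarrow> C * (\<Sum>i\<in>K. cmod 0)) (at_right 0)"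
      by (intro tendsto_intros small) auto
    then show ?thesis by (rule order_tendstoD) simp
  qed
  ultimately have "\<forall>\<^sub>F s in at_right 0. X s \<le> 2 * (\<Sum>i\<in>K. G i)"
    using eventually_at_right_less[of 0]
  proof eventually_elim
    case (elim s)
    have "cmod (x i s) \<le> G i + s * ((\<Sum>p\<in>M. cmod (c i p)) * (X s * X s))" if i: "i \<in> K" for i
    proof -
      have e: "cmod (g i s) \<le> G i" "x i s = g i s + of_real s * (\<Sum>p\<in>M. c i p * (x (u p) s * x (v p) s))"
        using elim(1) i by blast+
      have "cmod (x i s) \<le> cmod (g i s) + cmod (of_real s * (\<Sum>p\<in>M. c i p * (x (u p) s * x (v p) s)))"
        by (subst e(2)) (rule norm_triangle_ineq)
      also have "cmod (of_real s * (\<Sum>p\<in>M. c i p * (x (u p) s * x (v p) s)))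
          = s * cmod (\<Sum>p\<in>M. c i p * (x (u p) s * x (v p) s))" using elim(3) by (simp add: norm_mult)
      also have "\<dots> \<le> s * (\<Sum>p\<in>M. cmod (c i p) * (X s * X s))"
        using elim(3)
        by (intro mult_left_mono sum_norm_le) (auto simp: norm_mult intro!: mult_left_mono mult_mono X1 X0 uv)
      also have "(\<Sum>p\<in>M. cmod (c i p) * (X s * X s)) = (\<Sum>p\<in>M. cmod (c i p)) * (X s * X s)"
        by (simp add: sum_distrib_right)
      finally show ?thesis using e(1) by simp
    qed
    then have "X s \<le> (\<Sum>i\<in>K. G i + s * ((\<Sum>p\<in>M. cmod (c i p)) * (X s * X s)))"
      unfolding X_def by (intro sum_mono) auto
    also have "\<dots> = (\<Sum>i\<in>K. G i) + s * (C * (X s * X s))"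
      by (simp add: sum.distrib C_def sum_distrib_left sum_distrib_right)
    \<comment> \<open>One of the two factors \<open>X s\<close> is combined with \<open>s\<close>
      and \<open>C\<close> into a quantity below one half, so the term moves to the left-hand
      side.\<close>
    also have "s * (C * (X s * X s)) = (C * (\<Sum>i\<in>K. cmod (of_real s * x i s))) * X s"
      using elim(3) by (simp add: norm_mult X_def sum_distrib_left[symmetric] mult_ac)
    also have "\<dots> \<le> 1/2 * X s" using elim(2) X0 by (intro mult_right_mono) auto
    finally show ?case by simp
  qed
  then have "\<forall>\<^sub>F s in at_right 0. X s \<le> max 0 (2 * (\<Sum>i\<in>K. G i))"
    by eventually_elim auto
  then show ?thesis using that[of "max 0 (2 * (\<Sum>i\<in>K. G i))"] unfolding X_def by auto
qed

lemma norm_bilinear_diff_le: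
  fixes a b a' b' :: complex and s t B D :: real
  assumes "cmod a \<le> B" "cmod b \<le> B" "cmod a' \<le> B" "cmod b' \<le> B"
    "cmod (a - a') \<le> D" "cmod (b - b') \<le> D" "t \<ge> 0"
  shows "cmod (of_real s * (a * b) - of_real t * (a' * b')) \<le> \<bar>s - t\<bar> * (B * B) + t * (2 * B * D)"
proof -
  have B: "B \<ge> 0" "D \<ge> 0" using assms(1,5) norm_ge_zero order_trans by blast+
  have "of_real s * (a * b) - of_real t * (a' * b')
     = of_real (s - t) * (a * b) + of_real t * ((a - a') * b + a' * (b - b'))"
    by (simp add: algebra_simps)
  also have "cmod \<dots> \<le> \<bar>s - t\<bar> * (cmod a * cmod b) + t * (cmod (a - a') * cmod b + cmod a' * cmod (b - b'))"
    using assms(7) norm_triangle_ineq[of "(a - a') * b" "a' * (b - b')"]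
    by (intro order_trans[OF norm_triangle_ineq] add_mono) (auto simp: norm_mult simp del: of_real_diff intro!: mult_left_mono)
  also have "\<dots> \<le> \<bar>s - t\<bar> * (B * B) + t * (D * B + B * D)"
    using assms B by (intro add_mono mult_left_mono mult_mono) auto
  finally show ?thesis by (simp add: mult_ac)
qed

text \<open>The absorption is repeated for differences: once all unknowns are bounded by
  \<open>B\<close>, the coefficient of the total difference \<open>D\<close> carries a factor
  \<open>t\<close> and falls below one half near 0.\<close>

lemma quadratic_system_lip:
  fixes x g :: "'i \<Rightarrow> real \<Rightarrow> complex" and c :: "'i \<Rightarrow> 'p \<Rightarrow> complex"
  assumes fin: "finite K" "finite M" and uv: "\<And>p. p \<in> M \<Longrightarrow> u p \<in> K" "\<And>p. p \<in> M \<Longrightarrow> v p \<in> K"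
    and g: "\<And>i. i \<in> K \<Longrightarrow> lip_germ (g i)"
    and eq: "\<And>i. i \<in> K \<Longrightarrow> \<forall>\<^sub>F s in at_right 0.
        x i s = g i s + of_real s * (\<Sum>p\<in>M. c i p * (x (u p) s * x (v p) s))"
    and small: "\<And>i. i \<in> K \<Longrightarrow> ((\<lambda>s. of_real s * x i s) \<longlongrightarrow> 0) (at_right 0)"
    and "k \<in> K"
  shows "lip_germ (x k)"
proof -
  obtain B where B: "B \<ge> 0" "\<forall>\<^sub>F s in at_right 0. (\<Sum>i\<in>K. cmod (x i s)) \<le> B"
    using quadratic_system_bounded[of K M u v g x c] fin uv g eq small by blast
  obtain Q L where Q: "eventually Q (at_right 0)" "L \<ge> 0"
    "\<forall>i\<in>K. \<forall>s t. Q s \<longrightarrow> Q t \<longrightarrow> cmod (g i s - g i t) \<le> L * \<bar>s - t\<bar>"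
    using lip_germ_uniform[OF fin(1) g] .
  define C where "C = (\<Sum>i\<in>K. \<Sum>p\<in>M. cmod (c i p))"
  have C0: "C \<ge> 0" unfolding C_def by (intro sum_nonneg) auto
  have eqs: "\<forall>\<^sub>F s in at_right 0. \<forall>i\<in>K.
      x i s = g i s + of_real s * (\<Sum>p\<in>M. c i p * (x (u p) s * x (v p) s))"
    using fin eq by (auto simp: eventually_ball_finite_distrib)
  have tau: "\<forall>\<^sub>F s in at_right 0. C * (s * (2 * B)) < 1/2"
  proof -
    have "((\<lambda>s. C * (s * (2 * B))) \<longlongrightarrow> C * (0 * (2 * B))) (at_right 0)" by (intro tendsto_intros)
    then show ?thesis by (rule order_tendstoD) simp
  qed
  define R where "R s \<longleftrightarrow> Q s \<and> (\<Sum>i\<in>K. cmod (x i s)) \<le> B \<and> (\<forall>i\<in>K.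
      x i s = g i s + of_real s * (\<Sum>p\<in>M. c i p * (x (u p) s * x (v p) s))) \<and>
      C * (s * (2 * B)) < 1/2 \<and> 0 < s" for s
  have R: "eventually R (at_right 0)"
    unfolding R_def using Q(1) B(2) eqs tau eventually_at_right_less[of 0] by eventually_elim auto
  show ?thesis
  proof (rule lip_germI[OF R])
    fix s t assume s: "R s" and t: "R t"
    define D where "D = (\<Sum>i\<in>K. cmod (x i s - x i t))"
    have D0: "D \<ge> 0" unfolding D_def by (intro sum_nonneg) auto
    have le: "cmod (x i s) \<le> B" "cmod (x i t) \<le> B" "cmod (x i s - x i t) \<le> D" if i: "i \<in> K" for i
    proof -
      have "cmod (x i s) \<le> (\<Sum>i\<in>K. cmod (x i s))" "cmod (x i t) \<le> (\<Sum>i\<in>K. cmod (x i t))"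
        by (intro member_le_sum; use fin i in auto)+
      then show "cmod (x i s) \<le> B" "cmod (x i t) \<le> B" using s t unfolding R_def by linarith+
      show "cmod (x i s - x i t) \<le> D" unfolding D_def by (rule member_le_sum) (use fin i in auto)
    qed
    define W where "W = \<bar>s - t\<bar> * (B * B) + t * (2 * B * D)"
    have "cmod (x i s - x i t) \<le> L * \<bar>s - t\<bar> + (\<Sum>p\<in>M. cmod (c i p)) * W" if i: "i \<in> K" for i
    proof -
      define Z where "Z = (\<Sum>p\<in>M. c i p * (of_real s * (x (u p) s * x (v p) s) - of_real t * (x (u p) t * x (v p) t)))"
      have e: "x i s = g i s + of_real s * (\<Sum>p\<in>M. c i p * (x (u p) s * x (v p) s))"
        "x i t = g i t + of_real t * (\<Sum>p\<in>M. c i p * (x (u p) t * x (v p) t))"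
        using s t i unfolding R_def by blast+
      have "x i s - x i t = (g i s - g i t) + (of_real s * (\<Sum>p\<in>M. c i p * (x (u p) s * x (v p) s))
          - of_real t * (\<Sum>p\<in>M. c i p * (x (u p) t * x (v p) t)))"
        by (rule trans[OF arg_cong2[where f = "(-)", OF e] add_diff_add])
      also have "of_real s * (\<Sum>p\<in>M. c i p * (x (u p) s * x (v p) s))
          - of_real t * (\<Sum>p\<in>M. c i p * (x (u p) t * x (v p) t)) = Z"
        by (simp add: Z_def sum_distrib_left sum_subtractf right_diff_distrib mult_ac)
      finally have "x i s - x i t = (g i s - g i t) + Z" .
      then have "cmod (x i s - x i t) \<le> cmod (g i s - g i t) + cmod Z"
        by (simp only: norm_triangle_ineq)
      moreover have "cmod Z \<le> (\<Sum>p\<in>M. cmod (c i p) * W)"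
        unfolding Z_def
      proof (rule sum_norm_le)
        fix p assume p: "p \<in> M"
        have "cmod (of_real s * (x (u p) s * x (v p) s) - of_real t * (x (u p) t * x (v p) t)) \<le> W"
          unfolding W_def by (rule norm_bilinear_diff_le) (use t in \<open>auto simp: R_def intro: le uv p\<close>)
        then show "cmod (c i p * (of_real s * (x (u p) s * x (v p) s) - of_real t * (x (u p) t * x (v p) t)))
          \<le> cmod (c i p) * W" by (simp only: norm_mult mult_left_mono norm_ge_zero)
      qed
      moreover have "cmod (g i s - g i t) \<le> L * \<bar>s - t\<bar>" using Q(3) s t i unfolding R_def by blast
      ultimately show ?thesis by (simp add: sum_distrib_right)
    qed
    then have "D \<le> (\<Sum>i\<in>K. L * \<bar>s - t\<bar> + (\<Sum>p\<in>M. cmod (c i p)) * W)"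
      unfolding D_def by (rule sum_mono)
    also have "\<dots> = card K * L * \<bar>s - t\<bar> + C * W" by (simp add: sum.distrib C_def sum_distrib_right)
    also have "C * W = C * (B * B) * \<bar>s - t\<bar> + (C * (t * (2 * B))) * D" by (simp add: W_def algebra_simps)
    also have "(C * (t * (2 * B))) * D \<le> 1/2 * D"
      using t D0 unfolding R_def by (intro mult_right_mono) auto
    finally have "D \<le> 2 * (card K * L + C * (B * B)) * \<bar>s - t\<bar>" by (simp add: algebra_simps)
    with le(3)[OF \<open>k \<in> K\<close>] show "cmod (x k s - x k t) \<le> 2 * (card K * L + C * (B * B)) * \<bar>s - t\<bar>"
      by (rule order_trans)
  qed
qed

text \<open>The factor \<open>s\<close> in front of the quadratic part raises the Taylor order by one, so that
  smoothness bootstraps from the Lipschitz property.\<close>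

lemma quadratic_system_smooth:
  fixes x g :: "'i \<Rightarrow> real \<Rightarrow> complex" and c :: "'i \<Rightarrow> 'p \<Rightarrow> complex"
  assumes fin: "finite K" "finite M" and uv: "\<And>p. p \<in> M \<Longrightarrow> u p \<in> K" "\<And>p. p \<in> M \<Longrightarrow> v p \<in> K"
    and g: "\<And>i. i \<in> K \<Longrightarrow> smooth_germ (g i)"
    and eq: "\<And>i. i \<in> K \<Longrightarrow> \<forall>\<^sub>F s in at_right 0.
        x i s = g i s + of_real s * (\<Sum>p\<in>M. c i p * (x (u p) s * x (v p) s))"
    and small: "\<And>i. i \<in> K \<Longrightarrow> ((\<lambda>s. of_real s * x i s) \<longlongrightarrow> 0) (at_right 0)"
    and i: "i \<in> K"
  shows "smooth_germ (x i)"
proof -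
  have "\<forall>i\<in>K. taylor_germ k (x i)" for k
  proof (induction k)
    case 0
    show ?case using quadratic_system_lip[of K M u v g x c] fin uv smooth_germ_lip[OF g] eq small by simp
  next
    case (Suc k)
    show ?case
    proof
      fix i assume i: "i \<in> K"
      have sm: "taylor_germ k (\<lambda>s. \<Sum>p\<in>M. c i p * (x (u p) s * x (v p) s))"
        using Suc uv by (intro taylor_germ_sum taylor_germ_mult[OF taylor_germ_const taylor_germ_mult]) auto
      have "taylor_germ (Suc k) (\<lambda>s. of_real s * (\<Sum>p\<in>M. c i p * (x (u p) s * x (v p) s)))"
        by (rule taylor_germ_SucI[OF sm, of _ 0]) simp
      moreover have "taylor_germ (Suc k) (g i)" using g i by (simp add: smooth_germ_def)
      ultimately have "taylor_germ (Suc k) (\<lambda>s. g i s + of_real s * (\<Sum>p\<in>M. c i p * (x (u p) s * x (v p) s)))"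
        by (rule taylor_germ_add[rotated])
      then show "taylor_germ (Suc k) (x i)"
        by (rule taylor_germ_cong) (use eq[OF i] in \<open>eventually_elim, simp\<close>)
    qed
  qed
  with i show ?thesis by (auto simp: smooth_germ_def)
qed

section \<open>Hensel's lemma for root polynomials\<close>

definition root_poly :: "'j set \<Rightarrow> ('j \<Rightarrow> complex) \<Rightarrow> complex poly" where
  "root_poly J w = (\<Prod>j\<in>J. [:- w j, 1:])"

lemma degree_root_poly [simp]: "degree (root_poly J w) = card J"
  unfolding root_poly_def by (cases "finite J") (auto simp: degree_prod_eq_sum_degree)

lemma coeff_root_poly_card [simp]: "coeff (root_poly J w) (card J) = 1"
proof -
  have "lead_coeff (root_poly J w) = 1" unfolding root_poly_def by (simp add: lead_coeff_prod)
  then show ?thesis by simp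
qed

lemma poly_root_poly: "poly (root_poly J w) z = (\<Prod>j\<in>J. z - w j)"
  unfolding root_poly_def by (simp add: poly_prod)

lemma root_poly_insert:
  "finite J \<Longrightarrow> j \<notin> J \<Longrightarrow> root_poly (insert j J) w = [:- w j, 1:] * root_poly J w"
  unfolding root_poly_def by simp

lemma root_poly_Un:
  "finite A \<Longrightarrow> finite B \<Longrightarrow> A \<inter> B = {} \<Longrightarrow> root_poly (A \<union> B) w = root_poly A w * root_poly B w"
  unfolding root_poly_def by (simp add: prod.union_disjoint)

lemma coeff_root_poly_tendsto:
  assumes "finite J" "\<And>j. j \<in> J \<Longrightarrow> (\<nu> j \<longlongrightarrow> w j) F"
  shows "((\<lambda>s. coeff (root_poly J (\<lambda>j. \<nu> j s)) k) \<longlongrightarrow> coeff (root_poly J w) k) F"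
  using assms
proof (induction J arbitrary: k rule: finite_induct)
  case empty then show ?case by (simp add: root_poly_def)
next
  case (insert j J)
  have *: "coeff (root_poly (insert j J) v) k = - v j * coeff (root_poly J v) k +
      (case k of 0 \<Rightarrow> 0 | Suc l \<Rightarrow> coeff (root_poly J v) l)" for v
    using insert.hyps by (simp add: root_poly_insert coeff_pCons)
  show ?case unfolding *
    by (cases k) (auto intro!: tendsto_intros insert)
qed

text \<open>Division by a linear factor leaves the constant \<open>poly B w\<close> as remainder,
  which is invertible.\<close>

lemma bezout_linear:
  fixes B :: "complex poly"
  assumes "poly B w \<noteq> 0"
  shows "\<exists>U V. U * [:- w, 1:] + V * B = 1"
proof -
  let ?q = "synthetic_div B w" and ?b = "poly B w"
  have "B = [:- w, 1:] * ?q + [:?b:]" by (rule synthetic_div_correct'[symmetric])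
  then have "smult (1 / ?b) B = smult (1 / ?b) ([:- w, 1:] * ?q + [:?b:])" by (rule arg_cong)
  also have "\<dots> = [:- w, 1:] * smult (1 / ?b) ?q + 1"
    using assms by (simp add: smult_add_right one_pCons)
  finally have "(- smult (1 / ?b) ?q) * [:- w, 1:] + [:1 / ?b:] * B = 1"
    by (simp add: algebra_simps)
  then show ?thesis by blast
qed

text \<open>Multiply the Bezout identities of the single linear factors: every term of the product
  contains either the whole root polynomial or \<open>B\<close>.\<close>

lemma bezout_root_poly:
  fixes B :: "complex poly"
  assumes "finite J" "\<And>j. j \<in> J \<Longrightarrow> poly B (w j) \<noteq> 0"
  shows "\<exists>U V. U * root_poly J w + V * B = 1"
  using assms
proof (induction J rule: finite_induct)
  case empty
  show ?case by (rule exI[of _ 1], rule exI[of _ 0]) (simp add: root_poly_def)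
next
  case (insert j J)
  then obtain U V where UV: "U * root_poly J w + V * B = 1" by auto
  obtain U' V' where UV': "U' * [:- w j, 1:] + V' * B = 1" using bezout_linear insert.prems by blast
  let ?l = "[:- w j, 1:]" and ?p = "root_poly J w"
  have "(U * U') * (?l * ?p) + (U * ?p * V' + V * (U' * ?l) + V * V' * B) * B
     = (U * ?p + V * B) * (U' * ?l + V' * B)" by (simp only: ring_distribs mult_ac add_ac)
  also have "\<dots> = 1" unfolding UV UV' by simp
  finally show ?case using insert.hyps root_poly_insert by metis
qed

text \<open>Reduction modulo \<open>A\<close> is linear, so the weights depend on \<open>V\<close>
  and \<open>A\<close> only. For a family \<open>F\<close> depending on \<open>s\<close> they are
  constants, as the quadratic system requires.\<close>

lemma coeff_mult_mod_linear:
  fixes F V A :: "complex poly"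
  assumes "degree F \<le> d"
  shows "coeff ((V * F) mod A) i = (\<Sum>l\<le>d. coeff F l * coeff ((V * monom 1 l) mod A) i)"
proof -
  have sum_mod: "(\<Sum>l\<in>S. G l) mod A = (\<Sum>l\<in>S. G l mod A)" if "finite S" for S :: "nat set" and G
    using that by (induction S rule: finite_induct) (simp_all add: poly_mod_add_left)
  have "F = (\<Sum>l\<le>d. smult (coeff F l) (monom 1 l))"
    using poly_as_sum_of_monoms'[OF assms] by (simp add: smult_monom)
  then have "V * F = (\<Sum>l\<le>d. smult (coeff F l) (V * monom 1 l))"
    by (metis (no_types, lifting) mult_smult_right sum.cong sum_distrib_left)
  then have "(V * F) mod A = (\<Sum>l\<le>d. smult (coeff F l) ((V * monom 1 l) mod A))"
    by (simp add: sum_mod mod_smult_left)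
  then show ?thesis by (simp add: coeff_sum)
qed

lemma smooth_germ_limit_quotient:
  assumes "smooth_germ f" "(f \<longlongrightarrow> c) (at_right 0)"
  shows "smooth_germ (\<lambda>s. (f s - c) / of_real s)"
proof -
  obtain d where d: "(f \<longlongrightarrow> d) (at_right 0)" "smooth_germ (\<lambda>s. (f s - d) / of_real s)"
    using smooth_germ_expand[OF assms(1)] .
  have "d = c" using tendsto_unique[OF _ d(1) assms(2)] by simp
  with d(2) show ?thesis by simp
qed

text \<open>Multiply by \<open>V\<close> and replace \<open>V * B0\<close> by
  \<open>1 - U * A0\<close>; the degree bound makes \<open>E1\<close> its own residue. The case
  \<open>E1 = 0\<close> is separate because no degree lies below that of a constant
  \<open>A0\<close>.\<close>

lemma bezout_residue_eq:
  fixes A0 B0 E1 E2 G :: "complex poly"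
  assumes "U * A0 + V * B0 = 1" "A0 * E2 + B0 * E1 + c * (E1 * E2) = G"
    and "E1 = 0 \<or> degree E1 < degree A0"
  shows "E1 = (V * G) mod A0 - (V * (c * (E1 * E2))) mod A0"
proof -
  have "V * (G - c * (E1 * E2)) = V * (A0 * E2 + B0 * E1)" using assms(2) by (auto simp: algebra_simps)
  also have "\<dots> = (U * A0 + V * B0) * E1 + A0 * (V * E2 - U * E1)" by (simp add: algebra_simps)
  finally have "V * (G - c * (E1 * E2)) = E1 + A0 * (V * E2 - U * E1)" using assms(1) by simp
  then have "(V * (G - c * (E1 * E2))) mod A0 = E1 mod A0" by simp
  also have "\<dots> = E1" using assms(3) mod_poly_less by fastforce
  finally show ?thesis by (simp add: right_diff_distrib poly_mod_diff_left)
qed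

text \<open>Hensel's lemma: writing the factors as \<open>A\<^sub>0 + s E\<^sub>1\<close> and \<open>B\<^sub>0 + s E\<^sub>2\<close> with coprime \<open>A\<^sub>0\<close>, \<open>B\<^sub>0\<close>,
  the Bezout identity turns the factorisation into a quadratic system for the coefficients
  of \<open>E\<^sub>1\<close>, \<open>E\<^sub>2\<close>.\<close>

lemma smooth_germ_root_poly_split:
  fixes \<nu> :: "'j \<Rightarrow> real \<Rightarrow> complex"
  assumes fin: "finite J1" "finite J2" and disj: "J1 \<inter> J2 = {}"
    and lim: "\<And>j. j \<in> J1 \<union> J2 \<Longrightarrow> (\<nu> j \<longlongrightarrow> w j) (at_right 0)"
    and sep: "\<And>i j. i \<in> J1 \<Longrightarrow> j \<in> J2 \<Longrightarrow> w i \<noteq> w j"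
    and smooth: "\<And>k. smooth_germ (\<lambda>s. coeff (root_poly (J1 \<union> J2) (\<lambda>j. \<nu> j s)) k)"
  shows "smooth_germ (\<lambda>s. coeff (root_poly J1 (\<lambda>j. \<nu> j s)) k)"
proof -
  define A where "A s = root_poly J1 (\<lambda>j. \<nu> j s)" for s
  define B where "B s = root_poly J2 (\<lambda>j. \<nu> j s)" for s
  define P where "P s = root_poly (J1 \<union> J2) (\<lambda>j. \<nu> j s)" for s
  define A0 where "A0 = root_poly J1 w"
  define B0 where "B0 = root_poly J2 w"
  define P0 where "P0 = root_poly (J1 \<union> J2) w"
  define E1 where "E1 s = smult (1 / of_real s) (A s - A0)" for s :: real
  define E2 where "E2 s = smult (1 / of_real s) (B s - B0)" for s :: real
  define G where "G s = smult (1 / of_real s) (P s - P0)" for s :: real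
  define d where "d = card J1 + card J2"
  have PAB: "P s = A s * B s" "P0 = A0 * B0" for s
    using fin disj by (simp_all add: P_def A_def B_def P0_def A0_def B0_def root_poly_Un)
  have AE: "A s = A0 + smult (of_real s) (E1 s)" "B s = B0 + smult (of_real s) (E2 s)" if "s > 0" for s
    using that by (simp_all add: E1_def E2_def)
  have degE: "E1 s = 0 \<or> degree (E1 s) < degree A0" "E2 s = 0 \<or> degree (E2 s) < degree B0" for s
  proof -
    \<comment> \<open>The factors are monic of fixed degree for every \<open>s\<close>, so the
      leading terms cancel in the difference.\<close>
    have *: "p = q \<or> degree (p - q) < m" if "degree p = m" "degree q = m" "coeff p m = coeff q m"
      for p q :: "complex poly" and m
    proof (cases "p = q")
      case False
      have "degree (p - q) \<le> m" using that by (metis degree_diff_le order_refl)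
      moreover have "degree (p - q) \<noteq> m"
        using that False by (metis coeff_diff diff_self eq_iff_diff_eq_0 leading_coeff_0_iff)
      ultimately show ?thesis by simp
    qed simp
    show "E1 s = 0 \<or> degree (E1 s) < degree A0"
      using *[of "A s" "card J1" A0] by (auto simp: E1_def A_def A0_def)
    show "E2 s = 0 \<or> degree (E2 s) < degree B0"
      using *[of "B s" "card J2" B0] by (auto simp: E2_def B_def B0_def)
  qed
  have degd: "degree (E1 s * E2 s) \<le> d" "degree (G s) \<le> d" for s
  proof -
    have "degree (E1 s) \<le> card J1" "degree (E2 s) \<le> card J2"
      using degE[of s] by (auto simp: A0_def B0_def)
    then show "degree (E1 s * E2 s) \<le> d" unfolding d_def using degree_mult_le[of "E1 s" "E2 s"] by linarith
    have "card (J1 \<union> J2) = d" using fin disj by (simp add: d_def card_Un_disjoint)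
    then have "degree (P s) \<le> d" "degree P0 \<le> d" by (auto simp: P_def P0_def)
    then show "degree (G s) \<le> d" unfolding G_def by (metis degree_diff_le degree_smult_le order_trans)
  qed
  have Geq: "A0 * E2 s + B0 * E1 s + [:of_real s:] * (E1 s * E2 s) = G s" if "s > 0" for s
  proof -
    have "P s - P0 = smult (of_real s) (A0 * E2 s + B0 * E1 s + [:of_real s:] * (E1 s * E2 s))"
      unfolding PAB AE[OF that] by (simp add: algebra_simps smult_add_right)
    then show ?thesis using that by (simp add: G_def)
  qed
  have "poly B0 (w j) \<noteq> 0" if "j \<in> J1" for j
    using sep that fin by (auto simp: B0_def poly_root_poly)
  then obtain U V where UV: "U * A0 + V * B0 = 1"
    unfolding A0_def using bezout_root_poly[OF fin(1), of B0 w] by blast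
  then have UV': "V * B0 + U * A0 = 1" by (simp add: add.commute)
  \<comment> \<open>\<open>True\<close> marks coefficients of \<open>E1\<close>,
    \<open>False\<close> those of \<open>E2\<close>. Indices run up to \<open>d\<close> so that both
    indices of a Cauchy product stay inside \<open>K\<close>; \<open>M\<close> lists the pairs of
    total index and first index.\<close>
  define x :: "bool \<times> nat \<Rightarrow> real \<Rightarrow> complex"
    where "x i s = coeff (if fst i then E1 s else E2 s) (snd i)" for i s
  define \<alpha> where "\<alpha> i l = (if fst i then coeff ((V * monom 1 l) mod A0) (snd i)
      else coeff ((U * monom 1 l) mod B0) (snd i))" for i :: "bool \<times> nat" and l
  define g where "g i s = (\<Sum>l\<le>d. coeff (G s) l * \<alpha> i l)" for i s
  define K where "K = (UNIV :: bool set) \<times> {..d}"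
  define M where "M = (SIGMA l:{..d}. {..l})"
  have xeq: "x i s = g i s - of_real s * (\<Sum>l\<le>d. coeff (E1 s * E2 s) l * \<alpha> i l)" if s: "s > 0" for i s
  proof (cases "fst i")
    case True
    have "E1 s = (V * G s) mod A0 - (V * ([:of_real s:] * (E1 s * E2 s))) mod A0"
      by (rule bezout_residue_eq[OF UV Geq[OF s] degE(1)])
    then have "x i s = coeff ((V * G s) mod A0 - (V * ([:of_real s:] * (E1 s * E2 s))) mod A0) (snd i)"
      using True by (simp add: x_def)
    then show ?thesis
      using coeff_mult_mod_linear[OF degd(1), of V s A0 "snd i"]
        coeff_mult_mod_linear[OF degd(2), of V s A0 "snd i"] True
      by (simp add: g_def \<alpha>_def mod_smult_left)
  next
    case False
    have e: "B0 * E1 s + A0 * E2 s + [:of_real s:] * (E2 s * E1 s) = G s"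
      using Geq[OF s] by (simp add: algebra_simps)
    have "E2 s = (U * G s) mod B0 - (U * ([:of_real s:] * (E2 s * E1 s))) mod B0"
      by (rule bezout_residue_eq[OF UV' e degE(2)])
    then have "x i s = coeff ((U * G s) mod B0 - (U * ([:of_real s:] * (E1 s * E2 s))) mod B0) (snd i)"
      using False by (simp add: x_def mult.commute)
    then show ?thesis
      using coeff_mult_mod_linear[OF degd(1), of U s B0 "snd i"]
        coeff_mult_mod_linear[OF degd(2), of U s B0 "snd i"] False
      by (simp add: g_def \<alpha>_def mod_smult_left)
  qed
  have quad: "(\<Sum>l\<le>d. coeff (E1 s * E2 s) l * \<alpha> i l) =
      (\<Sum>p\<in>M. \<alpha> i (fst p) * (x (True, snd p) s * x (False, fst p - snd p) s))" for i s
  proof -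
    have "(\<Sum>l\<le>d. coeff (E1 s * E2 s) l * \<alpha> i l) =
        (\<Sum>l\<le>d. \<Sum>n\<le>l. \<alpha> i l * (x (True, n) s * x (False, l - n) s))"
      by (simp add: coeff_mult x_def sum_distrib_left sum_distrib_right mult_ac)
    also have "\<dots> = (\<Sum>p\<in>M. \<alpha> i (fst p) * (x (True, snd p) s * x (False, fst p - snd p) s))"
      unfolding M_def by (subst sum.Sigma) (simp_all add: case_prod_unfold)
    finally show ?thesis .
  qed
  have "smooth_germ (x i)" if i: "i \<in> K" for i
  proof (rule quadratic_system_smooth[where K = K and M = M and g = g and u = "\<lambda>p. (True, snd p)"
        and v = "\<lambda>p. (False, fst p - snd p)" and c = "\<lambda>i p. - \<alpha> i (fst p)"])
    show "finite K" "finite M" by (auto simp: K_def M_def)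
    show "(True, snd p) \<in> K" "(False, fst p - snd p) \<in> K" if "p \<in> M" for p
      using that by (auto simp: K_def M_def)
    show "smooth_germ (g i)" for i
    proof -
      have "smooth_germ (\<lambda>s. coeff (G s) l)" for l
        using smooth_germ_limit_quotient[OF smooth coeff_root_poly_tendsto[of "J1 \<union> J2" \<nu> w]] fin lim
        by (simp add: G_def P_def P0_def)
      then show ?thesis unfolding g_def by (intro smooth_germ_sum smooth_germ_mult smooth_germ_const)
    qed
    show "\<forall>\<^sub>F s in at_right 0. x i s = g i s + of_real s *
        (\<Sum>p\<in>M. - \<alpha> i (fst p) * (x (True, snd p) s * x (False, fst p - snd p) s))" for i
      using eventually_at_right_less[of 0]
      by eventually_elim (subst xeq, assumption, simp add: quad sum_negf)
    \<comment> \<open>\<open>s * x i s\<close> is a coefficient of \<open>A s - A0\<close> or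
      \<open>B s - B0\<close>, which tends to 0 because the roots converge.\<close>
    show "((\<lambda>s. of_real s * x i s) \<longlongrightarrow> 0) (at_right 0)" for i
    proof -
      have "((\<lambda>s. coeff (if fst i then A s else B s) (snd i) - coeff (if fst i then A0 else B0) (snd i)) \<longlongrightarrow> 0) (at_right 0)"
        unfolding A_def B_def A0_def B0_def
        using coeff_root_poly_tendsto[OF fin(1), of \<nu> w "at_right 0" "snd i"]
          coeff_root_poly_tendsto[OF fin(2), of \<nu> w "at_right 0" "snd i"] lim
        by (cases "fst i") (simp_all add: LIM_zero_iff)
      moreover have "\<forall>\<^sub>F s in at_right 0. coeff (if fst i then A s else B s) (snd i) -
          coeff (if fst i then A0 else B0) (snd i) = of_real s * x i s"
        using eventually_at_right_less[of 0] by eventually_elim (simp add: AE x_def)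
      ultimately show ?thesis by (rule Lim_transform_eventually)
    qed
  qed (use i in simp)
  then have xs: "smooth_germ (x (True, k))" if "k \<le> d" using that by (auto simp: K_def)
  show ?thesis
  proof (cases "k \<le> d")
    case True
    have "smooth_germ (\<lambda>s. coeff A0 k + of_real s * x (True, k) s)"
      by (intro smooth_germ_add smooth_germ_const smooth_germ_mult smooth_germ_ident xs True)
    moreover have "\<forall>\<^sub>F s in at_right 0. coeff A0 k + of_real s * x (True, k) s = coeff (A s) k"
      using eventually_at_right_less[of 0] by eventually_elim (simp add: AE x_def)
    ultimately show ?thesis unfolding A_def by (rule smooth_germ_cong)
  next
    case False
    then have "coeff (root_poly J1 (\<lambda>j. \<nu> j s)) k = 0" for s by (intro coeff_eq_0) (simp add: d_def)
    then show ?thesis by (simp add: smooth_germ_const)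
  qed
qed

section \<open>Convergence of roots\<close>

text \<open>Only for \<open>s > 0\<close>: a rescaled root is a quotient by a power of
  \<open>s\<close>, and the existence of its limit at 0 is something to be proved.\<close>

definition cont_germ :: "(real \<Rightarrow> complex) \<Rightarrow> bool" where
  "cont_germ f \<longleftrightarrow> (\<exists>r>0. continuous_on {0<..<r} f)"

lemma lip_imp_cont_germ: "lip_germ f \<Longrightarrow> cont_germ f"
  unfolding lip_germ_def cont_germ_def using lipschitz_on_continuous_on by blast

lemma cont_germ_diff:
  assumes "cont_germ f" "cont_germ g"
  shows "cont_germ (\<lambda>s. f s - g s)"
proof -
  obtain r r' where "r > 0" "continuous_on {0<..<r} f" "r' > 0" "continuous_on {0<..<r'} g"
    using assms unfolding cont_germ_def by auto
  then have "min r r' > 0 \<and> continuous_on {0<..<min r r'} (\<lambda>s. f s - g s)"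
    by (auto intro!: continuous_on_diff elim: continuous_on_subset)
  then show ?thesis unfolding cont_germ_def by blast
qed

lemma cont_germ_rescale:
  assumes "cont_germ f" "N \<ge> 1"
  shows "cont_germ (\<lambda>s. f (s ^ N) / of_real s ^ p)"
proof -
  obtain r where r: "r > 0" "continuous_on {0<..<r} f" using assms(1) unfolding cont_germ_def by auto
  have "continuous_on {0<..<min r 1} (\<lambda>s. f (s ^ N))"
  proof (rule continuous_on_compose2[OF r(2)])
    have "s ^ N < r" if "0 < s" "s < r" "s < 1" for s
    proof -
      have "s ^ N \<le> s ^ 1" using that assms(2) by (intro power_decreasing) auto
      then show ?thesis using that by simp
    qed
    then show "(\<lambda>s. s ^ N) ` {0<..<min r 1} \<subseteq> {0<..<r}" by auto
  qed (intro continuous_intros)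
  then have "continuous_on {0<..<min r 1} (\<lambda>s. f (s ^ N) / of_real s ^ p)"
    by (intro continuous_on_divide) (auto intro!: continuous_intros)
  with r(1) show ?thesis unfolding cont_germ_def by (intro exI[of _ "min r 1"]) auto
qed

text \<open>If \<open>cmod z > 1\<close>, solve for the leading power, bound all lower powers by
  \<open>cmod z ^ (n - 1)\<close> and cancel.\<close>

lemma monic_root_bound:
  fixes p :: "complex poly"
  assumes "poly p z = 0" "degree p = n" "coeff p n = 1" "\<And>k. k < n \<Longrightarrow> cmod (coeff p k) \<le> B"
  shows "cmod z \<le> max 1 (n * B)"
proof (cases "cmod z \<le> 1")
  case False
  have n: "n > 0" using assms(1-3) by (cases n) (auto simp: poly_altdef)
  have "{..n} = insert n {..<n}" by auto
  then have "z ^ n = - (\<Sum>k<n. coeff p k * z ^ k)"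
    using assms(1-3) by (simp add: poly_altdef eq_neg_iff_add_eq_0)
  then have "cmod z ^ n = cmod (\<Sum>k<n. coeff p k * z ^ k)" by (metis norm_minus_cancel norm_power)
  also have "\<dots> \<le> (\<Sum>k<n. B * cmod z ^ (n - 1))"
  proof (rule sum_norm_le)
    fix k assume "k \<in> {..<n}"
    then have "cmod (coeff p k) \<le> B" "cmod z ^ k \<le> cmod z ^ (n - 1)"
      using assms(4) False by (auto intro: power_increasing)
    moreover from this(1) have "0 \<le> B" by (rule order_trans[OF norm_ge_zero])
    ultimately show "cmod (coeff p k * z ^ k) \<le> B * cmod z ^ (n - 1)"
      unfolding norm_mult norm_power by (intro mult_mono) auto
  qed
  finally have "cmod z * cmod z ^ (n - 1) \<le> (n * B) * cmod z ^ (n - 1)"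
    using n by (cases n) simp_all
  moreover have "cmod z ^ (n - 1) > 0" using False by (intro zero_less_power) linarith
  ultimately show ?thesis by simp
qed simp

lemma roots_bounded:
  assumes "finite J" "\<And>k. \<exists>B. \<forall>\<^sub>F s in F. cmod (coeff (root_poly J (\<lambda>j. \<nu> j s)) k) \<le> B"
  obtains B where "B > 0" "\<forall>\<^sub>F s in F. \<forall>j\<in>J. cmod (\<nu> j s) \<le> B"
proof -
  let ?n = "card J"
  obtain b where b: "\<And>k. \<forall>\<^sub>F s in F. cmod (coeff (root_poly J (\<lambda>j. \<nu> j s)) k) \<le> b k"
    using assms(2) by metis
  let ?B = "\<Sum>k<?n. \<bar>b k\<bar>"
  have "\<forall>\<^sub>F s in F. \<forall>k\<in>{..<?n}. cmod (coeff (root_poly J (\<lambda>j. \<nu> j s)) k) \<le> b k"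
    using b by (simp add: eventually_ball_finite_distrib)
  then have "\<forall>\<^sub>F s in F. \<forall>j\<in>J. cmod (\<nu> j s) \<le> max 1 (?n * ?B)"
  proof eventually_elim
    case (elim s)
    show ?case
    proof
      fix j assume j: "j \<in> J"
      show "cmod (\<nu> j s) \<le> max 1 (?n * ?B)"
      proof (rule monic_root_bound)
        show "poly (root_poly J (\<lambda>j. \<nu> j s)) (\<nu> j s) = 0"
          using j assms(1) by (auto simp: poly_root_poly)
        fix k assume k: "k < ?n"
        then have "cmod (coeff (root_poly J (\<lambda>j. \<nu> j s)) k) \<le> \<bar>b k\<bar>" using elim by force
        also have "\<dots> \<le> ?B" by (rule member_le_sum) (use k in auto)
        finally show "cmod (coeff (root_poly J (\<lambda>j. \<nu> j s)) k) \<le> ?B" .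
      qed auto
    qed
  qed
  then show ?thesis using that[of "max 1 (?n * ?B)"] by auto
qed

text \<open>Removing open discs around the roots from the closed ball leaves a compact set, on which
  the modulus has a positive minimum; that minimum is the threshold.\<close>

lemma small_value_near_root:
  fixes p :: "complex poly"
  assumes "e > 0"
  shows "\<exists>\<eta>>0. \<forall>z. cmod z \<le> B \<longrightarrow> cmod (poly p z) < \<eta> \<longrightarrow> (\<exists>r. poly p r = 0 \<and> cmod (z - r) < e)"
proof -
  define K where "K = cball 0 B - (\<Union>r\<in>{r. poly p r = 0}. ball r e)"
  have comp: "compact K" unfolding K_def by (intro compact_diff) auto
  have Kz: "z \<in> K" if "cmod z \<le> B" "\<not> (\<exists>r. poly p r = 0 \<and> cmod (z - r) < e)" for z
    using that by (auto simp: K_def dist_norm norm_minus_commute)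
  show ?thesis
  proof (cases "K = {}")
    case True
    then show ?thesis using Kz by (intro exI[of _ 1]) auto
  next
    case False
    have "continuous_on K (\<lambda>z. cmod (poly p z))" by (intro continuous_intros)
    then obtain z0 where z0: "z0 \<in> K" "\<And>z. z \<in> K \<Longrightarrow> cmod (poly p z0) \<le> cmod (poly p z)"
      using continuous_attains_inf[OF comp False] by blast
    have "poly p z0 \<noteq> 0" using z0(1) assms by (auto simp: K_def)
    moreover have "\<exists>r. poly p r = 0 \<and> cmod (z - r) < e" if "cmod z \<le> B" "cmod (poly p z) < cmod (poly p z0)" for z
      using that Kz z0(2) by (meson not_le)
    ultimately show ?thesis by (intro exI[of _ "cmod (poly p z0)"]) auto
  qed
qed

lemma finite_separation:
  fixes R :: "complex set"
  assumes "finite R"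
  obtains d where "d > 0" "\<And>x y. x \<in> R \<Longrightarrow> y \<in> R \<Longrightarrow> x \<noteq> y \<Longrightarrow> d \<le> cmod (x - y)"
proof -
  \<comment> \<open>The element 1 keeps the set nonempty when \<open>R\<close> has at most one
    point.\<close>
  define D where "D = insert 1 ((\<lambda>(x, y). cmod (x - y)) ` {p \<in> R \<times> R. fst p \<noteq> snd p})"
  have fin: "finite D" using assms by (auto simp: D_def)
  have "Min D \<in> D" by (rule Min_in) (use fin D_def in auto)
  then have "Min D > 0" by (auto simp: D_def)
  moreover have "Min D \<le> cmod (x - y)" if "x \<in> R" "y \<in> R" "x \<noteq> y" for x y
    by (rule Min_le[OF fin]) (use that in \<open>auto simp: D_def image_iff\<close>)
  ultimately show ?thesis using that by blast
qed

text \<open>A value at distance exactly \<open>d / 3\<close> from \<open>r0\<close> would lie within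
  \<open>d / 3\<close> of another point of \<open>R\<close>, against the separation
  \<open>d\<close>. By connectedness the function never leaves the disc around
  \<open>r0\<close>.\<close>

lemma cont_germ_tendsto_finite:
  assumes "finite R" "cont_germ f" "\<And>e. e > 0 \<Longrightarrow> \<forall>\<^sub>F s in at_right 0. \<exists>r\<in>R. cmod (f s - r) < e"
  obtains r where "(f \<longlongrightarrow> r) (at_right 0)"
proof -
  obtain d where d: "d > 0" "\<And>x y. x \<in> R \<Longrightarrow> y \<in> R \<Longrightarrow> x \<noteq> y \<Longrightarrow> d \<le> cmod (x - y)"
    using finite_separation[OF assms(1)] by blast
  obtain \<rho> where \<rho>: "\<rho> > 0" "continuous_on {0<..<\<rho>} f" using assms(2) unfolding cont_germ_def by blast
  obtain \<eta>0 where \<eta>0: "\<eta>0 > 0" "\<And>s. 0 < s \<Longrightarrow> s < \<eta>0 \<Longrightarrow> \<exists>r\<in>R. cmod (f s - r) < d / 3"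
    using assms(3)[of "d / 3"] d(1) unfolding eventually_at_right_field by auto
  define \<eta> where "\<eta> = min \<eta>0 \<rho>"
  have \<eta>: "\<eta> > 0" using \<eta>0 \<rho> by (simp add: \<eta>_def)
  obtain r0 where r0: "r0 \<in> R" "cmod (f (\<eta> / 2) - r0) < d / 3"
  proof -
    have "\<eta> / 2 < \<eta>0" using \<eta> \<eta>0(1) by (simp add: \<eta>_def)
    with \<eta> show ?thesis using \<eta>0(2)[of "\<eta> / 2"] that by auto
  qed
  define u where "u s = cmod (f s - r0)" for s
  have cont: "continuous_on {0<..<\<eta>} u" unfolding u_def
    by (intro continuous_intros continuous_on_subset[OF \<rho>(2)]) (auto simp: \<eta>_def)
  have conn: "connected (u ` {0<..<\<eta>})" by (rule connected_continuous_image[OF cont]) auto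
  have near: "u s < d / 3" if s: "s \<in> {0<..<\<eta>}" for s
  proof (rule ccontr)
    assume "\<not> u s < d / 3"
    then have "d / 3 \<in> {u (\<eta> / 2)..u s}" using r0(2) by (auto simp: u_def)
    also have "\<dots> \<subseteq> u ` {0<..<\<eta>}"
      by (rule connected_contains_Icc[OF conn]) (use s \<eta> in auto)
    finally obtain s' where s': "s' \<in> {0<..<\<eta>}" "u s' = d / 3" by auto
    obtain r' where r': "r' \<in> R" "cmod (f s' - r') < d / 3" using \<eta>0(2)[of s'] s' by (auto simp: \<eta>_def)
    have "r' \<noteq> r0" using r' s' by (auto simp: u_def)
    then have "d \<le> cmod (r' - r0)" using d(2) r' r0 by blast
    also have "\<dots> \<le> cmod (f s' - r') + cmod (f s' - r0)"
      using norm_triangle_ineq4[of "f s' - r0" "f s' - r'"] by simp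
    also have "\<dots> < d / 3 + d / 3" using r' s' by (simp add: u_def)
    finally show False using d(1) by simp
  qed
  have "(f \<longlongrightarrow> r0) (at_right 0)"
  proof (rule tendstoI)
    fix e :: real assume "e > 0"
    then have "\<forall>\<^sub>F s in at_right 0. \<exists>r\<in>R. cmod (f s - r) < min e (d / 3)" using d(1) by (intro assms(3)) auto
    then show "\<forall>\<^sub>F s in at_right 0. dist (f s) r0 < e"
      using eventually_at_right_real[OF \<eta>]
    proof eventually_elim
      case (elim s)
      then obtain r where r: "r \<in> R" "cmod (f s - r) < min e (d / 3)" by blast
      have "cmod (r - r0) \<le> cmod (f s - r) + cmod (f s - r0)"
        using norm_triangle_ineq4[of "f s - r0" "f s - r"] by simp
      also have "\<dots> < d / 3 + d / 3" using near[OF elim(2)] r by (simp add: u_def)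
      finally have "r = r0" using d(1) d(2)[OF r(1) r0(1)] by (cases "r = r0") auto
      then show ?case using r by (simp add: dist_norm)
    qed
  qed
  then show ?thesis using that by blast
qed

lemma poly_eq_sum_le:
  fixes p :: "complex poly"
  assumes "degree p \<le> n"
  shows "poly p z = (\<Sum>k\<le>n. coeff p k * z ^ k)"
  using arg_cong[OF poly_as_sum_of_monoms'[OF assms], of "\<lambda>q. poly q z"]
  by (simp add: poly_sum poly_monom)

text \<open>The limit polynomial evaluated at a root tends to 0, because it differs from the
  polynomial having that root by small coefficients. So each root approaches the finite zero set of
  the limit, and continuity selects one zero.\<close>

lemma roots_converge:
  assumes fin: "finite J" and cont: "\<And>j. j \<in> J \<Longrightarrow> cont_germ (\<nu> j)"
    and lim: "\<And>k. ((\<lambda>s. coeff (root_poly J (\<lambda>j. \<nu> j s)) k) \<longlongrightarrow> c k) (at_right 0)"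
  obtains w where "\<And>j. j \<in> J \<Longrightarrow> (\<nu> j \<longlongrightarrow> w j) (at_right 0)" "\<And>k. coeff (root_poly J w) k = c k"
proof -
  let ?n = "card J"
  define p0 where "p0 = (\<Sum>k\<le>?n. monom (c k) k)"
  have cp0: "coeff p0 k = c k" if "k \<le> ?n" for k
    using that by (simp add: p0_def coeff_sum)
  \<comment> \<open>The leading coefficient is constantly 1, which makes the limit polynomial
    nonzero and its zero set finite.\<close>
  have "c ?n = 1" using tendsto_unique[OF _ lim[of ?n], of 1] by simp
  then have "p0 \<noteq> 0" using cp0[of ?n] by auto
  have deg: "degree p0 \<le> ?n" unfolding p0_def by (intro degree_sum_le) (auto intro: order_trans[OF degree_monom_le])
  have "\<exists>B. \<forall>\<^sub>F s in at_right 0. cmod (coeff (root_poly J (\<lambda>j. \<nu> j s)) k) \<le> B" for k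
  proof -
    have "\<forall>\<^sub>F s in at_right 0. cmod (coeff (root_poly J (\<lambda>j. \<nu> j s)) k) < cmod (c k) + 1"
      using tendsto_norm[OF lim[of k]] by (rule order_tendstoD) simp
    then have "\<forall>\<^sub>F s in at_right 0. cmod (coeff (root_poly J (\<lambda>j. \<nu> j s)) k) \<le> cmod (c k) + 1"
      by eventually_elim simp
    then show ?thesis by blast
  qed
  from roots_bounded[OF fin this] obtain B where B: "B > 0" "\<forall>\<^sub>F s in at_right 0. \<forall>j\<in>J. cmod (\<nu> j s) \<le> B" .
  have poly0: "((\<lambda>s. poly p0 (\<nu> j s)) \<longlongrightarrow> 0) (at_right 0)" if j: "j \<in> J" for j
  proof (rule Lim_null_comparison)
    define C where "C s = (\<Sum>k\<le>?n. cmod (c k - coeff (root_poly J (\<lambda>j. \<nu> j s)) k) * B ^ k)" for s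
    show "\<forall>\<^sub>F s in at_right 0. cmod (poly p0 (\<nu> j s)) \<le> C s"
      using B(2)
    proof eventually_elim
      case (elim s)
      let ?z = "\<nu> j s" and ?P = "root_poly J (\<lambda>j. \<nu> j s)"
      have "poly ?P ?z = 0" using j fin by (auto simp: poly_root_poly)
      then have "poly p0 ?z = (\<Sum>k\<le>?n. coeff p0 k * ?z ^ k) - (\<Sum>k\<le>?n. coeff ?P k * ?z ^ k)"
        using poly_eq_sum_le[OF deg, of ?z] poly_altdef[of ?P ?z] by simp
      also have "\<dots> = (\<Sum>k\<le>?n. (c k - coeff ?P k) * ?z ^ k)"
        by (simp add: cp0 sum_subtractf left_diff_distrib)
      also have "cmod \<dots> \<le> C s" unfolding C_def
        by (rule sum_norm_le) (use elim j in \<open>auto simp: norm_mult norm_power intro!: mult_left_mono power_mono\<close>)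
      finally show ?case .
    qed
    have "(C \<longlongrightarrow> (\<Sum>k\<le>?n. cmod (c k - c k) * B ^ k)) (at_right 0)"
      unfolding C_def by (intro tendsto_intros lim)
    then show "(C \<longlongrightarrow> 0) (at_right 0)" by simp
  qed
  have "\<exists>r. (\<nu> j \<longlongrightarrow> r) (at_right 0)" if j: "j \<in> J" for j
  proof -
    have "\<forall>\<^sub>F s in at_right 0. \<exists>r\<in>{r. poly p0 r = 0}. cmod (\<nu> j s - r) < e" if "e > 0" for e
    proof -
      obtain \<eta> where \<eta>: "\<eta> > 0" "\<And>z. cmod z \<le> B \<Longrightarrow> cmod (poly p0 z) < \<eta> \<Longrightarrow> \<exists>r. poly p0 r = 0 \<and> cmod (z - r) < e"
        using small_value_near_root[OF \<open>e > 0\<close>, of B p0] by blast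
      have "\<forall>\<^sub>F s in at_right 0. cmod (poly p0 (\<nu> j s)) < \<eta>"
        using tendsto_norm[OF poly0[OF j]] \<eta>(1) by (intro order_tendstoD) auto
      then show ?thesis using B(2) by eventually_elim (use \<eta>(2) j in auto)
    qed
    from cont_germ_tendsto_finite[OF poly_roots_finite[OF \<open>p0 \<noteq> 0\<close>] cont[OF j] this]
    show ?thesis by blast
  qed
  then obtain w where w: "\<And>j. j \<in> J \<Longrightarrow> (\<nu> j \<longlongrightarrow> w j) (at_right 0)" by metis
  have "coeff (root_poly J w) k = c k" for k
    using tendsto_unique[OF _ coeff_root_poly_tendsto[OF fin w] lim] by simp
  with w show ?thesis using that by blast
qed

section \<open>Coefficients under scaling and translation of the roots\<close>

text \<open>Homogeneity of elementary symmetric functions: the degree in the roots is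
  \<open>card J - k\<close>.\<close>

lemma coeff_root_poly_divide:
  assumes "finite J" "c \<noteq> 0" "k \<le> card J"
  shows "coeff (root_poly J (\<lambda>j. w j / c)) k = coeff (root_poly J w) k / c ^ (card J - k)"
  using assms(1,3)
proof (induction J arbitrary: k rule: finite_induct)
  case empty then show ?case by (simp add: root_poly_def)
next
  case (insert j J)
  have *: "coeff (root_poly (insert j J) v) k = - v j * coeff (root_poly J v) k +
      (case k of 0 \<Rightarrow> 0 | Suc l \<Rightarrow> coeff (root_poly J v) l)" for v
    using insert.hyps by (simp add: root_poly_insert coeff_pCons)
  have big: "coeff (root_poly J v) k = 0" if "k > card J" for v using that by (intro coeff_eq_0) simp
  show ?case
  proof (cases "k \<le> card J")
    case True
    note IH = insert.IH[OF True]
    have N: "card (insert j J) - k = Suc (card J - k)" using True insert.hyps by (simp add: Suc_diff_le)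
    show ?thesis
    proof (cases k)
      case 0
      then show ?thesis unfolding * N using IH assms(2) by simp
    next
      case (Suc l)
      have "l \<le> card J" "card J - l = Suc (card J - k)" using True Suc by auto
      then have "coeff (root_poly J (\<lambda>j. w j / c)) l = coeff (root_poly J w) l / c ^ Suc (card J - k)"
        using insert.IH[of l] by simp
      then show ?thesis unfolding * N using IH assms(2) Suc by (simp add: field_simps)
    qed
  next
    case False
    then have "k = Suc (card J)" using insert by simp
    then show ?thesis unfolding * using insert big by simp
  qed
qed

lemma coeff_root_poly_sum:
  assumes "finite J" "J \<noteq> {}"
  shows "coeff (root_poly J w) (card J - 1) = - (\<Sum>j\<in>J. w j)"
  using assms
proof (induction J rule: finite_ne_induct)
  case (singleton x) then show ?case by (simp add: root_poly_def)
next
  case (insert j J)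
  then have "coeff (root_poly (insert j J) w) (card J) = - w j + coeff (root_poly J w) (card J - 1)"
    using insert.hyps coeff_root_poly_card[of J w]
    by (cases "card J") (simp_all add: root_poly_insert coeff_pCons)
  with insert show ?case by simp
qed

text \<open>Translating the roots is composition with \<open>z + m\<close>, whose coefficients are
  polynomial in \<open>m\<close> and the old coefficients.\<close>

lemma smooth_germ_coeff_shift:
  assumes fin: "finite J" and m: "smooth_germ m"
    and smooth: "\<And>k. smooth_germ (\<lambda>s. coeff (root_poly J (\<lambda>j. \<nu> j s)) k)"
  shows "smooth_germ (\<lambda>s. coeff (root_poly J (\<lambda>j. \<nu> j s - m s)) k)"
proof -
  have pow: "smooth_germ (\<lambda>s. coeff ([:m s, 1:] ^ i) k)" for i k
  proof (induction i arbitrary: k)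
    case 0 then show ?case by (cases k) (simp_all add: smooth_germ_const)
  next
    case (Suc i)
    have "coeff ([:m s, 1:] ^ Suc i) k = m s * coeff ([:m s, 1:] ^ i) k +
        (if k = 0 then 0 else coeff ([:m s, 1:] ^ i) (k - 1))" for s
      by (simp add: coeff_pCons split: nat.split)
    moreover have "smooth_germ (\<lambda>s. if k = 0 then 0 else coeff ([:m s, 1:] ^ i) (k - 1))"
      by (cases "k = 0") (simp_all add: smooth_germ_const Suc)
    ultimately show ?case by (simp only:) (intro smooth_germ_add smooth_germ_mult m Suc)
  qed
  have "root_poly J (\<lambda>j. \<nu> j s - m s) = pcompose (root_poly J (\<lambda>j. \<nu> j s)) [:m s, 1:]" for s
    unfolding root_poly_def by (simp add: pcompose_prod pcompose_pCons)
  moreover have "pcompose (root_poly J (\<lambda>j. \<nu> j s)) q =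
      (\<Sum>i\<le>card J. smult (coeff (root_poly J (\<lambda>j. \<nu> j s)) i) (q ^ i))" for s q
  proof -
    have "root_poly J (\<lambda>j. \<nu> j s) = (\<Sum>i\<le>card J. smult (coeff (root_poly J (\<lambda>j. \<nu> j s)) i) ([:0, 1:] ^ i))"
      using poly_as_sum_of_monoms[of "root_poly J (\<lambda>j. \<nu> j s)"] by (simp add: monom_altdef)
    then have "pcompose (root_poly J (\<lambda>j. \<nu> j s)) q =
        pcompose (\<Sum>i\<le>card J. smult (coeff (root_poly J (\<lambda>j. \<nu> j s)) i) ([:0, 1:] ^ i)) q" by (rule arg_cong)
    moreover have "pcompose ([:0, 1:] ^ i) q = q ^ i" for i
      by (induction i) (simp_all add: pcompose_mult pcompose_pCons pcompose_1 del: mult_pCons_left)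
    ultimately show ?thesis by (simp add: pcompose_sum pcompose_smult)
  qed
  ultimately have "coeff (root_poly J (\<lambda>j. \<nu> j s - m s)) k =
      (\<Sum>i\<le>card J. coeff (root_poly J (\<lambda>j. \<nu> j s)) i * coeff ([:m s, 1:] ^ i) k)" for s
    by (simp add: coeff_sum)
  then show ?thesis by (simp only:) (intro smooth_germ_sum smooth_germ_mult smooth pow)
qed

section \<open>Lipschitz roots after a power substitution\<close>

text \<open>Depends on the difference only, hence survives subtraction of the common mean. The
  disjunction rules out a difference that is flat without vanishing near 0.\<close>

definition separated_germs :: "(real \<Rightarrow> complex) \<Rightarrow> (real \<Rightarrow> complex) \<Rightarrow> bool" where
  "separated_germs f g \<longleftrightarrow> (\<forall>\<^sub>F s in at_right 0. f s = g s) \<or>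
     (\<exists>c>0. \<exists>M. \<forall>\<^sub>F s in at_right 0. c * s ^ M \<le> cmod (f s - g s))"

text \<open>The substitution multiplies the exponent \<open>M\<close> by \<open>N\<close>, and
  division by \<open>s ^ p\<close> with \<open>s < 1\<close> can only enlarge the
  difference.\<close>

lemma separated_germs_rescale:
  assumes "separated_germs f g" "N \<ge> 1"
  shows "separated_germs (\<lambda>s. f (s ^ N) / of_real s ^ p) (\<lambda>s. g (s ^ N) / of_real s ^ p)"
  using assms(1) unfolding separated_germs_def
proof (elim disjE exE conjE)
  assume "\<forall>\<^sub>F s in at_right 0. f s = g s"
  from eventually_power_at_right_0[OF assms(2) this]
  have "\<forall>\<^sub>F s in at_right 0. f (s ^ N) / of_real s ^ p = g (s ^ N) / of_real s ^ p"
    by eventually_elim simp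
  then show "(\<forall>\<^sub>F s in at_right 0. f (s ^ N) / of_real s ^ p = g (s ^ N) / of_real s ^ p) \<or>
    (\<exists>c>0. \<exists>M. \<forall>\<^sub>F s in at_right 0. c * s ^ M \<le> cmod (f (s ^ N) / of_real s ^ p - g (s ^ N) / of_real s ^ p))" ..
next
  fix c M assume c: "c > 0" "\<forall>\<^sub>F s in at_right 0. c * s ^ M \<le> cmod (f s - g s)"
  have "\<forall>\<^sub>F s in at_right 0. c * s ^ (N * M) \<le> cmod (f (s ^ N) / of_real s ^ p - g (s ^ N) / of_real s ^ p)"
    using eventually_power_at_right_0[OF assms(2) c(2)] eventually_at_right_real[OF zero_less_one]
  proof eventually_elim
    case (elim s)
    have sp: "0 < s ^ p" "s ^ p \<le> 1" using elim by (auto intro: power_le_one)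
    have "c * s ^ (N * M) \<le> cmod (f (s ^ N) - g (s ^ N))" using elim by (simp add: power_mult)
    also have "\<dots> \<le> cmod (f (s ^ N) - g (s ^ N)) / s ^ p"
      using sp by (simp add: le_divide_eq mult_left_le)
    also have "\<dots> = cmod (f (s ^ N) / of_real s ^ p - g (s ^ N) / of_real s ^ p)"
      using elim by (simp add: diff_divide_distrib[symmetric] norm_divide norm_power)
    finally show ?case .
  qed
  with c(1) show "(\<forall>\<^sub>F s in at_right 0. f (s ^ N) / of_real s ^ p = g (s ^ N) / of_real s ^ p) \<or>
    (\<exists>c>0. \<exists>M. \<forall>\<^sub>F s in at_right 0. c * s ^ M \<le> cmod (f (s ^ N) / of_real s ^ p - g (s ^ N) / of_real s ^ p))"
    by blast
qed

lemma separated_germs_flat: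
  assumes "separated_germs f g"
    and "\<And>M. \<exists>B. \<forall>\<^sub>F s in at_right 0. cmod (f s - g s) \<le> B * s ^ M"
  shows "\<forall>\<^sub>F s in at_right 0. f s = g s"
proof (rule ccontr)
  assume "\<not> ?thesis"
  then obtain c M where c: "c > 0" "\<forall>\<^sub>F s in at_right 0. c * s ^ M \<le> cmod (f s - g s)"
    using assms(1) unfolding separated_germs_def by blast
  \<comment> \<open>One power beyond \<open>M\<close> already contradicts the lower bound.\<close>
  obtain B where B: "\<forall>\<^sub>F s in at_right 0. cmod (f s - g s) \<le> B * s ^ Suc M" using assms(2) by blast
  have "((\<lambda>s. B * s) \<longlongrightarrow> B * 0) (at_right 0)" by (intro tendsto_intros)
  then have "\<forall>\<^sub>F s in at_right 0. B * s < c" using c(1) by (intro order_tendstoD) auto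
  then have "\<forall>\<^sub>F s :: real in at_right 0. False" using c(2) B eventually_at_right_less[of 0]
  proof eventually_elim
    case (elim s)
    have "c * s ^ M \<le> (B * s) * s ^ M" using order_trans[OF elim(2,3)] by (simp add: mult_ac)
    moreover have "(B * s) * s ^ M < c * s ^ M" using elim by (intro mult_strict_right_mono) auto
    ultimately show False by simp
  qed
  then show False by (simp add: trivial_limit_at_right_real)
qed

text \<open>After division by \<open>s\<^sup>M\<close> the roots are those of a polynomial with bounded coefficients.\<close>

lemma flat_coeffs_imp_flat_roots:
  assumes fin: "finite J"
    and flat: "\<And>k M. k < card J \<Longrightarrow> \<exists>B. \<forall>\<^sub>F s in at_right 0. cmod (coeff (root_poly J (\<lambda>j. \<mu> j s)) k) \<le> B * s ^ M"
  shows "\<exists>B. \<forall>\<^sub>F s in at_right 0. \<forall>j\<in>J. cmod (\<mu> j s) \<le> B * s ^ M"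
proof -
  let ?n = "card J"
  have "\<exists>B. \<forall>\<^sub>F s in at_right 0. cmod (coeff (root_poly J (\<lambda>j. \<mu> j s / of_real s ^ M)) k) \<le> B" for k
  proof (cases "k < ?n")
    case True
    \<comment> \<open>Dividing the roots by \<open>s ^ M\<close> divides coefficient
      \<open>k\<close> by the power \<open>M * (card J - k)\<close>, so flatness of exactly this
      order leaves it bounded.\<close>
    obtain B where B: "\<forall>\<^sub>F s in at_right 0. cmod (coeff (root_poly J (\<lambda>j. \<mu> j s)) k) \<le> B * s ^ (M * (?n - k))"
      using flat[OF True] by blast
    have "\<forall>\<^sub>F s in at_right 0. cmod (coeff (root_poly J (\<lambda>j. \<mu> j s / of_real s ^ M)) k) \<le> B"
      using B eventually_at_right_less[of 0]
    proof eventually_elim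
      case (elim s)
      then show ?case using fin True
        by (simp add: coeff_root_poly_divide norm_divide norm_power power_mult pos_divide_le_eq)
    qed
    then show ?thesis by blast
  next
    case False
    have "cmod (coeff (root_poly J (\<lambda>j. \<mu> j s / of_real s ^ M)) k) \<le> 1" for s
    proof (cases "k = ?n")
      case False
      with \<open>\<not> k < ?n\<close> have "coeff (root_poly J (\<lambda>j. \<mu> j s / of_real s ^ M)) k = 0"
        by (intro coeff_eq_0) simp
      then show ?thesis by simp
    qed simp
    then show ?thesis by (intro exI[of _ 1]) simp
  qed
  from roots_bounded[OF fin this] obtain B where
    B: "\<forall>\<^sub>F s in at_right 0. \<forall>j\<in>J. cmod (\<mu> j s / of_real s ^ M) \<le> B" .
  have "\<forall>\<^sub>F s in at_right 0. \<forall>j\<in>J. cmod (\<mu> j s) \<le> B * s ^ M"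
    using B eventually_at_right_less[of 0]
    by eventually_elim (auto simp: norm_divide norm_power pos_divide_le_eq)
  then show ?thesis by blast
qed

text \<open>Flat differences of separated roots vanish, so all roots coincide near 0 and equal their
  mean, which is 0.\<close>

lemma flat_roots_eq:
  assumes fin: "finite J" and i: "i \<in> J" and sum0: "\<And>s. (\<Sum>j\<in>J. \<mu> j s) = 0"
    and sep: "\<And>i j. i \<in> J \<Longrightarrow> j \<in> J \<Longrightarrow> separated_germs (\<mu> i) (\<mu> j)"
    and flat: "\<And>M. \<exists>B. \<forall>\<^sub>F s in at_right 0. \<forall>j\<in>J. cmod (\<mu> j s) \<le> B * s ^ M"
  shows "\<forall>\<^sub>F s in at_right 0. \<mu> i s = 0"
proof -
  have "\<forall>\<^sub>F s in at_right 0. \<mu> i s = \<mu> j s" if j: "j \<in> J" for j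
  proof (rule separated_germs_flat[OF sep[OF i j]])
    fix M
    obtain B where B: "\<forall>\<^sub>F s in at_right 0. \<forall>j\<in>J. cmod (\<mu> j s) \<le> B * s ^ M" using flat by blast
    then have "\<forall>\<^sub>F s in at_right 0. cmod (\<mu> i s - \<mu> j s) \<le> (2 * B) * s ^ M"
    proof eventually_elim
      case (elim s)
      then have "cmod (\<mu> i s) \<le> B * s ^ M" "cmod (\<mu> j s) \<le> B * s ^ M" using i j by auto
      then show ?case using norm_triangle_ineq4[of "\<mu> i s" "\<mu> j s"] by simp
    qed
    then show "\<exists>B. \<forall>\<^sub>F s in at_right 0. cmod (\<mu> i s - \<mu> j s) \<le> B * s ^ M" by blast
  qed
  then have "\<forall>\<^sub>F s in at_right 0. \<forall>j\<in>J. \<mu> i s = \<mu> j s" using fin by (simp add: eventually_ball_finite_distrib)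
  then show ?thesis
  proof eventually_elim
    case (elim s)
    then have "(\<Sum>j\<in>J. \<mu> j s) = (\<Sum>j\<in>J. \<mu> i s)" by (intro sum.cong) auto
    then show ?case using sum0[of s] i fin by (auto simp: card_eq_0_iff)
  qed
qed

lemma smooth_germ_pow_bounded:
  assumes "smooth_germ g" "\<forall>\<^sub>F s in at_right 0. f s = of_real s ^ M * g s"
  shows "\<exists>B. \<forall>\<^sub>F s in at_right 0. cmod (f s) \<le> B * s ^ M"
proof -
  obtain B where B: "\<forall>\<^sub>F s in at_right 0. cmod (g s) \<le> B"
    using lip_germ_bounded[OF smooth_germ_lip[OF assms(1)]] by blast
  have "\<forall>\<^sub>F s in at_right 0. cmod (f s) \<le> B * s ^ M"
    using B assms(2) eventually_at_right_less[of 0]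
    by eventually_elim (simp add: norm_mult norm_power mult.commute[of B] mult_left_mono)
  then show ?thesis by blast
qed

text \<open>\<open>e\<close> is the exponent that scaling the roots imposes on a coefficient, and
  \<open>N * m\<close> is its order after the substitution; the inequality between them is the
  Newton polygon condition.\<close>

lemma smooth_germ_rescaled:
  assumes "smooth_germ g" "\<forall>\<^sub>F s in at_right 0. f s = of_real s ^ m * g s" "N \<ge> 1" "e \<le> N * m"
  shows "smooth_germ (\<lambda>s. f (s ^ N) / of_real s ^ e)"
    and "\<forall>\<^sub>F s in at_right 0. of_real s ^ (N * m - e) * g (s ^ N) = f (s ^ N) / of_real s ^ e"
proof -
  have e: "of_real (s ^ N) ^ m = (of_real s ^ (N * m - e) * of_real s ^ e :: complex)" for s :: real
    using assms(4) by (simp add: power_mult[symmetric] power_add[symmetric])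
  show ev: "\<forall>\<^sub>F s in at_right 0. of_real s ^ (N * m - e) * g (s ^ N) = f (s ^ N) / of_real s ^ e"
    using eventually_power_at_right_0[OF assms(3,2)] eventually_at_right_less[of 0]
    by eventually_elim (simp only: e, simp)
  show "smooth_germ (\<lambda>s. f (s ^ N) / of_real s ^ e)"
    by (rule smooth_germ_cong[OF _ ev])
      (intro smooth_germ_mult smooth_germ_power smooth_germ_ident smooth_germ_power_subst assms)
qed

text \<open>Minimises the Newton polygon slope \<open>m k / (n - k)\<close>; the conclusion is
  cross-multiplied to remain in the natural numbers.\<close>

lemma exists_min_slope:
  assumes "finite S" "S \<noteq> {}" "\<And>k. k \<in> S \<Longrightarrow> k < (n::nat)"
  obtains k0 where "k0 \<in> S" "\<And>k. k \<in> S \<Longrightarrow> (m k0 :: nat) * (n - k) \<le> m k * (n - k0)"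
proof -
  define q where "q k = real (m k) / real (n - k)" for k
  obtain k0 where k0: "k0 \<in> S" "\<And>k. k \<in> S \<Longrightarrow> q k0 \<le> q k"
    using finite_imageI[OF assms(1), of q] assms(2) arg_min_if_finite[of S q]
    by (metis assms(1) not_le)
  have "m k0 * (n - k) \<le> m k * (n - k0)" if k: "k \<in> S" for k
  proof -
    have "real (m k0) * real (n - k) \<le> real (m k) * real (n - k0)"
      using k0(2)[OF k] assms(3)[OF k] assms(3)[OF k0(1)]
      by (simp add: q_def divide_le_eq le_divide_eq field_simps)
    then show ?thesis by (metis of_nat_le_iff of_nat_mult)
  qed
  with k0(1) show ?thesis using that by blast
qed

text \<open>One step for centred roots. The induction hypothesis enters as the assumption
  \<open>IH\<close> on proper subsets containing \<open>i\<close>, since only the cluster of the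
  root with index \<open>i\<close> is followed.\<close>

lemma puiseux_lip_step:
  fixes \<mu> :: "'j \<Rightarrow> real \<Rightarrow> complex"
  assumes fin: "finite J" and sum0: "\<And>s. (\<Sum>j\<in>J. \<mu> j s) = 0"
    and cont: "\<And>j. j \<in> J \<Longrightarrow> cont_germ (\<mu> j)"
    and smooth: "\<And>k. smooth_germ (\<lambda>s. coeff (root_poly J (\<lambda>j. \<mu> j s)) k)"
    and sep: "\<And>i j. i \<in> J \<Longrightarrow> j \<in> J \<Longrightarrow> separated_germs (\<mu> i) (\<mu> j)"
    and i: "i \<in> J"
    and IH: "\<And>J' \<nu>. J' \<subset> J \<Longrightarrow> i \<in> J' \<Longrightarrow> (\<And>j. j \<in> J' \<Longrightarrow> cont_germ (\<nu> j)) \<Longrightarrow>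
        (\<And>k. smooth_germ (\<lambda>s. coeff (root_poly J' (\<lambda>j. \<nu> j s)) k)) \<Longrightarrow>
        (\<And>i j. i \<in> J' \<Longrightarrow> j \<in> J' \<Longrightarrow> separated_germs (\<nu> i) (\<nu> j)) \<Longrightarrow>
        \<exists>N\<ge>1. lip_germ (\<lambda>s. (\<nu> :: 'j \<Rightarrow> real \<Rightarrow> complex) i (s ^ N))"
  shows "\<exists>N\<ge>1. lip_germ (\<lambda>s. \<mu> i (s ^ N))"
proof -
  define n where "n = card J"
  define b where "b k s = coeff (root_poly J (\<lambda>j. \<mu> j s)) k" for k s
  have sb: "smooth_germ (b k)" for k using smooth[of k] by (simp add: b_def[abs_def])
  \<comment> \<open>The nonleading coefficients that are not flat; they span the Newton
    polygon.\<close>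
  define S where "S = {k. k < n \<and> (\<exists>m. has_order (b k) m)}"
  show ?thesis
  proof (cases "S = {}")
    case True
    have "\<exists>B. \<forall>\<^sub>F s in at_right 0. cmod (coeff (root_poly J (\<lambda>j. \<mu> j s)) k) \<le> B * s ^ M" if "k < card J" for k M
    proof -
      have "\<not> has_order (b k) m" for m using True that by (auto simp: S_def n_def)
      then obtain g where "smooth_germ g" "\<forall>\<^sub>F s in at_right 0. b k s = of_real s ^ M * g s"
        using smooth_germ_order_cases[OF sb[of k], of M] by blast
      from smooth_germ_pow_bounded[OF this] show ?thesis by (simp add: b_def)
    qed
    from flat_coeffs_imp_flat_roots[OF fin this]
    have "\<exists>B. \<forall>\<^sub>F s in at_right 0. \<forall>j\<in>J. cmod (\<mu> j s) \<le> B * s ^ M" for M .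
    with flat_roots_eq[OF fin i sum0 sep] have "\<forall>\<^sub>F s in at_right 0. \<mu> i s = 0" by blast
    then have "\<forall>\<^sub>F s in at_right 0. 0 = \<mu> i s" by eventually_elim simp
    then have "lip_germ (\<mu> i)" using lip_germ_cong[OF lip_germ_const] by blast
    then show ?thesis by (intro exI[of _ 1]) simp
  next
    case False
    define m where "m k = (SOME m. has_order (b k) m)" for k
    have m: "has_order (b k) (m k)" if "k \<in> S" for k
      using that someI_ex[of "has_order (b k)"] by (auto simp: S_def m_def)
    have finS: "finite S" by (simp add: S_def)
    obtain k0 where k0: "k0 \<in> S" "\<And>k. k \<in> S \<Longrightarrow> m k0 * (n - k) \<le> m k * (n - k0)"
      using exists_min_slope[OF finS False, of n m] by (auto simp: S_def)
    \<comment> \<open>The slope is \<open>p / N\<close>, not necessarily in lowest terms. After the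
      substitution by \<open>s ^ N\<close> the scaling factor becomes the integral power
      \<open>s ^ p\<close>.\<close>
    define N where "N = n - k0"
    define p where "p = m k0"
    have k0n: "k0 < n" using k0(1) by (simp add: S_def)
    have N: "N \<ge> 1" using k0n by (simp add: N_def)
    define \<nu> where "\<nu> j s = \<mu> j (s ^ N) / of_real s ^ p" for j s
    have coef\<nu>: "\<forall>\<^sub>F s in at_right 0. b k (s ^ N) / of_real s ^ (p * (n - k)) = coeff (root_poly J (\<lambda>j. \<nu> j s)) k"
      if "k \<le> n" for k
      using eventually_at_right_less[of 0]
      by eventually_elim (use fin that in \<open>simp add: \<nu>_def b_def n_def coeff_root_poly_divide power_mult\<close>)
    have smooth\<nu>: "smooth_germ (\<lambda>s. coeff (root_poly J (\<lambda>j. \<nu> j s)) k)" for k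
    proof -
      consider "k \<in> S" | "k < n" "k \<notin> S" | "k = n" | "k > n" by fastforce
      then show ?thesis
      proof cases
        case 1
        obtain g where g: "smooth_germ g" "\<forall>\<^sub>F s in at_right 0. b k s = of_real s ^ m k * g s"
          using m[OF 1] unfolding has_order_def by blast
        have "p * (n - k) \<le> N * m k" using k0(2)[OF 1] by (simp add: p_def N_def mult.commute)
        from smooth_germ_rescaled(1)[OF g N this]
        show ?thesis by (rule smooth_germ_cong) (use coef\<nu>[of k] 1 in \<open>auto simp: S_def\<close>)
      next
        case 2
        \<comment> \<open>A flat coefficient is divisible by any power of \<open>s\<close>; the
          power demanded by the scaling is taken.\<close>
        then obtain g where g: "smooth_germ g" "\<forall>\<^sub>F s in at_right 0. b k s = of_real s ^ (p * (n - k)) * g s"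
          using smooth_germ_order_cases[OF sb[of k], of "p * (n - k)"] by (auto simp: S_def)
        have "p * (n - k) \<le> N * (p * (n - k))" using N by simp
        from smooth_germ_rescaled(1)[OF g N this]
        show ?thesis by (rule smooth_germ_cong) (use coef\<nu>[of k] 2 in auto)
      next
        case 3
        then show ?thesis by (simp add: n_def smooth_germ_const)
      next
        case 4
        then have "coeff (root_poly J (\<lambda>j. \<nu> j s)) k = 0" for s by (intro coeff_eq_0) (simp add: n_def)
        then show ?thesis by (simp add: smooth_germ_const)
      qed
    qed
    have "\<exists>c. ((\<lambda>s. coeff (root_poly J (\<lambda>j. \<nu> j s)) k) \<longlongrightarrow> c) (at_right 0)" for k
      using smooth_germ_expand[OF smooth\<nu>] by blast
    then obtain c where c: "\<And>k. ((\<lambda>s. coeff (root_poly J (\<lambda>j. \<nu> j s)) k) \<longlongrightarrow> c k) (at_right 0)" by metis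
    have cont\<nu>: "cont_germ (\<nu> j)" if "j \<in> J" for j
      unfolding \<nu>_def using cont_germ_rescale[OF cont[OF that] N] .
    obtain w where w: "\<And>j. j \<in> J \<Longrightarrow> (\<nu> j \<longlongrightarrow> w j) (at_right 0)" "\<And>k. coeff (root_poly J w) k = c k"
      using roots_converge[OF fin cont\<nu> c] by blast
    have ck0: "c k0 \<noteq> 0"
    proof -
      obtain g d where g: "smooth_germ g" "(g \<longlongrightarrow> d) (at_right 0)" "d \<noteq> 0"
        "\<forall>\<^sub>F s in at_right 0. b k0 s = of_real s ^ m k0 * g s"
        using m[OF k0(1)] unfolding has_order_def by blast
      \<comment> \<open>At the minimising index the order and the scaling exponent cancel exactly,
        so the nonzero limit \<open>d\<close> survives.\<close>
      have e: "p * (n - k0) \<le> N * m k0" "N * m k0 - p * (n - k0) = 0" by (simp_all add: p_def N_def mult.commute)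
      have "\<forall>\<^sub>F s in at_right 0. g (s ^ N) = coeff (root_poly J (\<lambda>j. \<nu> j s)) k0"
        using smooth_germ_rescaled(2)[OF g(1,4) N e(1)] coef\<nu>[OF less_imp_le[OF k0n]]
        unfolding e(2) by eventually_elim simp
      moreover have "((\<lambda>s. g (s ^ N)) \<longlongrightarrow> d) (at_right 0)"
        using filterlim_compose[OF g(2) filterlim_power_at_right_0[OF N]] .
      ultimately have "((\<lambda>s. coeff (root_poly J (\<lambda>j. \<nu> j s)) k0) \<longlongrightarrow> d) (at_right 0)"
        by (rule Lim_transform_eventually[rotated])
      from tendsto_unique[OF _ this c[of k0]] g(3) show ?thesis by simp
    qed
    have sumw: "(\<Sum>j\<in>J. w j) = 0"
    proof -
      have "((\<lambda>s. \<Sum>j\<in>J. \<nu> j s) \<longlongrightarrow> (\<Sum>j\<in>J. w j)) (at_right 0)" by (intro tendsto_sum w)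
      moreover have "(\<Sum>j\<in>J. \<nu> j s) = 0" for s
        using sum0[of "s ^ N"] by (simp add: \<nu>_def sum_divide_distrib[symmetric])
      ultimately have "((\<lambda>s::real. 0) \<longlongrightarrow> (\<Sum>j\<in>J. w j)) (at_right 0)" by simp
      then show ?thesis by (simp add: tendsto_const_iff)
    qed
    define J1 where "J1 = {j \<in> J. w j = w i}"
    have "J1 \<noteq> J"
    proof
      assume "J1 = J"
      then have all: "w j = w i" if "j \<in> J" for j using that by (auto simp: J1_def)
      then have "(\<Sum>j\<in>J. w j) = (\<Sum>j\<in>J. w i)" by (rule sum.cong[OF refl])
      then have "w i = 0" using sumw i fin by (auto simp: card_eq_0_iff)
      then have "root_poly J w = monom 1 n"
        using all by (simp add: root_poly_def monom_altdef n_def)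
      then have "c k0 = 0" using w(2)[of k0] k0n by simp
      with ck0 show False by simp
    qed
    then have J1: "J1 \<subset> J" "i \<in> J1" using i by (auto simp: J1_def)
    have J1J: "J1 \<union> (J - J1) = J" using J1 by auto
    have "smooth_germ (\<lambda>s. coeff (root_poly J1 (\<lambda>j. \<nu> j s)) k)" for k
    proof (rule smooth_germ_root_poly_split[of J1 "J - J1" \<nu> w])
      show "finite J1" "finite (J - J1)" using fin J1(1) finite_subset by auto
      show "w i \<noteq> w j" if "i \<in> J1" "j \<in> J - J1" for i j using that by (auto simp: J1_def)
    qed (use J1J w smooth\<nu> in auto)
    moreover have "separated_germs (\<nu> j) (\<nu> k)" if "j \<in> J1" "k \<in> J1" for j k
      unfolding \<nu>_def using separated_germs_rescale[OF sep N] that J1(1) by blast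
    ultimately have "\<exists>N'\<ge>1. lip_germ (\<lambda>s. \<nu> i (s ^ N'))"
      using J1 cont\<nu> by (intro IH[of J1 \<nu>]) auto
    then obtain N' where N': "N' \<ge> 1" "lip_germ (\<lambda>s. \<nu> i (s ^ N'))" by blast
    \<comment> \<open>Undo the scaling at the point \<open>s ^ N'\<close>; the two substitutions
      compose to the exponent \<open>N' * N\<close>.\<close>
    have "lip_germ (\<lambda>s. (of_real s ^ N') ^ p * \<nu> i (s ^ N'))"
      by (intro lip_germ_mult N' smooth_germ_lip smooth_germ_power smooth_germ_ident)
    moreover have "\<forall>\<^sub>F s in at_right 0. (of_real s ^ N') ^ p * \<nu> i (s ^ N') = \<mu> i (s ^ (N' * N))"
      using eventually_at_right_less[of 0]
      by eventually_elim (simp add: \<nu>_def power_mult)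
    ultimately have "lip_germ (\<lambda>s. \<mu> i (s ^ (N' * N)))" by (rule lip_germ_cong)
    then show ?thesis using N N'(1) by (intro exI[of _ "N' * N"]) auto
  qed
qed

text \<open>The mean of the roots is a constant multiple of a coefficient, hence smooth. Centring
  therefore preserves all hypotheses, and shifting back only adds a Lipschitz germ.\<close>

lemma puiseux_lip:
  fixes \<phi> :: "'j \<Rightarrow> real \<Rightarrow> complex"
  assumes "finite J"
    and "\<And>j. j \<in> J \<Longrightarrow> cont_germ (\<phi> j)"
    and "\<And>k. smooth_germ (\<lambda>s. coeff (root_poly J (\<lambda>j. \<phi> j s)) k)"
    and "\<And>i j. i \<in> J \<Longrightarrow> j \<in> J \<Longrightarrow> separated_germs (\<phi> i) (\<phi> j)"
    and "i \<in> J"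
  shows "\<exists>N\<ge>1. lip_germ (\<lambda>s. \<phi> i (s ^ N))"
  using assms
proof (induction J arbitrary: \<phi> rule: finite_psubset_induct)
  case (psubset J)
  note fin = psubset.hyps(1)
  have n: "card J > 0" using psubset.prems(4) fin by (auto simp: card_gt_0_iff)
  define m where "m s = (- 1 / of_nat (card J)) * coeff (root_poly J (\<lambda>j. \<phi> j s)) (card J - 1)" for s
  have m: "smooth_germ m" unfolding m_def by (intro smooth_germ_cmult psubset.prems)
  have m_eq: "m s = (\<Sum>j\<in>J. \<phi> j s) / of_nat (card J)" for s
    using fin psubset.prems(4) by (subst m_def, subst coeff_root_poly_sum) auto
  define \<mu> where "\<mu> j s = \<phi> j s - m s" for j s
  have "\<exists>N\<ge>1. lip_germ (\<lambda>s. \<mu> i (s ^ N))"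
  proof (rule puiseux_lip_step[OF fin _ _ _ _ psubset.prems(4)])
    show "(\<Sum>j\<in>J. \<mu> j s) = 0" for s using n by (simp add: \<mu>_def sum_subtractf m_eq)
    show "cont_germ (\<mu> j)" if "j \<in> J" for j
      unfolding \<mu>_def using cont_germ_diff[OF psubset.prems(1)[OF that] lip_imp_cont_germ[OF smooth_germ_lip[OF m]]] .
    show "smooth_germ (\<lambda>s. coeff (root_poly J (\<lambda>j. \<mu> j s)) k)" for k
      unfolding \<mu>_def by (rule smooth_germ_coeff_shift[OF fin m psubset.prems(2)])
    show "separated_germs (\<mu> a) (\<mu> b)" if "a \<in> J" "b \<in> J" for a b
      using psubset.prems(3)[OF that] by (simp add: separated_germs_def \<mu>_def)
  qed (rule psubset.IH)
  then obtain N where N: "N \<ge> 1" "lip_germ (\<lambda>s. \<mu> i (s ^ N))" by blast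
  have "lip_germ (\<lambda>s. \<mu> i (s ^ N) + m (s ^ N))"
    by (intro lip_germ_add N smooth_germ_lip smooth_germ_power_subst m)
  with N(1) show ?case by (auto simp: \<mu>_def)
qed

section \<open>Newton identities and generalised discriminants\<close>

text \<open>Common interface for germs of power series and germs of quasianalytic functions.\<close>

definition function_algebra :: "(real \<Rightarrow> complex) set \<Rightarrow> bool" where
  "function_algebra A \<longleftrightarrow> (\<forall>c. (\<lambda>_. c) \<in> A) \<and>
     (\<forall>f\<in>A. \<forall>g\<in>A. (\<lambda>s. f s + g s) \<in> A \<and> (\<lambda>s. f s * g s) \<in> A)"

lemma function_algebra_const: "function_algebra A \<Longrightarrow> (\<lambda>_. c) \<in> A"
  and function_algebra_add: "function_algebra A \<Longrightarrow> f \<in> A \<Longrightarrow> g \<in> A \<Longrightarrow> (\<lambda>s. f s + g s) \<in> A"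
  and function_algebra_mult: "function_algebra A \<Longrightarrow> f \<in> A \<Longrightarrow> g \<in> A \<Longrightarrow> (\<lambda>s. f s * g s) \<in> A"
  unfolding function_algebra_def by blast+

lemma function_algebra_sum:
  assumes "function_algebra A" "\<And>i. i \<in> S \<Longrightarrow> h i \<in> A"
  shows "(\<lambda>s. \<Sum>i\<in>S. h i s) \<in> A"
  using assms(2)
  by (induction S rule: infinite_finite_induct)
    (simp_all add: function_algebra_const[OF assms(1)] function_algebra_add[OF assms(1)])

lemma function_algebra_prod:
  assumes "function_algebra A" "\<And>i. i \<in> S \<Longrightarrow> h i \<in> A"
  shows "(\<lambda>s. \<Prod>i\<in>S. h i s) \<in> A"
  using assms(2)
  by (induction S rule: infinite_finite_induct)
    (simp_all add: function_algebra_const[OF assms(1)] function_algebra_mult[OF assms(1)])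

text \<open>Horner's scheme, run downward from the top: \<open>coeff q i\<close> is coefficient
  \<open>Suc i\<close> of the product plus \<open>w * coeff q (Suc i)\<close>.\<close>

lemma coeff_linear_quotient:
  fixes q :: "complex poly"
  assumes "degree q < n"
  shows "coeff q i = (\<Sum>l\<in>{i<..n}. coeff ([:- w, 1:] * q) l * w ^ (l - Suc i))"
proof (cases "i < n")
  case True
  then show ?thesis
  proof (induction i rule: strict_inc_induct)
    case (base i)
    then have "{i<..n} = {n}" "coeff q n = 0" using assms by (auto intro: coeff_eq_0)
    with base show ?case by (simp add: coeff_pCons)
  next
    case (step i)
    have "{i<..n} = insert (Suc i) {Suc i<..n}" using step.hyps by auto
    then have "(\<Sum>l\<in>{i<..n}. coeff ([:- w, 1:] * q) l * w ^ (l - Suc i))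
      = coeff ([:- w, 1:] * q) (Suc i) + (\<Sum>l\<in>{Suc i<..n}. coeff ([:- w, 1:] * q) l * w ^ (l - Suc i))"
      by (simp del: mult_pCons_left)
    also have "(\<Sum>l\<in>{Suc i<..n}. coeff ([:- w, 1:] * q) l * w ^ (l - Suc i))
      = w * (\<Sum>l\<in>{Suc i<..n}. coeff ([:- w, 1:] * q) l * w ^ (l - Suc (Suc i)))"
      unfolding sum_distrib_left
      by (rule sum.cong) (auto simp: Suc_diff_Suc[symmetric] mult_ac simp del: mult_pCons_left)
    also have "\<dots> = w * coeff q (Suc i)" using step.IH by simp
    finally show ?case by (simp add: coeff_pCons)
  qed
next
  case False
  then have "{i<..n} = {}" "coeff q i = 0" using assms by (auto intro!: coeff_eq_0)
  then show ?thesis by simp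
qed

text \<open>Coefficient \<open>i\<close> of the derivative of the product, which is the sum of the
  products with one factor omitted; each of these is expanded by Horner's scheme. The summand
  \<open>l = Suc i\<close> contains the zeroth power sum.\<close>

lemma newton_identity:
  assumes "finite J" "i < card J"
  shows "of_nat (Suc i) * coeff (root_poly J w) (Suc i) =
    (\<Sum>l\<in>{i<..card J}. coeff (root_poly J w) l * (\<Sum>j\<in>J. w j ^ (l - Suc i)))"
proof -
  have q: "coeff (root_poly (J - {j}) w) i = (\<Sum>l\<in>{i<..card J}. coeff (root_poly J w) l * w j ^ (l - Suc i))"
    if j: "j \<in> J" for j
  proof -
    have "root_poly J w = [:- w j, 1:] * root_poly (J - {j}) w"
      using root_poly_insert[of "J - {j}" j w] j assms(1) by (simp add: insert_absorb del: mult_pCons_left)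
    moreover have "degree (root_poly (J - {j}) w) < card J"
      using j assms by (simp add: card_gt_0_iff)
    ultimately show ?thesis using coeff_linear_quotient[of "root_poly (J - {j}) w" "card J" i "w j"] by simp
  qed
  have "pderiv (root_poly J w) = (\<Sum>j\<in>J. root_poly (J - {j}) w)"
    unfolding root_poly_def by (simp add: pderiv_prod pderiv_pCons)
  then have "coeff (pderiv (root_poly J w)) i = (\<Sum>j\<in>J. coeff (root_poly (J - {j}) w) i)"
    by (simp add: coeff_sum)
  also have "\<dots> = (\<Sum>j\<in>J. \<Sum>l\<in>{i<..card J}. coeff (root_poly J w) l * w j ^ (l - Suc i))"
    using q by (rule sum.cong[OF refl])
  also have "\<dots> = (\<Sum>l\<in>{i<..card J}. coeff (root_poly J w) l * (\<Sum>j\<in>J. w j ^ (l - Suc i)))"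
    by (subst sum.swap) (simp add: sum_distrib_left)
  finally show ?thesis by (simp add: coeff_pderiv)
qed

text \<open>Below the degree Newton's identity expresses each power sum through smaller ones. From
  the degree on, the equation satisfied by each root, multiplied by a power of that root and summed,
  gives a linear recursion.\<close>

lemma power_sums_in_algebra:
  assumes A: "function_algebra A" and fin: "finite J"
    and coef: "\<And>k. (\<lambda>s. coeff (root_poly J (\<lambda>j. \<phi> j s)) k) \<in> A"
  shows "(\<lambda>s. \<Sum>j\<in>J. \<phi> j s ^ k) \<in> A"
proof (induction k rule: less_induct)
  case (less k)
  let ?n = "card J" and ?c = "\<lambda>k s. coeff (root_poly J (\<lambda>j. \<phi> j s)) k"
  let ?p = "\<lambda>k s. \<Sum>j\<in>J. \<phi> j s ^ k"
  consider "k = 0" | "0 < k" "k < ?n" | "k \<ge> ?n" "k > 0" by linarith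
  then show ?case
  proof cases
    case 1
    then show ?thesis using function_algebra_const[OF A] by simp
  next
    case 2
    \<comment> \<open>With this index the summand \<open>l = card J\<close>, whose coefficient is 1,
      is the power sum of exponent \<open>k\<close>; all others have smaller exponents.\<close>
    define i where "i = ?n - Suc k"
    have i: "i < ?n" "?n - Suc i = k" using 2 by (auto simp: i_def)
    have "{i<..?n} = insert ?n {i<..<?n}" using i by auto
    then have "of_nat (Suc i) * ?c (Suc i) s = ?p k s + (\<Sum>l\<in>{i<..<?n}. ?c l s * ?p (l - Suc i) s)" for s
      using newton_identity[OF fin i(1), of "\<lambda>j. \<phi> j s"] i(2) by simp
    then have "?p k s = of_nat (Suc i) * ?c (Suc i) s + (- 1) * (\<Sum>l\<in>{i<..<?n}. ?c l s * ?p (l - Suc i) s)" for s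
      by simp
    moreover have "(\<lambda>s. \<Sum>l\<in>{i<..<?n}. ?c l s * ?p (l - Suc i) s) \<in> A"
      using i by (intro function_algebra_sum[OF A] function_algebra_mult[OF A] coef less) auto
    ultimately show ?thesis
      by (simp only:) (intro function_algebra_add[OF A] function_algebra_mult[OF A] function_algebra_const[OF A] coef)
  next
    case 3
    have "?p k s = (- 1) * (\<Sum>l<?n. ?c l s * ?p (k - ?n + l) s)" for s
    proof -
      have "(\<Sum>j\<in>J. \<phi> j s ^ (k - ?n) * poly (root_poly J (\<lambda>j. \<phi> j s)) (\<phi> j s)) = 0"
        using fin by (intro sum.neutral) (auto simp: poly_root_poly)
      also have "(\<Sum>j\<in>J. \<phi> j s ^ (k - ?n) * poly (root_poly J (\<lambda>j. \<phi> j s)) (\<phi> j s))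
          = (\<Sum>l\<le>?n. ?c l s * ?p (k - ?n + l) s)"
        unfolding poly_altdef degree_root_poly sum_distrib_left
        by (subst sum.swap) (simp add: power_add mult_ac)
      also have "\<dots> = (\<Sum>l<?n. ?c l s * ?p (k - ?n + l) s) + ?p k s"
        using 3 by (simp add: lessThan_Suc_atMost[symmetric])
      finally show ?thesis by (simp add: eq_neg_iff_add_eq_0 add.commute)
    qed
    moreover have "(\<lambda>s. \<Sum>l<?n. ?c l s * ?p (k - ?n + l) s) \<in> A"
      using 3 by (intro function_algebra_sum[OF A] function_algebra_mult[OF A] coef less) auto
    ultimately show ?thesis
      by (simp only:) (intro function_algebra_mult[OF A] function_algebra_const[OF A])
  qed
qed

section \<open>Symmetrisation of polynomials in the roots\<close>

text \<open>Polynomials in the roots selected by the index map \<open>f\<close>. Generation by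
  monomials and sums is the form to which summation over all \<open>f\<close> applies; closure under
  products is then a lemma.\<close>

inductive polynomial_form :: "nat \<Rightarrow> ('j \<Rightarrow> real \<Rightarrow> complex) \<Rightarrow> ((nat \<Rightarrow> 'j) \<Rightarrow> real \<Rightarrow> complex) \<Rightarrow> bool"
  for m \<phi> where
  monomial: "polynomial_form m \<phi> (\<lambda>f s. c * (\<Prod>a<m. \<phi> (f a) s ^ e a))"
| add: "polynomial_form m \<phi> h \<Longrightarrow> polynomial_form m \<phi> h' \<Longrightarrow> polynomial_form m \<phi> (\<lambda>f s. h f s + h' f s)"

lemma polynomial_form_mult:
  assumes "polynomial_form m \<phi> h" "polynomial_form m \<phi> h'"
  shows "polynomial_form m \<phi> (\<lambda>f s. h f s * h' f s)"
  using assms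
proof (induction rule: polynomial_form.induct)
  case (monomial c e)
  then show ?case
  proof (induction rule: polynomial_form.induct)
    case (monomial c' e')
    have "(\<lambda>f s. c * (\<Prod>a<m. \<phi> (f a) s ^ e a) * (c' * (\<Prod>a<m. \<phi> (f a) s ^ e' a)))
        = (\<lambda>f s. (c * c') * (\<Prod>a<m. \<phi> (f a) s ^ (e a + e' a)))"
      by (simp add: power_add prod.distrib mult_ac)
    with polynomial_form.monomial[of m \<phi> "c * c'" "\<lambda>a. e a + e' a"] show ?case by (simp only:)
  next
    case (add h h')
    from polynomial_form.add[OF add.IH] show ?case by (simp add: distrib_left)
  qed
next
  case (add h h'')
  from polynomial_form.add[OF add.IH(1)[OF add.prems] add.IH(2)[OF add.prems]]
  show ?case by (simp add: distrib_right)
qed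

lemma polynomial_form_diff:
  assumes "a < m" "b < m"
  shows "polynomial_form m \<phi> (\<lambda>f s. \<phi> (f a) s - \<phi> (f b) s)"
proof -
  have "(\<Prod>x<m. \<phi> (f x) s ^ (if x = a then 1 else 0)) = \<phi> (f a) s" if "a < m" for a f s
  proof -
    have "(\<Prod>x<m. \<phi> (f x) s ^ (if x = a then 1 else 0)) = (\<Prod>x<m. if x = a then \<phi> (f x) s else 1)"
      by (rule prod.cong) auto
    with that show ?thesis by simp
  qed
  with polynomial_form.add[OF polynomial_form.monomial[of m \<phi> 1 "\<lambda>x. if x = a then 1 else 0"]
      polynomial_form.monomial[of m \<phi> "-1" "\<lambda>x. if x = b then 1 else 0"]] assms
  show ?thesis by simp
qed

lemma polynomial_form_prod:
  assumes "\<And>x. x \<in> T \<Longrightarrow> polynomial_form m \<phi> (h x)"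
  shows "polynomial_form m \<phi> (\<lambda>f s. \<Prod>x\<in>T. h x f s)"
proof -
  have one: "polynomial_form m \<phi> (\<lambda>f s. 1)" using polynomial_form.monomial[of m \<phi> 1 "\<lambda>_. 0"] by simp
  show ?thesis using assms
    by (induction T rule: infinite_finite_induct) (simp_all add: one polynomial_form_mult)
qed

text \<open>Summed over all maps, a monomial becomes a product over its positions of power sums, by
  distributivity.\<close>

lemma sum_polynomial_form_in_algebra:
  assumes A: "function_algebra A" and fin: "finite J"
    and p: "\<And>k. (\<lambda>s. \<Sum>j\<in>J. \<phi> j s ^ k) \<in> A"
    and h: "polynomial_form m \<phi> h"
  shows "(\<lambda>s. \<Sum>f\<in>{..<m} \<rightarrow>\<^sub>E J. h f s) \<in> A"
  using h
proof (induction rule: polynomial_form.induct)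
  case (monomial c e)
  have "(\<Sum>f\<in>{..<m} \<rightarrow>\<^sub>E J. c * (\<Prod>a<m. \<phi> (f a) s ^ e a)) = c * (\<Prod>a<m. \<Sum>j\<in>J. \<phi> j s ^ e a)" for s
    using prod_sum_PiE[of "{..<m}" "\<lambda>_. J" "\<lambda>a j. \<phi> j s ^ e a"] fin
    by (simp add: sum_distrib_left)
  then show ?case
    by (simp only:) (intro function_algebra_mult[OF A] function_algebra_const[OF A] function_algebra_prod[OF A] p)
next
  case (add h h')
  from function_algebra_add[OF A add.IH] show ?case by (simp add: sum.distrib)
qed

section \<open>Generalised discriminants\<close>

text \<open>With ordered pairs the product of differences is, up to sign, the square of the
  Vandermonde product, and reindexing along an injection requires no order on the values.\<close>

definition off_diagonal :: "'b set \<Rightarrow> ('b \<times> 'b) set" where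
  "off_diagonal X = {p \<in> X \<times> X. fst p \<noteq> snd p}"

lemma finite_off_diagonal [simp]: "finite X \<Longrightarrow> finite (off_diagonal X)"
  unfolding off_diagonal_def by simp

lemma bij_betw_off_diagonal:
  assumes "inj_on g X"
  shows "bij_betw (map_prod g g) (off_diagonal X) (off_diagonal (g ` X))"
  unfolding bij_betw_def
proof (intro conjI subset_antisym subsetI)
  show "inj_on (map_prod g g) (off_diagonal X)"
    by (rule inj_on_subset[OF map_prod_inj_on[OF assms assms]]) (auto simp: off_diagonal_def)
next
  fix p assume "p \<in> map_prod g g ` off_diagonal X"
  then obtain a b where "p = (g a, g b)" "a \<in> X" "b \<in> X" "a \<noteq> b" by (auto simp: off_diagonal_def)
  then show "p \<in> off_diagonal (g ` X)" using inj_onD[OF assms, of a b] by (auto simp: off_diagonal_def)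
next
  fix p assume "p \<in> off_diagonal (g ` X)"
  then obtain a b where "p = (g a, g b)" "a \<in> X" "b \<in> X" "g a \<noteq> g b"
    by (auto simp: off_diagonal_def)
  then have "p = map_prod g g (a, b)" "(a, b) \<in> off_diagonal X" by (auto simp: off_diagonal_def)
  then show "p \<in> map_prod g g ` off_diagonal X" by (rule image_eqI)
qed

text \<open>Up to the factor \<open>m!\<close> and the sign these are the generalised discriminants: the top nonvanishing
  one has index the number of distinct roots. Summing over all maps instead of all subsets makes
  them polynomials in the power sums.\<close>

definition gen_discr :: "'j set \<Rightarrow> nat \<Rightarrow> ('j \<Rightarrow> complex) \<Rightarrow> complex" where
  "gen_discr J m w = (\<Sum>f\<in>{..<m} \<rightarrow>\<^sub>E J. \<Prod>p\<in>off_diagonal {..<m}. w (f (fst p)) - w (f (snd p)))"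

lemma gen_discr_in_algebra:
  assumes A: "function_algebra A" and fin: "finite J"
    and coef: "\<And>k. (\<lambda>s. coeff (root_poly J (\<lambda>j. \<phi> j s)) k) \<in> A"
  shows "(\<lambda>s. gen_discr J m (\<lambda>j. \<phi> j s)) \<in> A"
  unfolding gen_discr_def
  by (rule sum_polynomial_form_in_algebra[OF A fin power_sums_in_algebra[OF A fin coef]],
      rule polynomial_form_prod, rule polynomial_form_diff) (auto simp: off_diagonal_def)

text \<open>With \<open>m\<close> at least the number of distinct values, \<open>f\<close> either
  repeats a value, producing a zero factor, or runs bijectively through the set of values, where the
  product is independent of \<open>f\<close>.\<close>

lemma discr_map_cases:
  fixes w :: "'j \<Rightarrow> complex"
  assumes fin: "finite J" and f: "f \<in> {..<m} \<rightarrow>\<^sub>E J" and m: "card (w ` J) \<le> m"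
  shows "(\<Prod>p\<in>off_diagonal {..<m}. w (f (fst p)) - w (f (snd p))) =
    (if m = card (w ` J) \<and> inj_on (\<lambda>a. w (f a)) {..<m}
     then \<Prod>p\<in>off_diagonal (w ` J). fst p - snd p else 0)"
proof -
  define g where "g a = w (f a)" for a
  have sub: "g ` {..<m} \<subseteq> w ` J" using f by (auto simp: g_def)
  show ?thesis
  proof (cases "inj_on g {..<m}")
    case True
    have "m \<le> card (w ` J)" using card_inj_on_le[OF True sub] fin by simp
    then have meq: "m = card (w ` J)" using m by simp
    have "g ` {..<m} = w ` J"
      by (rule card_subset_eq) (use fin sub True meq in \<open>auto simp: card_image\<close>)
    with bij_betw_off_diagonal[OF True]
    have "bij_betw (map_prod g g) (off_diagonal {..<m}) (off_diagonal (w ` J))" by simp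
    from prod.reindex_bij_betw[OF this, of "\<lambda>p. fst p - snd p"] meq True
    show ?thesis by (simp add: g_def[abs_def])
  next
    case False
    then obtain a b where "a < m" "b < m" "a \<noteq> b" "g a = g b" unfolding inj_on_def by auto
    then have "(a, b) \<in> off_diagonal {..<m}" "w (f (fst (a, b))) - w (f (snd (a, b))) = 0"
      by (auto simp: off_diagonal_def g_def)
    then have "(\<Prod>p\<in>off_diagonal {..<m}. w (f (fst p)) - w (f (snd p))) = 0"
      by (intro prod_zero) (auto intro: bexI[of _ "(a, b)"])
    with False show ?thesis by (simp add: g_def[abs_def])
  qed
qed

lemma gen_discr_eq_0:
  assumes "finite J" "card (w ` J) < m"
  shows "gen_discr J m w = 0"
  unfolding gen_discr_def using discr_map_cases[OF assms(1) _ less_imp_le[OF assms(2)]] assms(2)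
  by (intro sum.neutral) auto

text \<open>All nonzero summands are the same product, so nothing cancels; \<open>N\<close> counts
  the maps that run injectively through the values.\<close>

lemma gen_discr_card:
  assumes fin: "finite J" and m: "m = card (w ` J)"
  obtains N where "0 < N" "N \<le> card J ^ m"
    "gen_discr J m w = of_nat N * (\<Prod>p\<in>off_diagonal (w ` J). fst p - snd p)"
proof -
  let ?F = "{..<m} \<rightarrow>\<^sub>E J"
  define I where "I = {f \<in> ?F. inj_on (\<lambda>a. w (f a)) {..<m}}"
  have finF: "finite ?F" using fin by (intro finite_PiE) auto
  have "gen_discr J m w = (\<Sum>f\<in>?F. if f \<in> I then \<Prod>p\<in>off_diagonal (w ` J). fst p - snd p else 0)"
    unfolding gen_discr_def by (rule sum.cong) (auto simp: discr_map_cases[OF fin] m I_def)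
  also have "\<dots> = of_nat (card I) * (\<Prod>p\<in>off_diagonal (w ` J). fst p - snd p)"
    using finF by (simp add: sum.If_cases) (simp add: I_def Int_def)
  finally have eq: "gen_discr J m w = of_nat (card I) * (\<Prod>p\<in>off_diagonal (w ` J). fst p - snd p)" .
  have "card I \<le> card ?F" by (rule card_mono[OF finF]) (auto simp: I_def)
  also have "card ?F = card J ^ m" by (simp add: card_PiE)
  finally have le: "card I \<le> card J ^ m" .
  \<comment> \<open>Choosing one root for each value yields such a map, so the count is
    positive.\<close>
  obtain h where h: "bij_betw h {..<m} (w ` J)"
    using ex_bij_betw_nat_finite[of "w ` J"] fin m by (auto simp: atLeast0LessThan)
  have "\<exists>j\<in>J. w j = h a" if "a \<in> {..<m}" for a
  proof -
    have "h a \<in> w ` J" using bij_betwE[OF h] that by blast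
    then show ?thesis by (elim imageE) auto
  qed
  then obtain f where f: "\<And>a. a < m \<Longrightarrow> f a \<in> J \<and> w (f a) = h a" by (metis lessThan_iff)
  have "restrict f {..<m} \<in> I"
    using f bij_betw_imp_inj_on[OF h] by (auto simp: I_def inj_on_def)
  moreover have "finite I" using finF by (simp add: I_def)
  ultimately have "0 < card I" unfolding card_gt_0_iff by blast
  with le eq show ?thesis using that by blast
qed

lemma gen_discr_neq_0: "finite J \<Longrightarrow> gen_discr J (card (w ` J)) w \<noteq> 0"
  by (rule gen_discr_card[of J "card (w ` J)" w]) (auto simp: off_diagonal_def)

text \<open>One factor \<open>w i - w j\<close> is kept and all others are bounded by
  \<open>2 * B\<close>. The condition \<open>B \<ge> 1\<close> allows enlarging the exponents to
  values independent of the number of distinct roots.\<close>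

lemma gen_discr_le:
  fixes B :: real
  assumes fin: "finite J" and B: "\<And>j. j \<in> J \<Longrightarrow> cmod (w j) \<le> B" "B \<ge> 1"
    and ij: "i \<in> J" "j \<in> J" "w i \<noteq> w j"
  shows "cmod (gen_discr J (card (w ` J)) w) \<le> (card J ^ card J * (2 * B) ^ (card J * card J)) * cmod (w i - w j)"
proof -
  let ?X = "w ` J" and ?n = "card J"
  let ?T = "off_diagonal ?X"
  obtain N where N: "N \<le> ?n ^ card ?X" "gen_discr J (card ?X) w = of_nat N * (\<Prod>p\<in>?T. fst p - snd p)"
    using gen_discr_card[OF fin refl, of w] by metis
  have n: "card ?X \<le> ?n" "1 \<le> ?n" using fin ij by (auto simp: card_image_le Suc_le_eq card_gt_0_iff)
  have T: "(w i, w j) \<in> ?T" "finite ?T" using ij fin by (auto simp: off_diagonal_def)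
  have cT: "card ?T \<le> ?n * ?n"
  proof -
    have "card ?T \<le> card (?X \<times> ?X)" by (rule card_mono) (use fin in \<open>auto simp: off_diagonal_def\<close>)
    also have "\<dots> \<le> ?n * ?n" using n by (simp add: card_cartesian_product mult_le_mono)
    finally show ?thesis .
  qed
  have "(\<Prod>p\<in>?T - {(w i, w j)}. cmod (fst p - snd p)) \<le> (\<Prod>p\<in>?T - {(w i, w j)}. 2 * B)"
  proof (rule prod_mono)
    fix p assume "p \<in> ?T - {(w i, w j)}"
    then obtain a b where p: "p = (w a, w b)" "a \<in> J" "b \<in> J" by (auto simp: off_diagonal_def)
    show "0 \<le> cmod (fst p - snd p) \<and> cmod (fst p - snd p) \<le> 2 * B"
      using norm_triangle_ineq4[of "w a" "w b"] B(1)[OF p(2)] B(1)[OF p(3)] p(1) by simp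
  qed
  also have "\<dots> = (2 * B) ^ card (?T - {(w i, w j)})" by simp
  also have "\<dots> \<le> (2 * B) ^ (?n * ?n)"
  proof (rule power_increasing)
    have "card (?T - {(w i, w j)}) \<le> card ?T" by (rule card_mono) (use T in auto)
    then show "card (?T - {(w i, w j)}) \<le> ?n * ?n" using cT by simp
  qed (use B in simp)
  finally have rest: "(\<Prod>p\<in>?T - {(w i, w j)}. cmod (fst p - snd p)) \<le> (2 * B) ^ (?n * ?n)" .
  have "cmod (\<Prod>p\<in>?T. fst p - snd p) = cmod (w i - w j) * (\<Prod>p\<in>?T - {(w i, w j)}. cmod (fst p - snd p))"
    using prod.remove[OF T(2,1), of "\<lambda>p. cmod (fst p - snd p)"] by (simp add: prod_norm[symmetric])
  also have "\<dots> \<le> cmod (w i - w j) * (2 * B) ^ (?n * ?n)" by (rule mult_left_mono[OF rest]) simp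
  finally have d: "cmod (\<Prod>p\<in>?T. fst p - snd p) \<le> cmod (w i - w j) * (2 * B) ^ (?n * ?n)" .
  have "?n ^ card ?X \<le> ?n ^ ?n" using n by (intro power_increasing) auto
  then have "real N \<le> real (?n ^ ?n)" using N(1) by linarith
  then have "cmod (gen_discr J (card ?X) w) \<le> real (?n ^ ?n) * (cmod (w i - w j) * (2 * B) ^ (?n * ?n))"
    unfolding N(2) norm_mult norm_of_nat using d by (intro mult_mono) auto
  then show ?thesis by (simp add: mult_ac)
qed

section \<open>Separation of the roots\<close>

text \<open>The continuous quotient \<open>cmod (f s) / s ^ M\<close> omits the values strictly
  between 0 and \<open>c\<close>, so on a connected interval only one alternative can occur.\<close>

lemma cont_germ_dichotomy:
  assumes "cont_germ f" "c > 0" "\<forall>\<^sub>F s in at_right 0. f s = 0 \<or> c * s ^ M \<le> cmod (f s)"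
  shows "(\<forall>\<^sub>F s in at_right 0. f s = 0) \<or> (\<forall>\<^sub>F s in at_right 0. c * s ^ M \<le> cmod (f s))"
proof -
  obtain r where r: "r > 0" "continuous_on {0<..<r} f" using assms(1) unfolding cont_germ_def by blast
  obtain r' where r': "r' > 0" "\<And>s. 0 < s \<Longrightarrow> s < r' \<Longrightarrow> f s = 0 \<or> c * s ^ M \<le> cmod (f s)"
    using assms(3) unfolding eventually_at_right_field by auto
  define \<rho> where "\<rho> = min r r'"
  have \<rho>: "\<rho> > 0" using r r' by (simp add: \<rho>_def)
  define u where "u s = cmod (f s) / s ^ M" for s
  have alt: "u s = 0 \<or> c \<le> u s" if "s \<in> {0<..<\<rho>}" for s
    using r'(2)[of s] that by (auto simp: u_def \<rho>_def le_divide_eq)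
  have "continuous_on {0<..<\<rho>} u" unfolding u_def
    by (intro continuous_intros continuous_on_subset[OF r(2)]) (auto simp: \<rho>_def)
  then have conn: "connected (u ` {0<..<\<rho>})" by (rule connected_continuous_image) simp
  have "\<not> (u s = 0 \<and> c \<le> u t)" if "s \<in> {0<..<\<rho>}" "t \<in> {0<..<\<rho>}" for s t
  proof
    assume st: "u s = 0 \<and> c \<le> u t"
    then have "c / 2 \<in> {u s..u t}" using assms(2) by auto
    also have "\<dots> \<subseteq> u ` {0<..<\<rho>}" by (rule connected_contains_Icc[OF conn]) (use that in auto)
    finally obtain x where "x \<in> {0<..<\<rho>}" "u x = c / 2" by auto
    with alt[of x] assms(2) show False by auto
  qed
  then consider "\<forall>s\<in>{0<..<\<rho>}. u s = 0" | "\<forall>s\<in>{0<..<\<rho>}. c \<le> u s" using alt by metis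
  then show ?thesis
  proof cases
    case 1
    have "\<forall>\<^sub>F s in at_right 0. f s = 0"
      using eventually_at_right_real[OF \<rho>] by eventually_elim (use 1 in \<open>auto simp: u_def\<close>)
    then show ?thesis ..
  next
    case 2
    have "\<forall>\<^sub>F s in at_right 0. c * s ^ M \<le> cmod (f s)"
      using eventually_at_right_real[OF \<rho>] by eventually_elim (use 2 in \<open>auto simp: u_def le_divide_eq\<close>)
    then show ?thesis ..
  qed
qed

text \<open>The top discriminant that is not eventually zero is bounded below by a power of
  \<open>s\<close>, and bounded above by a multiple of any nonzero root difference. This holds
  pointwise; continuity turns it into an alternative between germs.\<close>

lemma roots_separated:
  assumes A: "function_algebra A" and fin: "finite J"
    and coef: "\<And>k. (\<lambda>s. coeff (root_poly J (\<lambda>j. \<phi> j s)) k) \<in> A"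
    and dich: "\<And>f. f \<in> A \<Longrightarrow> (\<forall>\<^sub>F s in at_right 0. f s = 0) \<or>
        (\<exists>c>0. \<exists>M. \<forall>\<^sub>F s in at_right 0. c * s ^ M \<le> cmod (f s))"
    and bounded: "\<forall>\<^sub>F s in at_right 0. \<forall>j\<in>J. cmod (\<phi> j s) \<le> B"
    and cont: "\<And>j. j \<in> J \<Longrightarrow> cont_germ (\<phi> j)"
    and ij: "i \<in> J" "j \<in> J"
  shows "separated_germs (\<phi> i) (\<phi> j)"
proof -
  define V where "V m s = gen_discr J m (\<lambda>j. \<phi> j s)" for m s
  have VA: "V m \<in> A" for m unfolding V_def[abs_def] by (rule gen_discr_in_algebra[OF A fin coef])
  define S where "S = {m. m \<le> card J \<and> \<not> (\<forall>\<^sub>F s in at_right 0. V m s = 0)}"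
  \<comment> \<open>The empty product over the single empty map; it guarantees that a top index
    \<open>m0\<close> exists.\<close>
  have "V 0 s = 1" for s by (simp add: V_def gen_discr_def off_diagonal_def)
  then have S: "finite S" "0 \<in> S" by (auto simp: S_def trivial_limit_at_right_real)
  define m0 where "m0 = Max S"
  have m0: "m0 \<in> S" unfolding m0_def using S by (intro Max_in) auto
  then obtain c M where c: "c > 0" "\<forall>\<^sub>F s in at_right 0. c * s ^ M \<le> cmod (V m0 s)"
    using dich[OF VA[of m0]] by (auto simp: S_def)
  have "\<forall>\<^sub>F s in at_right 0. V m s = 0" if m: "m \<in> {m0<..card J}" for m
  proof -
    have "m \<notin> S" using Max_ge[OF S(1), of m] m by (auto simp: m0_def)
    then show ?thesis using m by (simp add: S_def)
  qed
  then have van: "\<forall>\<^sub>F s in at_right 0. \<forall>m\<in>{m0<..card J}. V m s = 0"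
    by (simp add: eventually_ball_finite_distrib)
  define B' where "B' = max 1 B"
  define K where "K = real (card J ^ card J) * (2 * B') ^ (card J * card J)"
  have K: "K > 0" using ij fin by (auto simp: K_def B'_def card_gt_0_iff)
  have "\<forall>\<^sub>F s in at_right 0. \<phi> i s - \<phi> j s = 0 \<or> c / K * s ^ M \<le> cmod (\<phi> i s - \<phi> j s)"
    using c(2) van bounded eventually_at_right_less[of 0]
  proof eventually_elim
    case (elim s)
    let ?w = "\<lambda>j. \<phi> j s"
    let ?d = "card (?w ` J)"
    \<comment> \<open>The number \<open>?d\<close> of distinct roots at \<open>s\<close> is pinned
      to \<open>m0\<close>: the discriminant of index \<open>?d\<close> is nonzero, while those
      above \<open>m0\<close> vanish, and that of index \<open>m0\<close> is nonzero, while those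
      above \<open>?d\<close> vanish.\<close>
    have "V ?d s \<noteq> 0" unfolding V_def by (rule gen_discr_neq_0[OF fin])
    moreover have "?d \<le> card J" using fin by (rule card_image_le)
    ultimately have "?d \<le> m0" using elim(2) by force
    moreover have "c * s ^ M > 0" using elim(4) c(1) by simp
    then have "V m0 s \<noteq> 0" using elim(1) by auto
    then have "m0 \<le> ?d" using gen_discr_eq_0[OF fin, of ?w m0] by (force simp: V_def)
    ultimately have d: "?d = m0" by simp
    show ?case
    proof (cases "\<phi> i s = \<phi> j s")
      case False
      have "c * s ^ M \<le> K * cmod (\<phi> i s - \<phi> j s)"
        using elim(1) gen_discr_le[OF fin, of ?w B' i j] elim(3) ij False d
        by (force simp: V_def K_def B'_def)
      then show ?thesis using K by (simp add: field_simps)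
    qed simp
  qed
  from cont_germ_dichotomy[OF cont_germ_diff[OF cont[OF ij(1)] cont[OF ij(2)]] _ this] c(1) K
  have "(\<forall>\<^sub>F s in at_right 0. \<phi> i s - \<phi> j s = 0) \<or> (\<forall>\<^sub>F s in at_right 0. c / K * s ^ M \<le> cmod (\<phi> i s - \<phi> j s))"
    by simp
  moreover have "c / K > 0" using c(1) K by simp
  ultimately show ?thesis unfolding separated_germs_def right_minus_eq by blast
qed

lemma algebra_roots_lip:
  fixes \<phi> :: "'j \<Rightarrow> real \<Rightarrow> complex"
  assumes A: "function_algebra A" and fin: "finite J"
    and coef: "\<And>k. (\<lambda>s. coeff (root_poly J (\<lambda>j. \<phi> j s)) k) \<in> A"
    and smooth: "\<And>f. f \<in> A \<Longrightarrow> smooth_germ f"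
    and dich: "\<And>f. f \<in> A \<Longrightarrow> (\<forall>\<^sub>F s in at_right 0. f s = 0) \<or>
        (\<exists>c>0. \<exists>M. \<forall>\<^sub>F s in at_right 0. c * s ^ M \<le> cmod (f s))"
    and cont: "\<And>j. j \<in> J \<Longrightarrow> cont_germ (\<phi> j)"
    and i: "i \<in> J"
  shows "\<exists>N\<ge>1. lip_germ (\<lambda>s. \<phi> i (s ^ N))"
proof -
  have "\<exists>B. \<forall>\<^sub>F s in at_right 0. cmod (coeff (root_poly J (\<lambda>j. \<phi> j s)) k) \<le> B" for k
    using lip_germ_bounded[OF smooth_germ_lip[OF smooth[OF coef]]] by metis
  from roots_bounded[OF fin this] obtain B where "\<forall>\<^sub>F s in at_right 0. \<forall>j\<in>J. cmod (\<phi> j s) \<le> B" .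
  from roots_separated[OF A fin coef dich this cont]
  have "separated_germs (\<phi> a) (\<phi> b)" if "a \<in> J" "b \<in> J" for a b
    using that by blast
  from puiseux_lip[OF fin cont smooth[OF coef] this i] show ?thesis .
qed

section \<open>Analytic and smooth germs\<close>

definition power_series_germ :: "(nat \<Rightarrow> complex) \<Rightarrow> (real \<Rightarrow> complex) \<Rightarrow> bool" where
  "power_series_germ c f \<longleftrightarrow> (\<forall>\<^sub>F s in at_right 0. (\<lambda>k. c k * of_real s ^ k) sums f s)"

lemma power_series_germ_summable:
  assumes "power_series_germ c f"
  obtains r where "r > 0" "summable (\<lambda>k. c k * (of_real r :: complex) ^ k)"
proof -
  have ev: "\<forall>\<^sub>F s in at_right 0. 0 < s \<and> (\<lambda>k. c k * of_real s ^ k) sums f s"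
    using assms eventually_at_right_less[of 0] unfolding power_series_germ_def by eventually_elim simp
  from eventually_happens[OF ev] show ?thesis using that sums_summable by (auto simp: trivial_limit_at_right_real)
qed

lemma power_series_germ_lip:
  assumes "power_series_germ c f"
  shows "lip_germ f"
proof -
  obtain r where r: "r > 0" "summable (\<lambda>k. c k * (of_real r :: complex) ^ k)"
    using power_series_germ_summable[OF assms] .
  have sm: "summable (\<lambda>k. c k * z ^ k)" if "norm z < r" for z :: complex
    using powser_inside[OF r(2), of z] that r(1) by simp
  \<comment> \<open>Shrinking radii: the differentiated series converges at \<open>r / 2\<close>, so
    its sum is continuous, and hence bounded, on the closed disc of radius
    \<open>r / 3\<close>.\<close>
  have smd: "summable (\<lambda>k. diffs c k * (of_real (r / 2)) ^ k)"
    by (rule termdiff_converges[of _ r]) (use r(1) sm in auto)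
  define F where "F z = (\<Sum>k. c k * z ^ k)" for z :: complex
  define F' where "F' z = (\<Sum>k. diffs c k * z ^ k)" for z :: complex
  have der: "(F has_field_derivative F' z) (at z)" if "norm z < r" for z
    unfolding F_def[abs_def] F'_def using termdiffs_strong[OF r(2), of z] that r(1) by simp
  have "continuous_on (cball 0 (r / 3)) F'"
  proof (rule continuous_at_imp_continuous_on, rule ballI)
    fix z :: complex assume "z \<in> cball 0 (r / 3)"
    then have "norm z < norm (complex_of_real (r / 2))" using r(1) by simp
    then show "isCont F' z" unfolding F'_def[abs_def] by (rule isCont_powser[OF smd])
  qed
  then have "bounded (F' ` cball 0 (r / 3))" by (intro compact_imp_bounded compact_continuous_image) auto
  then obtain B where "\<forall>x\<in>F' ` cball 0 (r / 3). norm x \<le> B" unfolding bounded_iff by blast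
  then have B: "norm (F' z) \<le> B" if "z \<in> cball 0 (r / 3)" for z using that by blast
  have ev: "\<forall>\<^sub>F s in at_right 0. (\<lambda>k. c k * of_real s ^ k) sums f s \<and> 0 < s \<and> s < r / 3"
    using assms eventually_at_right_real[of 0 "r / 3"] r(1) unfolding power_series_germ_def
    by (simp add: eventually_conj_iff)
  show ?thesis
  proof (rule lip_germI[OF ev])
    fix s t assume s: "(\<lambda>k. c k * of_real s ^ k) sums f s \<and> 0 < s \<and> s < r / 3"
      and t: "(\<lambda>k. c k * of_real t ^ k) sums f t \<and> 0 < t \<and> t < r / 3"
    have "norm (F (of_real s) - F (of_real t)) \<le> B * norm (of_real s - of_real t :: complex)"
    proof (rule field_differentiable_bound[of "cball 0 (r / 3)" F F' B])
      show "(F has_field_derivative F' z) (at z within cball 0 (r / 3))" if "z \<in> cball 0 (r / 3)" for z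
        by (rule has_field_derivative_at_within[OF der]) (use that r(1) in auto)
    qed (use s t B in auto)
    also have "norm (of_real s - of_real t :: complex) = \<bar>s - t\<bar>"
      by (metis norm_of_real of_real_diff)
    also have "F (of_real s) = f s" using s by (auto simp: F_def sums_iff)
    also have "F (of_real t) = f t" using t by (auto simp: F_def sums_iff)
    finally show "cmod (f s - f t) \<le> B * \<bar>s - t\<bar>" .
  qed
qed

lemma power_series_germ_tail:
  assumes "power_series_germ c f"
  shows "power_series_germ (\<lambda>k. c (Suc k)) (\<lambda>s. (f s - c 0) / of_real s)"
  using assms eventually_at_right_less[of 0] unfolding power_series_germ_def
proof eventually_elim
  case (elim s)
  then have "(\<lambda>k. c (Suc k) * of_real s ^ Suc k) sums (f s - c 0)" by (subst sums_Suc_iff) simp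
  from sums_divide[OF this, of "of_real s"] show ?case using elim(2) by (simp add: mult_ac)
qed

lemma power_series_germ_taylor:
  "power_series_germ c f \<Longrightarrow> taylor_germ k f"
proof (induction k arbitrary: c f)
  case 0 then show ?case by (simp add: power_series_germ_lip)
next
  case (Suc k)
  have "\<forall>\<^sub>F s in at_right 0. f s = c 0 + of_real s * ((f s - c 0) / of_real s)"
    using eventually_at_right_less[of 0] by eventually_elim simp
  with Suc.IH[OF power_series_germ_tail[OF Suc.prems]] show ?case by (rule taylor_germ_SucI)
qed

lemma power_series_germ_const_nonzero:
  assumes "power_series_germ c f" "c 0 \<noteq> 0"
  shows "\<exists>b>0. \<exists>M. \<forall>\<^sub>F s in at_right 0. b * s ^ M \<le> cmod (f s)"
proof -
  have "\<forall>\<^sub>F s in at_right 0. f s = c 0 + of_real s * ((f s - c 0) / of_real s)"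
    using eventually_at_right_less[of 0] by eventually_elim simp
  from taylor_germ_tendsto[OF power_series_germ_taylor[OF power_series_germ_tail[OF assms(1)]] this]
  have "((\<lambda>s. cmod (f s)) \<longlongrightarrow> cmod (c 0)) (at_right 0)" by (rule tendsto_norm)
  then have "\<forall>\<^sub>F s in at_right 0. cmod (c 0) / 2 < cmod (f s)" by (rule order_tendstoD) (use assms in simp)
  then have "\<forall>\<^sub>F s in at_right 0. cmod (c 0) / 2 * s ^ 0 \<le> cmod (f s)" by eventually_elim simp
  moreover have "cmod (c 0) / 2 > 0" using assms(2) by simp
  ultimately show ?thesis by blast
qed

text \<open>Induction on the index of some nonzero coefficient, dividing by \<open>s\<close> while
  the constant term vanishes; each division raises the exponent of the lower bound by one.\<close>

lemma power_series_germ_dichotomy: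
  assumes "power_series_germ c f"
  shows "(\<forall>\<^sub>F s in at_right 0. f s = 0) \<or> (\<exists>b>0. \<exists>M. \<forall>\<^sub>F s in at_right 0. b * s ^ M \<le> cmod (f s))"
proof (cases "\<forall>k. c k = 0")
  case True
  have "\<forall>\<^sub>F s in at_right 0. f s = 0"
    using assms unfolding power_series_germ_def
    by eventually_elim (use True sums_unique2[OF _ sums_zero] in auto)
  then show ?thesis ..
next
  case False
  have "\<exists>b>0. \<exists>M. \<forall>\<^sub>F s in at_right 0. b * s ^ M \<le> cmod (f s)" if "c m \<noteq> 0" for m
    using assms that
  proof (induction m arbitrary: c f)
    case 0
    then show ?case by (rule power_series_germ_const_nonzero)
  next
    case (Suc m)
    show ?case
    proof (cases "c 0 = 0")
      case True
      obtain b M where b: "b > 0" "\<forall>\<^sub>F s in at_right 0. b * s ^ M \<le> cmod ((f s - c 0) / of_real s)"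
        using Suc.IH[OF power_series_germ_tail[OF Suc.prems(1)] Suc.prems(2)] by blast
      have "\<forall>\<^sub>F s in at_right 0. b * s ^ Suc M \<le> cmod (f s)"
        using b(2) eventually_at_right_less[of 0]
        by eventually_elim (simp add: True norm_divide le_divide_eq mult_ac)
      with b(1) show ?thesis by blast
    next
      case False
      with Suc.prems(1) show ?thesis by (rule power_series_germ_const_nonzero)
    qed
  qed
  with False show ?thesis by blast
qed

lemma function_algebra_power_series: "function_algebra {f. \<exists>c. power_series_germ c f}"
  unfolding function_algebra_def
proof (intro conjI allI ballI)
  fix c :: complex
  have "(\<lambda>k. (if k = 0 then c else 0) * of_real s ^ k) sums c" for s :: real
    using sums_single[of 0 "\<lambda>k. c * of_real s ^ k"] by (simp add: if_distrib[of "\<lambda>x. x * _"] cong: if_cong)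
  then have "power_series_germ (\<lambda>k. if k = 0 then c else 0) (\<lambda>_. c)" by (simp add: power_series_germ_def)
  then show "(\<lambda>_. c) \<in> {f. \<exists>c. power_series_germ c f}" by blast
next
  fix f g assume "f \<in> {f. \<exists>c. power_series_germ c f}" "g \<in> {f. \<exists>c. power_series_germ c f}"
  then obtain c d where cd: "power_series_germ c f" "power_series_germ d g" by blast
  have "power_series_germ (\<lambda>k. c k + d k) (\<lambda>s. f s + g s)"
    using cd unfolding power_series_germ_def
    by eventually_elim (simp add: distrib_right sums_add)
  then show "(\<lambda>s. f s + g s) \<in> {f. \<exists>c. power_series_germ c f}" by blast
  obtain r where r: "r > 0" "summable (\<lambda>k. c k * (of_real r :: complex) ^ k)"
    using power_series_germ_summable[OF cd(1)] .
  obtain r' where r': "r' > 0" "summable (\<lambda>k. d k * (of_real r' :: complex) ^ k)"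
    using power_series_germ_summable[OF cd(2)] .
  have "power_series_germ (\<lambda>k. \<Sum>i\<le>k. c i * d (k - i)) (\<lambda>s. f s * g s)"
    using cd eventually_at_right_real[OF r(1)] eventually_at_right_real[OF r'(1)]
    unfolding power_series_germ_def
  proof eventually_elim
    case (elim s)
    have "summable (\<lambda>k. norm (c k * of_real s ^ k))" "summable (\<lambda>k. norm (d k * of_real s ^ k))"
      using powser_insidea[OF r(2), of "of_real s"] powser_insidea[OF r'(2), of "of_real s"] elim by auto
    from Cauchy_product_sums[OF this]
    have "(\<lambda>k. \<Sum>i\<le>k. c i * of_real s ^ i * (d (k - i) * of_real s ^ (k - i))) sums (f s * g s)"
      using elim by (simp add: sums_iff)
    also have "(\<lambda>k. \<Sum>i\<le>k. c i * of_real s ^ i * (d (k - i) * of_real s ^ (k - i)))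
        = (\<lambda>k. (\<Sum>i\<le>k. c i * d (k - i)) * of_real s ^ k)"
    proof
      fix k
      have "c i * of_real s ^ i * (d (k - i) * of_real s ^ (k - i)) = c i * d (k - i) * of_real s ^ k"
        if "i \<in> {..k}" for i
      proof -
        have "of_real s ^ k = (of_real s ^ i * of_real s ^ (k - i) :: complex)"
          using that by (simp add: power_add[symmetric])
        then show ?thesis by simp
      qed
      then show "(\<Sum>i\<le>k. c i * of_real s ^ i * (d (k - i) * of_real s ^ (k - i)))
          = (\<Sum>i\<le>k. c i * d (k - i)) * of_real s ^ k"
        by (simp only: sum_distrib_right) (rule sum.cong[OF refl])
    qed
    finally show ?case .
  qed
  then show "(\<lambda>s. f s * g s) \<in> {f. \<exists>c. power_series_germ c f}" by blast
qed

section \<open>Smooth functions on a closed interval\<close>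

text \<open>Carrying the derivatives as explicit data makes shifts and differences, such as a
  function minus its Taylor polynomial, objects of the same kind.\<close>

definition derivative_sequence :: "real \<Rightarrow> (nat \<Rightarrow> real \<Rightarrow> complex) \<Rightarrow> bool" where
  "derivative_sequence \<rho> F \<longleftrightarrow>
     (\<forall>k. \<forall>s\<in>{0..\<rho>}. (F k has_vector_derivative F (Suc k) s) (at s within {0..\<rho>}))"

lemma derivative_sequence_bounded:
  assumes "derivative_sequence \<rho> F"
  shows "\<exists>B. \<forall>s\<in>{0..\<rho>}. cmod (F k s) \<le> B"
proof -
  have "continuous_on {0..\<rho>} (F k)"
    using assms by (intro continuous_on_vector_derivative[of _ _ "F (Suc k)"]) (auto simp: derivative_sequence_def)
  then have "bounded (F k ` {0..\<rho>})" by (intro compact_imp_bounded compact_continuous_image) auto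
  then show ?thesis unfolding bounded_iff by auto
qed

lemma vector_derivative_bound:
  fixes f :: "real \<Rightarrow> complex"
  assumes "convex S" "\<And>x. x \<in> S \<Longrightarrow> (f has_vector_derivative f' x) (at x within S)"
    and "\<And>x. x \<in> S \<Longrightarrow> cmod (f' x) \<le> B" "x \<in> S" "y \<in> S"
  shows "cmod (f x - f y) \<le> B * \<bar>x - y\<bar>"
proof -
  have "norm (f x - f y) \<le> B * norm (x - y)"
  proof (rule differentiable_bound[OF assms(1)])
    show "(f has_derivative (\<lambda>h. h *\<^sub>R f' z)) (at z within S)" if "z \<in> S" for z
      using assms(2)[OF that] by (simp add: has_vector_derivative_def)
    show "onorm (\<lambda>h. h *\<^sub>R f' z) \<le> B" if "z \<in> S" for z
      using assms(3)[OF that] by (intro onorm_le) (simp add: mult.commute[of B] mult_left_mono)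
  qed (use assms in auto)
  then show ?thesis by simp
qed

text \<open>Induction through the shifted sequence: the bound on the derivative over
  \<open>{0..s}\<close> gains one power of \<open>s\<close> by the mean value inequality.\<close>

lemma derivative_sequence_order:
  assumes "derivative_sequence \<rho> F" "\<And>j. j < k \<Longrightarrow> F j 0 = 0"
  shows "\<exists>C\<ge>0. \<forall>s\<in>{0..\<rho>}. cmod (F 0 s) \<le> C * s ^ k"
  using assms
proof (induction k arbitrary: F)
  case 0
  obtain B where "\<forall>s\<in>{0..\<rho>}. cmod (F 0 s) \<le> B" using derivative_sequence_bounded[OF 0(1)] by blast
  then show ?case by (intro exI[of _ "max 0 B"]) auto
next
  case (Suc k)
  have "derivative_sequence \<rho> (\<lambda>k. F (Suc k))" using Suc.prems(1) by (simp add: derivative_sequence_def)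
  then obtain C where C: "C \<ge> 0" "\<And>s. s \<in> {0..\<rho>} \<Longrightarrow> cmod (F 1 s) \<le> C * s ^ k"
    using Suc.IH[of "\<lambda>k. F (Suc k)"] Suc.prems(2) by auto
  have "cmod (F 0 s) \<le> C * s ^ Suc k" if s: "s \<in> {0..\<rho>}" for s
  proof -
    have "cmod (F 0 s - F 0 0) \<le> (C * s ^ k) * \<bar>s - 0\<bar>"
    proof (rule vector_derivative_bound[of "{0..s}" _ "F 1"])
      fix x assume x: "x \<in> {0..s}"
      have "(F 0 has_vector_derivative F 1 x) (at x within {0..\<rho>})"
        using Suc.prems(1) x s by (auto simp: derivative_sequence_def)
      then show "(F 0 has_vector_derivative F 1 x) (at x within {0..s})"
        by (rule has_vector_derivative_within_subset) (use s in auto)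
      have "cmod (F 1 x) \<le> C * x ^ k" using C(2) x s by auto
      also have "\<dots> \<le> C * s ^ k" using C(1) x by (intro mult_left_mono power_mono) auto
      finally show "cmod (F 1 x) \<le> C * s ^ k" .
    qed (use s in auto)
    then show ?thesis using Suc.prems(2)[of 0] s by (simp add: mult_ac)
  qed
  with C(1) show ?case by blast
qed

lemma taylor_germ_power_mult_lip:
  assumes "lip_germ g"
  shows "taylor_germ k (\<lambda>s. of_real s ^ k * g s)"
proof (induction k)
  case 0 then show ?case using assms by simp
next
  case (Suc k)
  show ?case by (rule taylor_germ_SucI[OF Suc, of _ 0]) (simp add: mult.assoc)
qed

text \<open>Vanishing up to order \<open>k\<close> gives \<open>F 0\<close> of size
  \<open>s ^ Suc k\<close> and \<open>F 1\<close> of size \<open>s ^ k\<close>. By the quotient rule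
  \<open>F 0 s / s ^ k\<close> then has bounded derivative, so it is Lipschitz.\<close>

lemma derivative_sequence_flat_taylor:
  assumes \<rho>: "\<rho> > 0" and F: "derivative_sequence \<rho> F" and flat: "\<And>j. j \<le> k \<Longrightarrow> F j 0 = 0"
  shows "taylor_germ k (F 0)"
proof -
  obtain C0 where C0: "C0 \<ge> 0" "\<And>s. s \<in> {0..\<rho>} \<Longrightarrow> cmod (F 0 s) \<le> C0 * s ^ Suc k"
    using derivative_sequence_order[OF F, of "Suc k"] flat by auto
  have "derivative_sequence \<rho> (\<lambda>k. F (Suc k))" using F by (simp add: derivative_sequence_def)
  then obtain C1 where C1: "C1 \<ge> 0" "\<And>s. s \<in> {0..\<rho>} \<Longrightarrow> cmod (F 1 s) \<le> C1 * s ^ k"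
    using derivative_sequence_order[of \<rho> "\<lambda>k. F (Suc k)" k] flat by auto
  define g where "g s = (1 / s ^ k) *\<^sub>R F 0 s" for s
  define g' where "g' s = (1 / s ^ k) *\<^sub>R F 1 s + (- (real k * s ^ (k - 1)) / (s ^ k * s ^ k)) *\<^sub>R F 0 s" for s
  have der: "(g has_vector_derivative g' s) (at s within {0<..<\<rho>})" if s: "s \<in> {0<..<\<rho>}" for s
  proof -
    have "(F 0 has_vector_derivative F 1 s) (at s within {0..\<rho>})"
      using F s by (auto simp: derivative_sequence_def)
    then have 1: "(F 0 has_vector_derivative F 1 s) (at s within {0<..<\<rho>})"
      by (rule has_vector_derivative_within_subset) auto
    have "((\<lambda>s. 1 / s ^ k) has_field_derivative (- (real k * s ^ (k - 1)) / (s ^ k * s ^ k))) (at s within {0<..<\<rho>})"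
      using s by (auto intro!: derivative_eq_intros)
    from has_vector_derivative_scaleR[OF this 1] show ?thesis
      by (simp add: g_def[abs_def] g'_def)
  qed
  have bound: "cmod (g' s) \<le> C1 + real k * C0" if s: "s \<in> {0<..<\<rho>}" for s
  proof -
    have sp: "s > 0" "s \<in> {0..\<rho>}" using s by auto
    have "cmod ((1 / s ^ k) *\<^sub>R F 1 s) \<le> C1" using C1(2)[OF sp(2)] sp(1) by (simp add: divide_le_eq)
    moreover have "cmod ((- (real k * s ^ (k - 1)) / (s ^ k * s ^ k)) *\<^sub>R F 0 s) \<le> real k * C0"
    proof (cases k)
      case (Suc l)
      have "cmod ((- (real k * s ^ (k - 1)) / (s ^ k * s ^ k)) *\<^sub>R F 0 s)
          = (real k * s ^ (k - 1)) / (s ^ k * s ^ k) * cmod (F 0 s)"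
        using sp(1) by (simp add: abs_mult)
      also have "\<dots> \<le> (real k * s ^ (k - 1)) / (s ^ k * s ^ k) * (C0 * s ^ Suc k)"
        using C0(2)[OF sp(2)] sp(1) by (intro mult_left_mono) auto
      also have "\<dots> = real k * C0" using sp(1) Suc by simp
      finally show ?thesis .
    qed simp
    ultimately show ?thesis unfolding g'_def using norm_triangle_ineq order_trans add_mono by meson
  qed
  have "lip_germ g"
    by (rule lip_germI[OF eventually_at_right_real[OF \<rho>]])
      (rule vector_derivative_bound[OF _ der bound], auto)
  from taylor_germ_power_mult_lip[OF this, of k] show ?thesis
    by (rule taylor_germ_cong)
      (use eventually_at_right_less[of 0] in \<open>eventually_elim, simp add: g_def scaleR_conv_of_real\<close>)
qed

text \<open>Differentiation shifts the coefficient sequence by one. The top term that would be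
  missing after the shift is zero by the assumption on \<open>a\<close>, so the range
  \<open>i \<le> k\<close> can stay fixed.\<close>

lemma derivative_sequence_polynomial:
  assumes "\<And>i. i > k \<Longrightarrow> a i = 0"
  shows "derivative_sequence \<rho> (\<lambda>j s. \<Sum>i\<le>k. a (i + j) * of_real (s ^ i / fact i))"
  unfolding derivative_sequence_def
proof (intro allI ballI)
  fix j s
  have d: "((\<lambda>s. s ^ i / fact i) has_field_derivative (if i = 0 then 0 else s ^ (i - 1) / fact (i - 1)))
      (at s within {0..\<rho>})" for i
  proof -
    have "((\<lambda>s. s ^ i / fact i) has_field_derivative (of_nat i * s ^ (i - 1)) / fact i) (at s within {0..\<rho>})"
      by (intro DERIV_cdivide) (auto intro!: derivative_eq_intros)
    also have "(of_nat i * s ^ (i - 1)) / fact i = (if i = 0 then 0 else s ^ (i - 1) / fact (i - 1))"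
      by (cases i) (simp_all del: of_nat_Suc)
    finally show ?thesis .
  qed
  have "((\<lambda>s. \<Sum>i\<le>k. a (i + j) * of_real (s ^ i / fact i)) has_vector_derivative
     (\<Sum>i\<le>k. a (i + j) * of_real (if i = 0 then 0 else s ^ (i - 1) / fact (i - 1)))) (at s within {0..\<rho>})"
    by (intro has_vector_derivative_sum has_vector_derivative_mult_right has_vector_derivative_of_real d)
  also have "(\<Sum>i\<le>k. a (i + j) * of_real (if i = 0 then 0 else s ^ (i - 1) / fact (i - 1)))
      = (\<Sum>i<k. a (Suc i + j) * of_real (s ^ i / fact i))"
    by (cases k) (simp_all add: sum.atMost_Suc_shift lessThan_Suc_atMost del: sum.atMost_Suc)
  also have "\<dots> = (\<Sum>i\<le>k. a (i + Suc j) * of_real (s ^ i / fact i))"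
    using assms[of "Suc k + j"] by (simp add: lessThan_Suc_atMost[symmetric])
  finally show "((\<lambda>s. \<Sum>i\<le>k. a (i + j) * of_real (s ^ i / fact i)) has_vector_derivative
     (\<Sum>i\<le>k. a (i + Suc j) * of_real (s ^ i / fact i))) (at s within {0..\<rho>})" .
qed

lemma derivative_sequence_remainder:
  assumes "derivative_sequence \<rho> F"
  obtains H where "derivative_sequence \<rho> H" "\<And>j. j \<le> k \<Longrightarrow> H j 0 = 0"
    "\<And>s. F 0 s = (\<Sum>i\<le>k. F i 0 * of_real (s ^ i / fact i)) + H 0 s"
proof -
  define a where "a i = (if i \<le> k then F i 0 else 0)" for i
  define P where "P j s = (\<Sum>i\<le>k. a (i + j) * of_real (s ^ i / fact i))" for j s
  have "derivative_sequence \<rho> P"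
    unfolding P_def[abs_def] by (rule derivative_sequence_polynomial) (simp add: a_def)
  then have "derivative_sequence \<rho> (\<lambda>j s. F j s - P j s)"
    using assms by (auto simp: derivative_sequence_def intro!: has_vector_derivative_diff)
  moreover have "P j 0 = a j" for j
  proof -
    have "P j 0 = (\<Sum>i\<le>k. if i = 0 then a j else 0)" unfolding P_def by (rule sum.cong) auto
    then show ?thesis by simp
  qed
  moreover have "P 0 s = (\<Sum>i\<le>k. F i 0 * of_real (s ^ i / fact i))" for s by (simp add: P_def a_def)
  ultimately show ?thesis using that[of "\<lambda>j s. F j s - P j s"] by (simp add: a_def)
qed

lemma derivative_sequence_smooth:
  assumes "\<rho> > 0" "derivative_sequence \<rho> F"
  shows "smooth_germ (F 0)"
  unfolding smooth_germ_def
proof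
  fix k
  obtain H where H: "derivative_sequence \<rho> H" "\<And>j. j \<le> k \<Longrightarrow> H j 0 = 0"
    "\<And>s. F 0 s = (\<Sum>i\<le>k. F i 0 * of_real (s ^ i / fact i)) + H 0 s"
    using derivative_sequence_remainder[OF assms(2)] by blast
  have "taylor_germ k (\<lambda>s. \<Sum>i\<le>k. (F i 0 / fact i) * of_real s ^ i)"
    by (intro taylor_germ_sum taylor_germ_mult taylor_germ_const taylor_germ_power taylor_germ_ident)
  from taylor_germ_add[OF this derivative_sequence_flat_taylor[OF assms(1) H(1,2)]]
  have "taylor_germ k (\<lambda>s. (\<Sum>i\<le>k. (F i 0 / fact i) * of_real s ^ i) + H 0 s)" .
  moreover have "(\<Sum>i\<le>k. (F i 0 / fact i) * of_real s ^ i) + H 0 s = F 0 s" for s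
    by (subst H(3)) simp
  ultimately show "taylor_germ k (F 0)" by (simp only:)
qed

text \<open>The first nonzero Taylor term, of order \<open>m\<close>, dominates: the remainder has
  size \<open>s ^ Suc m\<close> and uses up at most half of it near 0.\<close>

lemma derivative_sequence_nonflat:
  assumes \<rho>: "\<rho> > 0" and F: "derivative_sequence \<rho> F" and "F k 0 \<noteq> 0"
  shows "\<exists>b>0. \<exists>M. \<forall>\<^sub>F s in at_right 0. b * s ^ M \<le> cmod (F 0 s)"
proof -
  define m where "m = (LEAST k. F k 0 \<noteq> 0)"
  have m: "F m 0 \<noteq> 0" unfolding m_def by (rule LeastI[of _ k]) (rule assms(3))
  have below: "F i 0 = 0" if "i < m" for i using not_less_Least that unfolding m_def by blast
  obtain H where H: "derivative_sequence \<rho> H" "\<And>j. j \<le> m \<Longrightarrow> H j 0 = 0"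
    "\<And>s. F 0 s = (\<Sum>i\<le>m. F i 0 * of_real (s ^ i / fact i)) + H 0 s"
    using derivative_sequence_remainder[OF F] by blast
  obtain C where C: "C \<ge> 0" "\<And>s. s \<in> {0..\<rho>} \<Longrightarrow> cmod (H 0 s) \<le> C * s ^ Suc m"
    using derivative_sequence_order[OF H(1), of "Suc m"] H(2) by auto
  define b where "b = cmod (F m 0) / fact m"
  have b: "b > 0" using m by (simp add: b_def)
  have eq: "F 0 s = F m 0 * of_real (s ^ m / fact m) + H 0 s" for s
    unfolding H(3) using below by (simp add: lessThan_Suc_atMost[symmetric])
  have "((\<lambda>s. C * s) \<longlongrightarrow> C * 0) (at_right 0)" by (intro tendsto_intros)
  then have "\<forall>\<^sub>F s in at_right 0. C * s < b / 2" using b by (intro order_tendstoD) auto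
  then have "\<forall>\<^sub>F s in at_right 0. b / 2 * s ^ m \<le> cmod (F 0 s)"
    using eventually_at_right_real[OF \<rho>]
  proof eventually_elim
    case (elim s)
    have "b * s ^ m = cmod (F m 0 * of_real (s ^ m / fact m))" using elim by (simp add: b_def norm_mult norm_divide norm_power)
    also have "\<dots> = cmod (F 0 s - H 0 s)" by (simp add: eq)
    also have "\<dots> \<le> cmod (F 0 s) + cmod (H 0 s)" by (rule norm_triangle_ineq4)
    also have "cmod (H 0 s) \<le> (C * s) * s ^ m" using C(2)[of s] elim by (simp add: mult_ac)
    also have "(C * s) * s ^ m \<le> b / 2 * s ^ m" using elim by (intro mult_right_mono) auto
    finally show ?case by simp
  qed
  with b show ?thesis by (intro exI[of _ "b / 2"]) auto
qed

section \<open>Absolute continuity\<close>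

text \<open>Chain rule along the ray from \<open>t0\<close>: derivatives within \<open>I\<close>
  restrict to the image segment, and each differentiation contributes a factor
  \<open>\<sigma>\<close>.\<close>

lemma quasianalytic_derivative_sequence:
  assumes smooth: "smooth_within f I" and sub: "\<And>s. s \<in> {0..\<rho>} \<Longrightarrow> t0 + \<sigma> * s \<in> I"
  shows "derivative_sequence \<rho> (\<lambda>k s. of_real \<sigma> ^ k * higher_deriv_within I k f (t0 + \<sigma> * s))"
  unfolding derivative_sequence_def
proof (intro allI ballI)
  fix k s assume s: "s \<in> {0..\<rho>}"
  let ?h = "\<lambda>s. t0 + \<sigma> * s"
  have "higher_deriv_within I k f differentiable (at (?h s) within I)"
    using smooth sub[OF s] by (auto simp: smooth_within_def differentiable_on_def)
  then have "(higher_deriv_within I k f has_vector_derivative higher_deriv_within I (Suc k) f (?h s)) (at (?h s) within I)"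
    by (simp add: vector_derivative_works[symmetric])
  then have d: "(higher_deriv_within I k f has_vector_derivative higher_deriv_within I (Suc k) f (?h s))
      (at (?h s) within ?h ` {0..\<rho>})"
    by (rule has_vector_derivative_within_subset) (use sub in auto)
  have "(?h has_vector_derivative \<sigma>) (at s within {0..\<rho>})"
    by (auto intro!: derivative_eq_intros simp flip: has_real_derivative_iff_has_vector_derivative)
  from has_vector_derivative_mult_right[OF vector_diff_chain_within[OF this d], of "of_real \<sigma> ^ k"]
  show "((\<lambda>s. of_real \<sigma> ^ k * higher_deriv_within I k f (?h s)) has_vector_derivative
      of_real \<sigma> ^ Suc k * higher_deriv_within I (Suc k) f (?h s)) (at s within {0..\<rho>})"
    by (simp add: o_def scaleR_conv_of_real mult_ac)
qed

text \<open>Infinite flatness at \<open>t0\<close> forces \<open>f\<close> to vanish on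
  \<open>I\<close>; otherwise some derivative at \<open>t0\<close> is nonzero, and remains so after
  multiplication by a power of \<open>\<sigma>\<close>.\<close>

lemma quasianalytic_germ:
  assumes Q: "quasianalytic_class I Q" "f \<in> Q" and t0: "t0 \<in> I" and \<rho>: "\<rho> > 0" and \<sigma>: "\<sigma> \<noteq> 0"
    and sub: "\<And>s. s \<in> {0..\<rho>} \<Longrightarrow> t0 + \<sigma> * s \<in> I"
  shows "smooth_germ (\<lambda>s. f (t0 + \<sigma> * s))"
    and "(\<forall>\<^sub>F s in at_right 0. f (t0 + \<sigma> * s) = 0) \<or>
        (\<exists>b>0. \<exists>M. \<forall>\<^sub>F s in at_right 0. b * s ^ M \<le> cmod (f (t0 + \<sigma> * s)))"
proof -
  define F where "F k s = of_real \<sigma> ^ k * higher_deriv_within I k f (t0 + \<sigma> * s)" for k s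
  have "smooth_within f I" using Q by (simp add: quasianalytic_class_def)
  then have F: "derivative_sequence \<rho> F"
    unfolding F_def[abs_def] by (rule quasianalytic_derivative_sequence[OF _ sub])
  have F0: "F 0 = (\<lambda>s. f (t0 + \<sigma> * s))" by (simp add: F_def[abs_def])
  show "smooth_germ (\<lambda>s. f (t0 + \<sigma> * s))" using derivative_sequence_smooth[OF \<rho> F] by (simp add: F0)
  show "(\<forall>\<^sub>F s in at_right 0. f (t0 + \<sigma> * s) = 0) \<or>
        (\<exists>b>0. \<exists>M. \<forall>\<^sub>F s in at_right 0. b * s ^ M \<le> cmod (f (t0 + \<sigma> * s)))"
  proof (cases "infinitely_flat_at f I t0")
    case True
    then have zero: "\<forall>t\<in>I. f t = 0" using Q t0 unfolding quasianalytic_class_def by blast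
    have "\<forall>\<^sub>F s in at_right 0. f (t0 + \<sigma> * s) = 0"
      using eventually_at_right_real[OF \<rho>] by eventually_elim (use zero sub in auto)
    then show ?thesis ..
  next
    case False
    then obtain k where "F k 0 \<noteq> 0" using \<sigma> by (auto simp: infinitely_flat_at_def F_def)
    from derivative_sequence_nonflat[OF \<rho> F this] show ?thesis by (simp add: F0)
  qed
qed

lemma analytic_germ:
  assumes "real_analytic_on f I" and t0: "t0 \<in> I" and \<rho>: "\<rho> > 0"
    and sub: "\<And>s. s \<in> {0..\<rho>} \<Longrightarrow> t0 + \<sigma> * s \<in> I" and \<sigma>: "\<bar>\<sigma>\<bar> = 1"
  shows "\<exists>c. power_series_germ c (\<lambda>s. f (t0 + \<sigma> * s))"
proof -
  obtain r c where r: "r > 0" "\<And>t. t \<in> I \<Longrightarrow> dist t t0 < r \<Longrightarrow> (\<lambda>k. c k * of_real (t - t0) ^ k) sums f t"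
    using assms(1) t0 unfolding real_analytic_on_def by blast
  have "power_series_germ (\<lambda>k. c k * of_real \<sigma> ^ k) (\<lambda>s. f (t0 + \<sigma> * s))"
    unfolding power_series_germ_def
    using eventually_at_right_real[OF \<rho>] eventually_at_right_real[OF r(1)]
  proof eventually_elim
    case (elim s)
    have "(\<lambda>k. c k * of_real (t0 + \<sigma> * s - t0) ^ k) sums f (t0 + \<sigma> * s)"
      by (rule r(2)) (use elim sub \<sigma> in \<open>auto simp: dist_real_def abs_mult\<close>)
    then show ?case by (simp add: power_mult_distrib mult.assoc)
  qed
  then show ?thesis by blast
qed

section \<open>The polynomial curve on one side of a point\<close>

lemma coeff_monic_poly_curve:
  "coeff (monic_poly_curve n a t) k =
    (if k < n then (- 1) ^ (n - k) * a (n - k) t else if k = n then 1 else 0)"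
proof -
  have "coeff (monic_poly_curve n a t) k = (if n = k then 1 else 0) +
      (\<Sum>j=1..n. if n - j = k then (- 1) ^ j * a j t else 0)"
    by (simp add: monic_poly_curve_def coeff_sum)
  also have "(\<Sum>j=1..n. if n - j = k then (- 1) ^ j * a j t else 0)
      = (\<Sum>j=1..n. if j = n - k then (if k < n then (- 1) ^ j * a j t else 0) else 0)"
    by (rule sum.cong) auto
  finally show ?thesis by auto
qed

lemma monic_poly_curve_eq_root_poly:
  assumes "continuous_root_parameterization I n (monic_poly_curve n a) \<Lambda>" "t \<in> I"
  shows "monic_poly_curve n a t = root_poly {1..n} (\<lambda>j. \<Lambda> j t)"
proof -
  have "poly (monic_poly_curve n a t) = poly (root_poly {1..n} (\<lambda>j. \<Lambda> j t))"
    using assms by (auto simp: continuous_root_parameterization_def poly_root_poly)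
  then show ?thesis by (simp add: poly_eq_poly_eq_iff)
qed

text \<open>The coefficients of the curve and of the root polynomial are known to agree only at
  parameters in \<open>I\<close>, that is, for small \<open>s\<close>; the hypothesis
  \<open>cong\<close> transfers membership in \<open>A\<close> across this eventual
  equality.\<close>

lemma one_sided_lip:
  assumes par: "continuous_root_parameterization I n (monic_poly_curve n a) \<Lambda>"
    and \<rho>: "\<rho> > 0" and sub: "\<And>s. s \<in> {0..\<rho>} \<Longrightarrow> t0 + \<sigma> * s \<in> I"
    and A: "function_algebra A" and cong: "\<And>f g. f \<in> A \<Longrightarrow> \<forall>\<^sub>F s in at_right 0. f s = g s \<Longrightarrow> g \<in> A"
    and aA: "\<And>j. j \<in> {1..n} \<Longrightarrow> (\<lambda>s. a j (t0 + \<sigma> * s)) \<in> A"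
    and smooth: "\<And>f. f \<in> A \<Longrightarrow> smooth_germ f"
    and dich: "\<And>f. f \<in> A \<Longrightarrow> (\<forall>\<^sub>F s in at_right 0. f s = 0) \<or>
        (\<exists>c>0. \<exists>M. \<forall>\<^sub>F s in at_right 0. c * s ^ M \<le> cmod (f s))"
    and i: "i \<in> {1..n}"
  shows "\<exists>N\<ge>1. lip_germ (\<lambda>s. \<Lambda> i (t0 + \<sigma> * s ^ N))"
proof (rule algebra_roots_lip[where \<phi> = "\<lambda>j s. \<Lambda> j (t0 + \<sigma> * s)" and J = "{1..n}", OF A _ _ smooth dich _ i])
  fix k
  have "(\<lambda>s. coeff (monic_poly_curve n a (t0 + \<sigma> * s)) k) \<in> A"
  proof (cases "k < n")
    case True
    then have "n - k \<in> {1..n}" by auto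
    with True function_algebra_mult[OF A function_algebra_const[OF A] aA, of "n - k" "(- 1) ^ (n - k)"]
    show ?thesis by (simp add: coeff_monic_poly_curve)
  next
    case False
    then show ?thesis using function_algebra_const[OF A] by (simp add: coeff_monic_poly_curve)
  qed
  moreover have "\<forall>\<^sub>F s in at_right 0. coeff (monic_poly_curve n a (t0 + \<sigma> * s)) k =
      coeff (root_poly {1..n} (\<lambda>j. \<Lambda> j (t0 + \<sigma> * s))) k"
    using eventually_at_right_real[OF \<rho>]
    by eventually_elim (simp add: monic_poly_curve_eq_root_poly[OF par sub])
  ultimately show "(\<lambda>s. coeff (root_poly {1..n} (\<lambda>j. \<Lambda> j (t0 + \<sigma> * s))) k) \<in> A" by (rule cong)
next
  fix j assume j: "j \<in> {1..n}"
  have "continuous_on I (\<Lambda> j)" using par j by (auto simp: continuous_root_parameterization_def)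
  then have "continuous_on {0<..<\<rho>} (\<lambda>s. \<Lambda> j (t0 + \<sigma> * s))"
    by (rule continuous_on_compose2) (use sub in \<open>auto intro!: continuous_intros\<close>)
  with \<rho> show "cont_germ (\<lambda>s. \<Lambda> j (t0 + \<sigma> * s))" unfolding cont_germ_def by blast
qed auto

lemma one_sided_lip_curve:
  assumes par: "continuous_root_parameterization I n (monic_poly_curve n a) \<Lambda>"
    and coef: "(\<forall>j\<in>{1..n}. real_analytic_on (a j) I) \<or>
         (\<exists>Q. quasianalytic_class I Q \<and> (\<forall>j\<in>{1..n}. a j \<in> Q))"
    and t0: "t0 \<in> I" and \<rho>: "\<rho> > 0" and sub: "\<And>s. s \<in> {0..\<rho>} \<Longrightarrow> t0 + \<sigma> * s \<in> I"
    and \<sigma>: "\<bar>\<sigma>\<bar> = 1" and i: "i \<in> {1..n}"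
  shows "\<exists>N\<ge>1. lip_germ (\<lambda>s. \<Lambda> i (t0 + \<sigma> * s ^ N))"
  using coef
proof (elim disjE exE conjE)
  assume an: "\<forall>j\<in>{1..n}. real_analytic_on (a j) I"
  show ?thesis
  proof (rule one_sided_lip[where A = "{f. \<exists>c. power_series_germ c f}", OF par \<rho> sub function_algebra_power_series _ _ _ _ i])
    fix f g assume f: "f \<in> {f. \<exists>c. power_series_germ c f}"
    show "smooth_germ f" using f power_series_germ_taylor by (auto simp: smooth_germ_def)
    show "(\<forall>\<^sub>F s in at_right 0. f s = 0) \<or> (\<exists>c>0. \<exists>M. \<forall>\<^sub>F s in at_right 0. c * s ^ M \<le> cmod (f s))"
      using f power_series_germ_dichotomy by blast
    assume fg: "\<forall>\<^sub>F s in at_right 0. f s = g s"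
    obtain c where "power_series_germ c f" using f by blast
    then have "power_series_germ c g"
      using fg unfolding power_series_germ_def by eventually_elim simp
    then show "g \<in> {f. \<exists>c. power_series_germ c f}" by blast
  next
    fix j assume "j \<in> {1..n}"
    then show "(\<lambda>s. a j (t0 + \<sigma> * s)) \<in> {f. \<exists>c. power_series_germ c f}"
      using analytic_germ[OF _ t0 \<rho> sub \<sigma>] an by blast
  qed
next
  fix Q assume Q: "quasianalytic_class I Q" and aQ: "\<forall>j\<in>{1..n}. a j \<in> Q"
  \<comment> \<open>All functions eventually equal to a member of the class along the ray, so that
    \<open>A\<close> is closed under eventual equality by construction.\<close>
  define A where "A = {g. \<exists>f\<in>Q. \<forall>\<^sub>F s in at_right 0. f (t0 + \<sigma> * s) = g s}"
  have \<sigma>0: "\<sigma> \<noteq> 0" using \<sigma> by auto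
  have algA: "function_algebra A"
    unfolding function_algebra_def
  proof (intro conjI allI ballI)
    show "(\<lambda>_. c) \<in> A" for c
      unfolding A_def using Q by (auto simp: quasianalytic_class_def intro!: bexI[of _ "\<lambda>_. c"])
  next
    fix g g' assume "g \<in> A" "g' \<in> A"
    then obtain f f' where f: "f \<in> Q" "\<forall>\<^sub>F s in at_right 0. f (t0 + \<sigma> * s) = g s"
      "f' \<in> Q" "\<forall>\<^sub>F s in at_right 0. f' (t0 + \<sigma> * s) = g' s" by (auto simp: A_def)
    have "(\<lambda>t. 1 * f t + 1 * f' t) \<in> Q" using Q f(1,3) unfolding quasianalytic_class_def by blast
    moreover have "\<forall>\<^sub>F s in at_right 0. 1 * f (t0 + \<sigma> * s) + 1 * f' (t0 + \<sigma> * s) = g s + g' s"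
      using f(2,4) by eventually_elim simp
    ultimately have "\<exists>h\<in>Q. \<forall>\<^sub>F s in at_right 0. h (t0 + \<sigma> * s) = g s + g' s"
      by (rule bexI[of _ "\<lambda>t. 1 * f t + 1 * f' t", rotated])
    then show "(\<lambda>s. g s + g' s) \<in> A" by (simp add: A_def)
    have "(\<lambda>t. f t * f' t) \<in> Q" using Q f(1,3) unfolding quasianalytic_class_def by blast
    moreover have "\<forall>\<^sub>F s in at_right 0. f (t0 + \<sigma> * s) * f' (t0 + \<sigma> * s) = g s * g' s"
      using f(2,4) by eventually_elim simp
    ultimately have "\<exists>h\<in>Q. \<forall>\<^sub>F s in at_right 0. h (t0 + \<sigma> * s) = g s * g' s"
      by (rule bexI[of _ "\<lambda>t. f t * f' t", rotated])
    then show "(\<lambda>s. g s * g' s) \<in> A" by (simp add: A_def)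
  qed
  show ?thesis
  proof (rule one_sided_lip[where A = A, OF par \<rho> sub algA _ _ _ _ i])
    fix g assume "g \<in> A"
    then obtain f where f: "f \<in> Q" "\<forall>\<^sub>F s in at_right 0. f (t0 + \<sigma> * s) = g s" by (auto simp: A_def)
    have "smooth_germ (\<lambda>s. f (t0 + \<sigma> * s))"
      by (rule quasianalytic_germ(1)[OF Q f(1) t0 \<rho> \<sigma>0 sub])
    then show "smooth_germ g" using f(2) by (rule smooth_germ_cong)
    have "(\<forall>\<^sub>F s in at_right 0. f (t0 + \<sigma> * s) = 0) \<or>
        (\<exists>b>0. \<exists>M. \<forall>\<^sub>F s in at_right 0. b * s ^ M \<le> cmod (f (t0 + \<sigma> * s)))"
      by (rule quasianalytic_germ(2)[OF Q f(1) t0 \<rho> \<sigma>0 sub])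
    then show "(\<forall>\<^sub>F s in at_right 0. g s = 0) \<or> (\<exists>c>0. \<exists>M. \<forall>\<^sub>F s in at_right 0. c * s ^ M \<le> cmod (g s))"
    proof (elim disjE exE conjE)
      assume "\<forall>\<^sub>F s in at_right 0. f (t0 + \<sigma> * s) = 0"
      with f(2) have "\<forall>\<^sub>F s in at_right 0. g s = 0" by eventually_elim simp
      then show ?thesis ..
    next
      fix b M assume b: "b > 0" "\<forall>\<^sub>F s in at_right 0. b * s ^ M \<le> cmod (f (t0 + \<sigma> * s))"
      from b(2) f(2) have "\<forall>\<^sub>F s in at_right 0. b * s ^ M \<le> cmod (g s)" by eventually_elim simp
      with b(1) show ?thesis by blast
    qed
    show "h \<in> A" if gh: "\<forall>\<^sub>F s in at_right 0. g s = h s" for h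
    proof -
      from f(2) gh have "\<forall>\<^sub>F s in at_right 0. f (t0 + \<sigma> * s) = h s" by eventually_elim simp
      with f(1) show ?thesis unfolding A_def by blast
    qed
  next
    show "(\<lambda>s. a j (t0 + \<sigma> * s)) \<in> A" if "j \<in> {1..n}" for j
      using aQ that by (auto simp: A_def intro!: bexI[of _ "a j"])
  qed
qed

text \<open>The Lipschitz bound in \<open>s\<close> is read off at \<open>s = root N x\<close>.
  Since germs ignore 0, continuity of the root at \<open>t0\<close> is used to extend the bound to
  that endpoint.\<close>

lemma one_sided_root_bound:
  assumes int: "is_interval I"
    and par: "continuous_root_parameterization I n (monic_poly_curve n a) \<Lambda>"
    and coef: "(\<forall>j\<in>{1..n}. real_analytic_on (a j) I) \<or>
         (\<exists>Q. quasianalytic_class I Q \<and> (\<forall>j\<in>{1..n}. a j \<in> Q))"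
    and t0: "t0 \<in> I" and \<sigma>: "\<bar>\<sigma>\<bar> = 1" and i: "i \<in> {1..n}"
  obtains N L r where "N \<ge> (1::nat)" "L \<ge> (0::real)" "r > 0"
    "\<And>x y. 0 \<le> x \<Longrightarrow> x < r \<Longrightarrow> 0 \<le> y \<Longrightarrow> y < r \<Longrightarrow> t0 + \<sigma> * x \<in> I \<Longrightarrow> t0 + \<sigma> * y \<in> I \<Longrightarrow>
       cmod (\<Lambda> i (t0 + \<sigma> * x) - \<Lambda> i (t0 + \<sigma> * y)) \<le> L * \<bar>root N x - root N y\<bar>"
proof (cases "\<exists>\<rho>>0. t0 + \<sigma> * \<rho> \<in> I")
  case False
  show ?thesis
  \<comment> \<open>Here \<open>I\<close> contains no point beyond \<open>t0\<close> in this
    direction, so \<open>x = y = 0\<close> and arbitrary constants will do.\<close>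
  proof (rule that[of 1 0 1])
    fix x y :: real assume "0 \<le> x" "0 \<le> y" "t0 + \<sigma> * x \<in> I" "t0 + \<sigma> * y \<in> I"
    then have "x = 0" "y = 0" using False by (metis order_le_less)+
    then show "cmod (\<Lambda> i (t0 + \<sigma> * x) - \<Lambda> i (t0 + \<sigma> * y)) \<le> 0 * \<bar>root 1 x - root 1 y\<bar>" by simp
  qed auto
next
  case True
  then obtain \<rho> where \<rho>: "\<rho> > 0" "t0 + \<sigma> * \<rho> \<in> I" by blast
  have sub: "t0 + \<sigma> * s \<in> I" if "s \<in> {0..\<rho>}" for s
  proof -
    consider "\<sigma> = 1" | "\<sigma> = - 1" using \<sigma> by linarith
    then show ?thesis
    proof cases
      case 1
      show ?thesis by (rule mem_is_interval_1_I[OF int t0 \<rho>(2)]) (use 1 that in auto)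
    next
      case 2
      show ?thesis by (rule mem_is_interval_1_I[OF int \<rho>(2) t0]) (use 2 that in auto)
    qed
  qed
  obtain N where N: "N \<ge> 1" "lip_germ (\<lambda>s. \<Lambda> i (t0 + \<sigma> * s ^ N))"
    using one_sided_lip_curve[OF par coef t0 \<rho>(1) sub \<sigma> i] by blast
  define h where "h s = \<Lambda> i (t0 + \<sigma> * s ^ N)" for s
  obtain r0 L where r0: "r0 > 0" "L-lipschitz_on {0<..<r0} h"
    using N(2) unfolding lip_germ_def h_def[abs_def] by blast
  have L0: "L \<ge> 0" using lipschitz_on_nonneg[OF r0(2)] .
  define r1 where "r1 = min r0 (min 1 \<rho>)"
  have r1: "r1 > 0" using r0 \<rho> by (simp add: r1_def)
  have pow: "s ^ N \<in> {0..\<rho>}" if "s \<in> {0..<r1}" for s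
  proof -
    have "s ^ N \<le> s ^ 1" using that N(1) by (intro power_decreasing) (auto simp: r1_def)
    then show ?thesis using that by (auto simp: r1_def)
  qed
  have "continuous_on I (\<Lambda> i)" using par i by (auto simp: continuous_root_parameterization_def)
  then have conth: "continuous_on {0..<r1} h" unfolding h_def
    by (rule continuous_on_compose2) (use sub pow in \<open>auto intro!: continuous_intros\<close>)
  have h0: "(h \<longlongrightarrow> h 0) (at_right 0)"
  proof -
    have "(h \<longlongrightarrow> h 0) (at 0 within {0..<r1})"
      using conth r1 by (simp add: continuous_on_def)
    also have "at 0 within {0..<r1} = at_right 0"
      by (rule at_within_nhd[of 0 "{- 1<..<r1}"]) (use r1 in auto)
    finally show ?thesis .
  qed
  have pos: "cmod (h s - h t) \<le> L * \<bar>s - t\<bar>" if "0 < s" "s < r1" "0 < t" "t < r1" for s t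
    using lipschitz_onD[OF r0(2), of s t] that by (simp add: r1_def dist_norm)
  \<comment> \<open>Let one argument of the bound on the open interval tend to 0.\<close>
  have zero: "cmod (h 0 - h t) \<le> L * \<bar>0 - t\<bar>" if "0 < t" "t < r1" for t
  proof (rule tendsto_le)
    show "((\<lambda>s. cmod (h s - h t)) \<longlongrightarrow> cmod (h 0 - h t)) (at_right 0)" by (intro tendsto_intros h0)
    show "((\<lambda>s. L * \<bar>s - t\<bar>) \<longlongrightarrow> L * \<bar>0 - t\<bar>) (at_right 0)" by (intro tendsto_intros)
    show "\<forall>\<^sub>F s in at_right 0. cmod (h s - h t) \<le> L * \<bar>s - t\<bar>"
      using eventually_at_right_real[OF r1] by eventually_elim (use pos that in auto)
  qed simp
  have lip: "cmod (h s - h t) \<le> L * \<bar>s - t\<bar>" if st: "0 \<le> s" "s < r1" "0 \<le> t" "t < r1" for s t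
  proof -
    consider "s = 0" "t = 0" | "s = 0" "t > 0" | "s > 0" "t = 0" | "s > 0" "t > 0" using st by fastforce
    then show ?thesis
    proof cases
      case 3
      then show ?thesis using zero[of s] st by (simp add: norm_minus_commute)
    qed (use zero[of t] pos[of s t] st in auto)
  qed
  show ?thesis
  proof (rule that[of N L "r1 ^ N"])
    fix x y :: real assume xy: "0 \<le> x" "x < r1 ^ N" "0 \<le> y" "y < r1 ^ N"
    have "root N z < r1 \<and> 0 \<le> root N z \<and> root N z ^ N = z" if "0 \<le> z" "z < r1 ^ N" for z
    proof -
      have "root N z < root N (r1 ^ N)" using N(1) that by simp
      then show ?thesis using N(1) that r1 by (simp add: real_root_power_cancel)
    qed
    from this[OF xy(1,2)] this[OF xy(3,4)] lip[of "root N x" "root N y"]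
    show "cmod (\<Lambda> i (t0 + \<sigma> * x) - \<Lambda> i (t0 + \<sigma> * y)) \<le> L * \<bar>root N x - root N y\<bar>"
      by (simp add: h_def)
  qed (use N L0 r1 in auto)
qed

section \<open>Absolute continuity of roots of the distance\<close>

text \<open>A monotone map sends non-overlapping intervals to non-overlapping intervals in
  \<open>{lo..hi}\<close>; the sum of increments is the Lebesgue measure of their union.\<close>

lemma sum_increments_le:
  fixes T :: "real \<Rightarrow> real"
  assumes "mono T" "\<And>x. T x \<in> {lo..hi}" "\<forall>i<m. u i \<le> v i"
    and disj: "disjoint_family_on (\<lambda>i. {u i<..<v i}) {..<m::nat}"
  shows "(\<Sum>i<m. T (v i) - T (u i)) \<le> hi - lo"
proof -
  let ?A = "\<lambda>i. {T (u i)<..<T (v i)}"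
  have le: "T (u i) \<le> T (v i)" if "i < m" for i using assms(1,3) that by (auto dest: monoD)
  have sep: "T (v i) \<le> T (u j)" if "v i \<le> u j" for i j using monoD[OF assms(1) that] .
  have disjA: "disjoint_family_on ?A {..<m}"
    unfolding disjoint_family_on_def
  proof (intro ballI impI equals0I)
    fix i j y assume ij: "i \<in> {..<m}" "j \<in> {..<m}" "i \<noteq> j" and y: "y \<in> ?A i \<inter> ?A j"
    have "{u i<..<v i} \<inter> {u j<..<v j} = {}" using disj ij by (auto simp: disjoint_family_on_def)
    then have "{max (u i) (u j)<..<min (v i) (v j)} = {}" by auto
    then have "min (v i) (v j) \<le> max (u i) (u j)" by simp
    \<comment> \<open>The first and last alternatives are degenerate intervals, whose image interval
      is empty.\<close>
    then consider "v i \<le> u i" | "v i \<le> u j" | "v j \<le> u i" | "v j \<le> u j"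
      by (auto simp: min_le_iff_disj le_max_iff_disj)
    then show False using y sep[of i i] sep[of i j] sep[of j i] sep[of j j] by cases auto
  qed
  have "(\<Sum>i<m. T (v i) - T (u i)) = (\<Sum>i<m. measure lborel (?A i))" using le by simp
  also have "\<dots> = measure lborel (\<Union>i<m. ?A i)"
    by (rule measure_finite_Union[symmetric]) (use disjA le in auto)
  also have "\<dots> \<le> measure lborel {lo..hi}"
  proof (rule measure_mono_fmeasurable)
    show "(\<Union>i<m. ?A i) \<subseteq> {lo..hi}"
    proof
      fix y assume "y \<in> (\<Union>i<m. ?A i)"
      then obtain i where "T (u i) < y" "y < T (v i)" by auto
      moreover have "lo \<le> T (u i)" "T (v i) \<le> hi" using assms(2) by auto
      ultimately show "y \<in> {lo..hi}" by simp
    qed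
    show "{lo..hi} \<in> fmeasurable lborel" by (rule fmeasurableI) (auto simp: emeasure_lborel_Icc_eq)
  qed auto
  also have "\<dots> = hi - lo" using assms(2)[of 0] by simp
  finally show ?thesis .
qed

text \<open>With \<open>p\<close> and \<open>q\<close> the roots of \<open>x\<close> and
  \<open>y\<close>, the difference \<open>q ^ N - p ^ N\<close> is at least
  \<open>(q - p) * q ^ (N - 1)\<close>, and \<open>q \<ge> g\<close>.\<close>

lemma root_diff_le:
  assumes "N \<ge> 1" "0 < g" "g ^ N \<le> x" "x \<le> y"
  shows "root N y - root N x \<le> (y - x) / g ^ (N - 1)"
proof -
  obtain k where k: "N = Suc k" using assms(1) by (cases N) auto
  have x0: "0 < x" using assms by (meson less_le_trans zero_less_power)
  define p where "p = root N x"
  define q where "q = root N y"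
  have "root N (g ^ N) \<le> p" using assms by (simp add: p_def)
  then have p: "g \<le> p" "p ^ N = x" using assms x0 by (auto simp: p_def real_root_power_cancel)
  have q: "p \<le> q" "q ^ N = y" using assms x0 by (auto simp: p_def q_def)
  have "(q - p) * g ^ k \<le> (q - p) * q ^ k"
    using p q assms by (intro mult_left_mono power_mono) auto
  also have "\<dots> \<le> (q - p) * q ^ k + p * (q ^ k - p ^ k)"
    using p q assms power_mono[of p q k] by simp
  also have "\<dots> = y - x" unfolding p(2)[symmetric] q(2)[symmetric] k by (simp add: algebra_simps)
  finally show ?thesis using assms(2) by (simp add: p_def q_def k le_divide_eq)
qed

text \<open>Near the singularity the total increment is small by monotonicity, away from it the function
  is Lipschitz.\<close>

lemma root_increments_small:
  assumes N: "N \<ge> 1" and \<epsilon>: "\<epsilon> > 0"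
  obtains \<delta> where "\<delta> > 0" "\<And>m u v. \<forall>i<m. u i \<le> v i \<Longrightarrow>
    disjoint_family_on (\<lambda>i. {u i<..<v i}) {..<m::nat} \<Longrightarrow> (\<Sum>i<m. v i - u i) < \<delta> \<Longrightarrow>
    (\<Sum>i<m. root N (max 0 (v i)) - root N (max 0 (u i))) < \<epsilon>"
proof -
  \<comment> \<open>The cut is placed where the root equals half of \<open>\<epsilon>\<close>, so
    the part below the cut contributes at most that half.\<close>
  define g where "g = \<epsilon> / 2"
  have g: "g > 0" using \<epsilon> by (simp add: g_def)
  define \<eta> where "\<eta> = g ^ N"
  have \<eta>: "\<eta> > 0" "root N \<eta> = g" using g N by (auto simp: \<eta>_def real_root_power_cancel)
  define T where "T x = root N (min \<eta> (max 0 x))" for x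
  have split: "root N (max 0 x) = T x + (root N (max \<eta> x) - g)" for x
    using \<eta> by (cases "x \<le> \<eta>") (auto simp: T_def max_def min_def)
  have T: "mono T" "T x \<in> {0..g}" for x
  proof -
    show "mono T" by (rule monoI) (use N in \<open>auto simp: T_def\<close>)
    have "root N (min \<eta> (max 0 x)) \<le> root N \<eta>" using N by simp
    moreover have "0 \<le> root N (min \<eta> (max 0 x))" using N \<eta>(1) by (intro real_root_ge_zero) auto
    ultimately show "T x \<in> {0..g}" using \<eta> by (simp add: T_def)
  qed
  show ?thesis
  \<comment> \<open>Above the cut the root is Lipschitz with constant
    \<open>1 / g ^ (N - 1)\<close>, so this total length leaves less than the other half.\<close>
  proof (rule that[of "g * g ^ (N - 1)"])
    show "g * g ^ (N - 1) > 0" using g by simp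
    fix m u v assume uv: "\<forall>i<m. u i \<le> v i" "disjoint_family_on (\<lambda>i. {u i<..<v i}) {..<m::nat}"
      and small: "(\<Sum>i<m. v i - u i) < g * g ^ (N - 1)"
    have "(\<Sum>i<m. root N (max 0 (v i)) - root N (max 0 (u i))) =
        (\<Sum>i<m. T (v i) - T (u i)) + (\<Sum>i<m. root N (max \<eta> (v i)) - root N (max \<eta> (u i)))"
      unfolding sum.distrib[symmetric] by (rule sum.cong) (auto simp: split)
    also have "(\<Sum>i<m. T (v i) - T (u i)) \<le> g - 0" by (rule sum_increments_le[OF T uv])
    also have "(\<Sum>i<m. root N (max \<eta> (v i)) - root N (max \<eta> (u i))) \<le> (\<Sum>i<m. (v i - u i) / g ^ (N - 1))"
    proof (rule sum_mono)
      fix i assume "i \<in> {..<m}"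
      then have i: "u i \<le> v i" using uv by auto
      have "root N (max \<eta> (v i)) - root N (max \<eta> (u i)) \<le> (max \<eta> (v i) - max \<eta> (u i)) / g ^ (N - 1)"
        by (rule root_diff_le[OF N g]) (use i in \<open>auto simp: \<eta>_def\<close>)
      also have "\<dots> \<le> (v i - u i) / g ^ (N - 1)" using g i by (intro divide_right_mono) auto
      finally show "root N (max \<eta> (v i)) - root N (max \<eta> (u i)) \<le> (v i - u i) / g ^ (N - 1)" .
    qed
    also have "(\<Sum>i<m. (v i - u i) / g ^ (N - 1)) = (\<Sum>i<m. v i - u i) / g ^ (N - 1)"
      by (simp add: sum_divide_distrib)
    also have "\<dots> < g" using small g by (simp add: divide_less_eq)
    finally show "(\<Sum>i<m. root N (max 0 (v i)) - root N (max 0 (u i))) < \<epsilon>" by (simp add: g_def)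
  qed
qed

text \<open>The increments of \<open>f\<close> are dominated by those of two monotone functions, one
  for each side of \<open>t0\<close>. Translation and the reflection \<open>x\<close> to
  \<open>t0 - x\<close>, which swaps endpoints, reduce both to the root at 0.\<close>

lemma abs_continuous_on_root_majorant:
  assumes N: "N1 \<ge> 1" "N2 \<ge> 1" and L: "L1 \<ge> 0" "L2 \<ge> 0"
    and maj: "\<And>u v. u \<in> S \<Longrightarrow> v \<in> S \<Longrightarrow> u \<le> v \<Longrightarrow> cmod (f v - f u) \<le>
      L1 * (root N1 (max 0 (v - t0)) - root N1 (max 0 (u - t0))) +
      L2 * (root N2 (max 0 (t0 - u)) - root N2 (max 0 (t0 - v)))"
  shows "abs_continuous_on S f"
  unfolding abs_continuous_on_def
proof (intro allI impI)
  fix \<epsilon> :: real assume \<epsilon>: "\<epsilon> > 0"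
  \<comment> \<open>The summand 1 avoids division by zero when both constants vanish and makes the
    final estimate strict.\<close>
  define \<epsilon>' where "\<epsilon>' = \<epsilon> / (L1 + L2 + 1)"
  have \<epsilon>': "\<epsilon>' > 0" using \<epsilon> L by (simp add: \<epsilon>'_def)
  obtain \<delta>1 where \<delta>1: "\<delta>1 > 0" "\<And>m u v. \<forall>i<m. u i \<le> v i \<Longrightarrow>
    disjoint_family_on (\<lambda>i. {u i<..<v i}) {..<m::nat} \<Longrightarrow> (\<Sum>i<m. v i - u i) < \<delta>1 \<Longrightarrow>
    (\<Sum>i<m. root N1 (max 0 (v i)) - root N1 (max 0 (u i))) < \<epsilon>'"
    using root_increments_small[OF N(1) \<epsilon>'] by blast
  obtain \<delta>2 where \<delta>2: "\<delta>2 > 0" "\<And>m u v. \<forall>i<m. u i \<le> v i \<Longrightarrow>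
    disjoint_family_on (\<lambda>i. {u i<..<v i}) {..<m::nat} \<Longrightarrow> (\<Sum>i<m. v i - u i) < \<delta>2 \<Longrightarrow>
    (\<Sum>i<m. root N2 (max 0 (v i)) - root N2 (max 0 (u i))) < \<epsilon>'"
    using root_increments_small[OF N(2) \<epsilon>'] by blast
  show "\<exists>\<delta>>0. \<forall>(m::nat) u v. (\<forall>i<m. u i \<le> v i \<and> {u i..v i} \<subseteq> S) \<and>
        disjoint_family_on (\<lambda>i. {u i<..<v i}) {..<m} \<and> (\<Sum>i<m. v i - u i) < \<delta> \<longrightarrow>
        (\<Sum>i<m. dist (f (v i)) (f (u i))) < \<epsilon>"
  proof (intro exI[of _ "min \<delta>1 \<delta>2"] conjI allI impI)
    show "min \<delta>1 \<delta>2 > 0" using \<delta>1 \<delta>2 by simp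
    fix m :: nat and u v :: "nat \<Rightarrow> real"
    assume "(\<forall>i<m. u i \<le> v i \<and> {u i..v i} \<subseteq> S) \<and>
        disjoint_family_on (\<lambda>i. {u i<..<v i}) {..<m} \<and> (\<Sum>i<m. v i - u i) < min \<delta>1 \<delta>2"
    then have uv: "\<And>i. i < m \<Longrightarrow> u i \<le> v i" "\<And>i. i < m \<Longrightarrow> {u i..v i} \<subseteq> S"
      and disj: "disjoint_family_on (\<lambda>i. {u i<..<v i}) {..<m}"
      and small: "(\<Sum>i<m. v i - u i) < min \<delta>1 \<delta>2" by auto
    define X1 where "X1 = (\<Sum>i<m. root N1 (max 0 (v i - t0)) - root N1 (max 0 (u i - t0)))"
    define X2 where "X2 = (\<Sum>i<m. root N2 (max 0 (t0 - u i)) - root N2 (max 0 (t0 - v i)))"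
    have "X1 < \<epsilon>'" unfolding X1_def
    proof (rule \<delta>1(2))
      show "disjoint_family_on (\<lambda>i. {u i - t0<..<v i - t0}) {..<m}"
        unfolding disjoint_family_on_def
      proof (intro ballI impI equals0I)
        fix i j y assume "i \<in> {..<m}" "j \<in> {..<m}" "i \<noteq> j" "y \<in> {u i - t0<..<v i - t0} \<inter> {u j - t0<..<v j - t0}"
        then have "y + t0 \<in> {u i<..<v i} \<inter> {u j<..<v j}" by auto
        with disj \<open>i \<in> {..<m}\<close> \<open>j \<in> {..<m}\<close> \<open>i \<noteq> j\<close> show False unfolding disjoint_family_on_def by blast
      qed
    qed (use uv small in auto)
    moreover have "X2 < \<epsilon>'" unfolding X2_def
    proof (rule \<delta>2(2))
      show "disjoint_family_on (\<lambda>i. {t0 - v i<..<t0 - u i}) {..<m}"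
        unfolding disjoint_family_on_def
      proof (intro ballI impI equals0I)
        fix i j y assume "i \<in> {..<m}" "j \<in> {..<m}" "i \<noteq> j" "y \<in> {t0 - v i<..<t0 - u i} \<inter> {t0 - v j<..<t0 - u j}"
        then have "t0 - y \<in> {u i<..<v i} \<inter> {u j<..<v j}" by auto
        with disj \<open>i \<in> {..<m}\<close> \<open>j \<in> {..<m}\<close> \<open>i \<noteq> j\<close> show False unfolding disjoint_family_on_def by blast
      qed
    qed (use uv small in auto)
    ultimately have X: "L1 * X1 \<le> L1 * \<epsilon>'" "L2 * X2 \<le> L2 * \<epsilon>'" using L by (auto intro: mult_left_mono)
    have "(\<Sum>i<m. dist (f (v i)) (f (u i))) \<le> (\<Sum>i<m.
        L1 * (root N1 (max 0 (v i - t0)) - root N1 (max 0 (u i - t0))) +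
        L2 * (root N2 (max 0 (t0 - u i)) - root N2 (max 0 (t0 - v i))))"
    proof (rule sum_mono)
      fix i assume "i \<in> {..<m}"
      then have "u i \<in> S" "v i \<in> S" "u i \<le> v i" using uv[of i] by auto
      from maj[OF this] show "dist (f (v i)) (f (u i)) \<le>
        L1 * (root N1 (max 0 (v i - t0)) - root N1 (max 0 (u i - t0))) +
        L2 * (root N2 (max 0 (t0 - u i)) - root N2 (max 0 (t0 - v i)))" by (simp add: dist_norm)
    qed
    also have "\<dots> = L1 * X1 + L2 * X2" by (simp add: X1_def X2_def sum.distrib sum_distrib_left)
    also have "\<dots> \<le> (L1 + L2) * \<epsilon>'" using X by (simp add: distrib_right)
    also have "\<dots> < (L1 + L2 + 1) * \<epsilon>'" using \<epsilon>' by (simp add: distrib_right)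
    also have "\<dots> = \<epsilon>" using L by (simp add: \<epsilon>'_def)
    finally show "(\<Sum>i<m. dist (f (v i)) (f (u i))) < \<epsilon>" .
  qed
qed

theorem corollary3p4:
  fixes I :: "real set" and n :: nat and a \<Lambda> :: "nat \<Rightarrow> real \<Rightarrow> complex"
  assumes "is_interval I"
    and "(\<forall>j\<in>{1..n}. real_analytic_on (a j) I) \<or>
         (\<exists>Q. quasianalytic_class I Q \<and> (\<forall>j\<in>{1..n}. a j \<in> Q))"
    and "continuous_root_parameterization I n (monic_poly_curve n a) \<Lambda>"
  shows "\<forall>j\<in>{1..n}. locally_abs_continuous_on I (\<Lambda> j)"
  unfolding locally_abs_continuous_on_def
proof (intro ballI)
  fix j t0 assume j: "j \<in> {1..n}" and t0: "t0 \<in> I"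
  obtain N1 L1 r1 where 1: "N1 \<ge> (1::nat)" "L1 \<ge> (0::real)" "r1 > 0"
    "\<And>x y. 0 \<le> x \<Longrightarrow> x < r1 \<Longrightarrow> 0 \<le> y \<Longrightarrow> y < r1 \<Longrightarrow> t0 + 1 * x \<in> I \<Longrightarrow> t0 + 1 * y \<in> I \<Longrightarrow>
       cmod (\<Lambda> j (t0 + 1 * x) - \<Lambda> j (t0 + 1 * y)) \<le> L1 * \<bar>root N1 x - root N1 y\<bar>"
    using one_sided_root_bound[OF assms(1,3,2) t0 _ j, of 1] by (metis abs_one)
  obtain N2 L2 r2 where 2: "N2 \<ge> (1::nat)" "L2 \<ge> (0::real)" "r2 > 0"
    "\<And>x y. 0 \<le> x \<Longrightarrow> x < r2 \<Longrightarrow> 0 \<le> y \<Longrightarrow> y < r2 \<Longrightarrow> t0 + - 1 * x \<in> I \<Longrightarrow> t0 + - 1 * y \<in> I \<Longrightarrow>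
       cmod (\<Lambda> j (t0 + - 1 * x) - \<Lambda> j (t0 + - 1 * y)) \<le> L2 * \<bar>root N2 x - root N2 y\<bar>"
    using one_sided_root_bound[OF assms(1,3,2) t0 _ j, of "- 1"] by (metis abs_one abs_minus)
  define r where "r = min r1 r2"
  have right: "cmod (\<Lambda> j v - \<Lambda> j u) \<le> L1 * (root N1 (v - t0) - root N1 (u - t0))"
    if "u \<in> I \<inter> ball t0 r" "v \<in> I \<inter> ball t0 r" "t0 \<le> u" "u \<le> v" for u v
  proof -
    have "root N1 (u - t0) \<le> root N1 (v - t0)" using 1(1) that by simp
    then show ?thesis using 1(4)[of "v - t0" "u - t0"] that by (auto simp: r_def dist_real_def)
  qed
  have left: "cmod (\<Lambda> j v - \<Lambda> j u) \<le> L2 * (root N2 (t0 - u) - root N2 (t0 - v))"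
    if "u \<in> I \<inter> ball t0 r" "v \<in> I \<inter> ball t0 r" "u \<le> v" "v \<le> t0" for u v
  proof -
    have "root N2 (t0 - v) \<le> root N2 (t0 - u)" using 2(1) that by simp
    then show ?thesis using 2(4)[of "t0 - v" "t0 - u"] that by (auto simp: r_def dist_real_def)
  qed
  have "r > 0" using 1 2 by (simp add: r_def)
  have "abs_continuous_on (I \<inter> ball t0 r) (\<Lambda> j)"
  proof (rule abs_continuous_on_root_majorant[OF 1(1) 2(1) 1(2) 2(2)])
    fix u v assume uv: "u \<in> I \<inter> ball t0 r" "v \<in> I \<inter> ball t0 r" "u \<le> v"
    have mid: "t0 \<in> I \<inter> ball t0 r" using t0 \<open>r > 0\<close> by simp
    consider "t0 \<le> u" | "v \<le> t0" | "u < t0" "t0 < v" by linarith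
    then show "cmod (\<Lambda> j v - \<Lambda> j u) \<le>
      L1 * (root N1 (max 0 (v - t0)) - root N1 (max 0 (u - t0))) +
      L2 * (root N2 (max 0 (t0 - u)) - root N2 (max 0 (t0 - v)))"
    proof cases
      case 1
      then show ?thesis using right[OF uv(1,2) 1 uv(3)] uv(3) by (simp add: max_absorb1 max_absorb2)
    next
      case 2
      then show ?thesis using left[OF uv 2] uv(3) by (simp add: max_absorb1 max_absorb2)
    next
      case 3
      \<comment> \<open>An interval straddling \<open>t0\<close> is split there; each half is
        controlled by the bound of its own side, possibly with different exponents.\<close>
      have "cmod (\<Lambda> j v - \<Lambda> j u) \<le> cmod (\<Lambda> j v - \<Lambda> j t0) + cmod (\<Lambda> j t0 - \<Lambda> j u)"
        using norm_triangle_ineq[of "\<Lambda> j v - \<Lambda> j t0" "\<Lambda> j t0 - \<Lambda> j u"] by simp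
      also have "\<dots> \<le> L1 * (root N1 (v - t0) - root N1 (t0 - t0)) + L2 * (root N2 (t0 - u) - root N2 (t0 - t0))"
        using right[OF mid uv(2)] left[OF uv(1) mid] 3 by (intro add_mono) auto
      finally show ?thesis using 3 by (simp add: max_absorb1 max_absorb2)
    qed
  qed
  with \<open>r > 0\<close> show "\<exists>r>0. abs_continuous_on (I \<inter> ball t0 r) (\<Lambda> j)" by blast
qed

end
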